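(* Let $\mathcal{M}=G/H$ be a reductive homogeneous space with reductive complement $\mathfrak{m}$, let $c_0\in\mathcal{M}$, and let $\omega\colon T\mathcal{M}\to\mathfrak{g}$ be the $\mathfrak{g}$-valued $1$-form on $\mathcal{M}$ determined by $\mathfrak{m}$, with $\theta_\omega\colon C^\infty(I,T\mathcal{M})\to C^\infty(I,\mathfrak{g})$, $f\mapsto\omega\circ f$. Consider $D\colon C^\infty_{c_0}(I,\mathcal{M})\to C^\infty(I,T\mathcal{M})$, $c\mapsto\dot c$. Then $$\rho_{c_0}\circ\theta_\omega\circ D=\mathrm{id}_{C^\infty_{c_0}(I,\mathcal{M})}.$$
   Context: $G$ is a finite-dimensional Lie group with identity $e$ and Lie algebra $\mathfrak{g}=T_eG$; $H\subseteq G$ is a closed Lie subgroup with Lie algebra $\mathfrak{h}$; $\mathcal{M}=G/H$ carries the manifold structure making $\pi\colon G\to G/H$, $g\mapsto gH$, a submersion. $\Lambda\colon G\times\mathcal{M}\to\mathcal{M}$, $(g,kH)\mapsto(gk)H$, with $\Lambda_{c_0}(g)=\Lambda^g(c_0)=\Lambda(g,c_0)$. $I=[0,1]$; $C^\infty_{c_0}(I,\mathcal{M})$ is the set of smooth curves $c\colon I\to\mathcal{M}$ with $c(0)=c_0$. $\mathcal{M}$ is reductive: $\mathfrak{m}\subseteq\mathfrak{g}$ is a fixed vector subspace with $\mathfrak{g}=\mathfrak{h}\oplus\mathfrak{m}$ and $\mathrm{Ad}(h).\mathfrak{m}\subseteq\mathfrak{m}$ for all $h\in H$ (a reductive complement).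 Let $\omega_e\colon T_{eH}\mathcal{M}\to\mathfrak{m}$ be the inverse of the isomorphism $T_e\pi|_{\mathfrak{m}}\colon\mathfrak{m}\to T_{eH}\mathcal{M}$. The $1$-form is $\omega(v)=\mathrm{Ad}(g).\omega_e(T\Lambda^{g^{-1}}(v))$ for $v\in T_{gH}\mathcal{M}$; it is well defined (independent of the representative $g$ of $gH$). $\mathrm{Evol}\colon C^\infty(I,\mathfrak{g})\to\{g\in C^\infty(I,G): g(0)=e\}$ sends $q$ to the solution $g$ of $\dot g(t)=T_eR_{g(t)}(q(t))$, $g(0)=e$, where $R_g$ is right multiplication by $g$. $\rho_{c_0}\colon C^\infty(I,\mathfrak{g})\to C^\infty_{c_0}(I,\mathcal{M})$ is $\rho_{c_0}(q)(t)=\Lambda_{c_0}(\mathrm{Evol}(q)(t))$. *)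

theory Defs
  imports "HOL-Analysis.Analysis" "HOL-Algebra.Left_Coset"
begin

section \<open>Smooth maps between normed spaces\<close>

text \<open>
  \<open>Ck_on k f S\<close>, intended for open \<open>S\<close> and a finite-dimensional domain: \<open>f\<close> is of class \<open>C^k\<close>.
\<close>

primrec Ck_on :: "nat \<Rightarrow> ('a::real_normed_vector \<Rightarrow> 'b::real_normed_vector) \<Rightarrow> 'a set \<Rightarrow> bool" where
  "Ck_on 0 f S \<longleftrightarrow> continuous_on S f"
| "Ck_on (Suc k) f S \<longleftrightarrow>
    (\<forall>x\<in>S. f differentiable (at x)) \<and> (\<forall>v. Ck_on k (\<lambda>x. frechet_derivative f (at x) v) S)"

text \<open>
  On an arbitrary set, smooth means: locally the restriction of a smooth map on an open set. For
  open \<open>S\<close> this is ordinary smoothness; for subintervals of the line it is smoothness up to the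
  boundary points they contain.
\<close>

definition smooth_on :: "'a::real_normed_vector set \<Rightarrow> ('a \<Rightarrow> 'b::real_normed_vector) \<Rightarrow> bool" where
  "smooth_on S f \<longleftrightarrow>
    (\<forall>x\<in>S. \<exists>W F. open W \<and> x \<in> W \<and> (\<forall>k. Ck_on k F W) \<and> (\<forall>y\<in>S \<inter> W. f y = F y))"


section \<open>Smooth manifolds\<close>

text \<open>
  A manifold is given by an atlas, which determines the underlying set and the topology. The model
  space is a Banach space \<open>'e\<close>, required to be finite-dimensional in \<open>smooth_manifold\<close> below. The
  sort \<open>euclidean_space\<close> would exclude manifolds of dimension 0 (such as \<open>G/H\<close> with \<open>H\<close> open);
  \<open>banach\<close> does not, and it excludes no finite-dimensional normed space.
\<close>

type_synonym ('p, 'e) chart = "'p set \<times> ('p \<Rightarrow> 'e)"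
type_synonym ('p, 'e) atlas = "('p, 'e) chart set"

definition points_of :: "('p, 'e) atlas \<Rightarrow> 'p set" where
  "points_of A = \<Union> (fst ` A)"

definition smooth_atlas :: "('p, 'e::banach) atlas \<Rightarrow> bool" where
  "smooth_atlas A \<longleftrightarrow>
    (\<forall>(U, \<phi>)\<in>A. inj_on \<phi> U) \<and>
    (\<forall>(U, \<phi>)\<in>A. \<forall>(V, \<psi>)\<in>A.
      open (\<phi> ` (U \<inter> V)) \<and> smooth_on (\<phi> ` (U \<inter> V)) (\<psi> \<circ> inv_into U \<phi>))"

definition maximal_atlas :: "('p, 'e::banach) atlas \<Rightarrow> ('p, 'e) atlas" where
  "maximal_atlas A = {(U, \<phi>). U \<subseteq> points_of A \<and> smooth_atlas (insert (U, \<phi>) A)}"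

definition mtopology :: "('p, 'e::banach) atlas \<Rightarrow> 'p topology" where
  "mtopology A = topology (\<lambda>W. W \<subseteq> points_of A \<and> (\<forall>(U, \<phi>)\<in>A. open (\<phi> ` (W \<inter> U))))"

lemma openin_mtopology:
  assumes "smooth_atlas A"
  shows "openin (mtopology A) W \<longleftrightarrow> W \<subseteq> points_of A \<and> (\<forall>(U, \<phi>)\<in>A. open (\<phi> ` (W \<inter> U)))"
proof -
  have inj: "inj_on \<phi> U" if "(U, \<phi>) \<in> A" for U \<phi>
    using assms that unfolding smooth_atlas_def by blast
  let ?P = "\<lambda>W. W \<subseteq> points_of A \<and> (\<forall>(U, \<phi>)\<in>A. open (\<phi> ` (W \<inter> U)))"
  have top: "istopology ?P"
    unfolding istopology_def
  proof (rule conjI; intro allI impI)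
    fix S T
    assume S: "?P S" and T: "?P T"
    have "open (\<phi> ` (S \<inter> T \<inter> U))" if c: "(U, \<phi>) \<in> A" for U \<phi>
    proof -
      have "\<phi> ` (S \<inter> T \<inter> U) = \<phi> ` (S \<inter> U) \<inter> \<phi> ` (T \<inter> U)"
        using inj_on_image_Int[OF inj[OF c], of "S \<inter> U" "T \<inter> U"] by (simp add: Int_ac)
      then show ?thesis
        using S T c by fastforce
    qed
    then show "?P (S \<inter> T)"
      using S by blast
  next
    fix \<K>
    assume K: "\<forall>K\<in>\<K>. ?P K"
    have "open (\<phi> ` (\<Union>\<K> \<inter> U))" if c: "(U, \<phi>) \<in> A" for U \<phi>
    proof -
      have "\<phi> ` (\<Union>\<K> \<inter> U) = (\<Union>K\<in>\<K>. \<phi> ` (K \<inter> U))"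
        by blast
      then show ?thesis
        using K c by fastforce
    qed
    then show "?P (\<Union>\<K>)"
      using K by blast
  qed
  show ?thesis
    unfolding mtopology_def topology_inverse'[OF top] by (rule refl)
qed

text \<open>Second countability is not required.\<close>

locale smooth_manifold =
  fixes A :: "('p, 'e::banach) atlas"
  assumes finite_dim: "\<exists>B::'e set. finite B \<and> span B = UNIV"
    and smooth_atlas: "smooth_atlas A"
    and Hausdorff: "Hausdorff_space (mtopology A)"

definition smooth_map ::
    "('p, 'e::banach) atlas \<Rightarrow> ('q, 'f::banach) atlas \<Rightarrow> ('p \<Rightarrow> 'q) \<Rightarrow> bool" where
  "smooth_map A B f \<longleftrightarrow>
    f ` points_of A \<subseteq> points_of B \<and>
    (\<forall>p\<in>points_of A. \<exists>(U, \<phi>)\<in>A. \<exists>(V, \<psi>)\<in>B. \<exists>W. openin (mtopology A) W \<and> p \<in> W \<and> W \<subseteq> U \<and> f ` W \<subseteq> V \<and>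
      smooth_on (\<phi> ` W) (\<psi> \<circ> f \<circ> inv_into U \<phi>))"

definition prod_atlas :: "('p, 'e) atlas \<Rightarrow> ('q, 'f) atlas \<Rightarrow> ('p \<times> 'q, 'e \<times> 'f) atlas" where
  "prod_atlas A B = (\<lambda>((U, \<phi>), (V, \<psi>)). (U \<times> V, map_prod \<phi> \<psi>)) ` (A \<times> B)"


section \<open>Tangent vectors\<close>

text \<open>
  The tangent space at \<open>p\<close> is the model space: a tangent vector is represented by its coordinates
  in one chart around \<open>p\<close>, chosen once and for all for each \<open>p\<close>. Hence the tangent bundle is the
  set of all \<open>(p, u)\<close> with \<open>p \<in> points_of A\<close> and \<open>u :: 'e\<close>, and derivatives and velocities are computed
  in the chosen charts.
\<close>

definition chart_at :: "('p, 'e) atlas \<Rightarrow> 'p \<Rightarrow> ('p, 'e) chart" where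
  "chart_at A p = (SOME c. c \<in> A \<and> p \<in> fst c)"

definition chart_map :: "('p, 'e) atlas \<Rightarrow> 'p \<Rightarrow> 'p \<Rightarrow> 'e" where
  "chart_map A p = snd (chart_at A p)"

definition chart_inv :: "('p, 'e) atlas \<Rightarrow> 'p \<Rightarrow> 'e \<Rightarrow> 'p" where
  "chart_inv A p = inv_into (fst (chart_at A p)) (chart_map A p)"

text \<open>The differential \<open>T\<^sub>p f\<close>, a map from the tangent space at \<open>p\<close> to the one at \<open>f p\<close>.\<close>

definition tderiv ::
    "('p, 'e::banach) atlas \<Rightarrow> ('q, 'f::banach) atlas \<Rightarrow> ('p \<Rightarrow> 'q) \<Rightarrow> 'p \<Rightarrow> 'e \<Rightarrow> 'f" where
  "tderiv A B f p =
    frechet_derivative (chart_map B (f p) \<circ> f \<circ> chart_inv A p) (at (chart_map A p p))"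

definition tangent_map ::
    "('p, 'e::banach) atlas \<Rightarrow> ('q, 'f::banach) atlas \<Rightarrow> ('p \<Rightarrow> 'q) \<Rightarrow> 'p \<times> 'e \<Rightarrow> 'q \<times> 'f" where
  "tangent_map A B f = (\<lambda>(p, u). (f p, tderiv A B f p u))"

text \<open>
  The chart \<open>T\<phi>\<close> of the tangent bundle induced by a chart \<open>\<phi>\<close> first converts the coordinates of a
  tangent vector from the chosen chart to \<open>\<phi>\<close>.
\<close>

definition tangent_atlas :: "('p, 'e::banach) atlas \<Rightarrow> ('p \<times> 'e, 'e \<times> 'e) atlas" where
  "tangent_atlas A =
    (\<lambda>(U, \<phi>). (U \<times> UNIV,
      \<lambda>(p, u). (\<phi> p, frechet_derivative (\<phi> \<circ> chart_inv A p) (at (chart_map A p p)) u))) ` A"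


section \<open>Curves\<close>

definition smooth_curve :: "('p, 'e::banach) atlas \<Rightarrow> real set \<Rightarrow> (real \<Rightarrow> 'p) \<Rightarrow> bool" where
  "smooth_curve A J c \<longleftrightarrow>
    (\<forall>t\<in>J. \<exists>(U, \<phi>)\<in>A. \<exists>\<epsilon>>0. c ` (J \<inter> ball t \<epsilon>) \<subseteq> U \<and> smooth_on (J \<inter> ball t \<epsilon>) (\<phi> \<circ> c))"

definition velocity :: "('p, 'e::banach) atlas \<Rightarrow> real set \<Rightarrow> (real \<Rightarrow> 'p) \<Rightarrow> real \<Rightarrow> 'e" where
  "velocity A J c t = vector_derivative (chart_map A (c t) \<circ> c) (at t within J)"

abbreviation unit_int :: "real set" where
  "unit_int \<equiv> {0..1}"

text \<open>
  Functions with domain \<open>[0,1]\<close> are \<open>extensional\<close> (that is, \<open>undefined\<close> elsewhere), so that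
  equality in HOL is equality of functions on \<open>[0,1]\<close>.
\<close>

definition smooth_curves :: "('p, 'e::banach) atlas \<Rightarrow> (real \<Rightarrow> 'p) set" where
  "smooth_curves A = {c \<in> extensional unit_int. smooth_curve A unit_int c}"

definition smooth_curves_from :: "('p, 'e::banach) atlas \<Rightarrow> 'p \<Rightarrow> (real \<Rightarrow> 'p) set" where
  "smooth_curves_from A p = {c \<in> smooth_curves A. c 0 = p}"

definition smooth_vcurves :: "(real \<Rightarrow> 'e::real_normed_vector) set" where
  "smooth_vcurves = {q \<in> extensional unit_int. smooth_on unit_int q}"

definition curve_deriv :: "('p, 'e::banach) atlas \<Rightarrow> (real \<Rightarrow> 'p) \<Rightarrow> real \<Rightarrow> 'p \<times> 'e" where
  "curve_deriv A c = (\<lambda>t\<in>unit_int. (c t, velocity A unit_int c t))"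


section \<open>Submanifolds and submersions\<close>

definition submanifold :: "('p, 'e::banach) atlas \<Rightarrow> 'p set \<Rightarrow> bool" where
  "submanifold A N \<longleftrightarrow>
    N \<subseteq> points_of A \<and>
    (\<forall>p\<in>N. \<exists>(U, \<phi>)\<in>maximal_atlas A. \<exists>S. p \<in> U \<and> subspace S \<and> \<phi> ` (U \<inter> N) = \<phi> ` U \<inter> S)"

text \<open>
  The tangent space \<open>T\<^sub>p N\<close> of a submanifold \<open>N\<close>, as a subspace of \<open>T\<^sub>p A\<close>.
\<close>

definition tangent_subspace :: "('p, 'e::banach) atlas \<Rightarrow> 'p set \<Rightarrow> 'p \<Rightarrow> 'e set" where
  "tangent_subspace A N p =
    {velocity A {-\<epsilon><..<\<epsilon>} c 0 | c \<epsilon>.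
      \<epsilon> > 0 \<and> smooth_curve A {-\<epsilon><..<\<epsilon>} c \<and> c ` {-\<epsilon><..<\<epsilon>} \<subseteq> N \<and> c 0 = p}"

definition submersion ::
    "('p, 'e::banach) atlas \<Rightarrow> ('q, 'f::banach) atlas \<Rightarrow> ('p \<Rightarrow> 'q) \<Rightarrow> bool" where
  "submersion A B f \<longleftrightarrow> smooth_map A B f \<and> (\<forall>p\<in>points_of A. surj (tderiv A B f p))"


section \<open>Lie groups\<close>

locale lie_group = group G + smooth_manifold A
  for G :: "('g, 'b) monoid_scheme" (structure) and A :: "('g, 'e::banach) atlas" +
  assumes points_of_eq: "points_of A = carrier G"
    and smooth_mult: "smooth_map (prod_atlas A A) A (\<lambda>(x, y). x \<otimes> y)"
    and smooth_inv: "smooth_map A A (\<lambda>x. inv x)"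

text \<open>
  The Lie algebra of \<open>G\<close> is the tangent space at \<open>\<one>\<close>, hence the type \<open>'e\<close>; only its vector space
  structure is used.
\<close>

definition closed_lie_subgroup ::
    "('g, 'b) monoid_scheme \<Rightarrow> ('g, 'e::banach) atlas \<Rightarrow> 'g set \<Rightarrow> bool" where
  "closed_lie_subgroup G A H \<longleftrightarrow> subgroup H G \<and> closedin (mtopology A) H \<and> submanifold A H"

definition Ad ::
    "('g, 'b) monoid_scheme \<Rightarrow> ('g, 'e::banach) atlas \<Rightarrow> 'g \<Rightarrow> 'e \<Rightarrow> 'e" where
  "Ad G A g = tderiv A A (\<lambda>x. g \<otimes>\<^bsub>G\<^esub> x \<otimes>\<^bsub>G\<^esub> inv\<^bsub>G\<^esub> g) \<one>\<^bsub>G\<^esub>"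

definition Evol ::
    "('g, 'b) monoid_scheme \<Rightarrow> ('g, 'e::banach) atlas \<Rightarrow> (real \<Rightarrow> 'e) \<Rightarrow> real \<Rightarrow> 'g" where
  "Evol G A q = (THE g. g \<in> smooth_curves_from A \<one>\<^bsub>G\<^esub> \<and>
    (\<forall>t\<in>unit_int. velocity A unit_int g t = tderiv A A (\<lambda>x. x \<otimes>\<^bsub>G\<^esub> g t) \<one>\<^bsub>G\<^esub> (q t)))"


section \<open>Reductive homogeneous spaces\<close>

text \<open>The points of \<open>G/H\<close> are the left cosets of \<open>H\<close>, as subsets of \<open>G\<close>.\<close>

definition quot_proj :: "('g, 'b) monoid_scheme \<Rightarrow> 'g set \<Rightarrow> 'g \<Rightarrow> 'g set" where
  "quot_proj G H g = g <#\<^bsub>G\<^esub> H"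

definition homogeneous_space ::
    "('g, 'b) monoid_scheme \<Rightarrow> ('g, 'e::banach) atlas \<Rightarrow> 'g set \<Rightarrow> ('g set, 'f::banach) atlas \<Rightarrow> bool" where
  "homogeneous_space G A H B \<longleftrightarrow>
    smooth_manifold B \<and> points_of B = lcosets\<^bsub>G\<^esub> H \<and> submersion A B (quot_proj G H)"

text \<open>
  \<open>l_coset\<close> applied to the set \<open>p = kH\<close> translates it to \<open>gp = (gk)H\<close>.
\<close>

definition quot_act :: "('g, 'b) monoid_scheme \<Rightarrow> 'g \<Rightarrow> 'g set \<Rightarrow> 'g set" where
  "quot_act G g p = g <#\<^bsub>G\<^esub> p"

definition reductive_complement ::
    "('g, 'b) monoid_scheme \<Rightarrow> ('g, 'e::banach) atlas \<Rightarrow> 'g set \<Rightarrow> 'e set \<Rightarrow> bool" where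
  "reductive_complement G A H \<mm> \<longleftrightarrow>
    (let \<hh> = tangent_subspace A H \<one>\<^bsub>G\<^esub> in
      subspace \<mm> \<and> \<hh> \<inter> \<mm> = {0} \<and> {x + y | x y. x \<in> \<hh> \<and> y \<in> \<mm>} = UNIV \<and>
      (\<forall>h\<in>H. Ad G A h ` \<mm> \<subseteq> \<mm>))"

definition omega_e ::
    "('g, 'b) monoid_scheme \<Rightarrow> ('g, 'e::banach) atlas \<Rightarrow> 'g set \<Rightarrow> ('g set, 'f::banach) atlas \<Rightarrow>
      'e set \<Rightarrow> 'f \<Rightarrow> 'e" where
  "omega_e G A H B \<mm> = the_inv_into \<mm> (tderiv A B (quot_proj G H) \<one>\<^bsub>G\<^esub>)"

text \<open>
  The representatives of a coset are its elements. The result does not depend on which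
  representative \<open>SOME\<close> selects, because \<open>\<mm>\<close> is \<open>Ad(H)\<close>-invariant.
\<close>

definition omega ::
    "('g, 'b) monoid_scheme \<Rightarrow> ('g, 'e::banach) atlas \<Rightarrow> 'g set \<Rightarrow> ('g set, 'f::banach) atlas \<Rightarrow>
      'e set \<Rightarrow> 'g set \<times> 'f \<Rightarrow> 'e" where
  "omega G A H B \<mm> v =
    (let g = (SOME g. g \<in> fst v) in
      Ad G A g (omega_e G A H B \<mm> (snd (tangent_map B B (quot_act G (inv\<^bsub>G\<^esub> g)) v))))"

definition theta :: "('p, 'f::banach) atlas \<Rightarrow> ('p \<times> 'f \<Rightarrow> 'e) \<Rightarrow> (real \<Rightarrow> 'p \<times> 'f) \<Rightarrow> real \<Rightarrow> 'e" where
  "theta B \<omega> = (\<lambda>f\<in>smooth_curves (tangent_atlas B). \<lambda>t\<in>unit_int. \<omega> (f t))"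

definition rho ::
    "('g, 'b) monoid_scheme \<Rightarrow> ('g, 'e::banach) atlas \<Rightarrow> 'g set \<Rightarrow> (real \<Rightarrow> 'e) \<Rightarrow> real \<Rightarrow> 'g set" where
  "rho G A c\<^sub>0 = (\<lambda>q\<in>smooth_vcurves. \<lambda>t\<in>unit_int. quot_act G (Evol G A q t) c\<^sub>0)"

end

theory Submission
  imports Defs
begin

text \<open>
  Put \<open>q = \<omega>(c')\<close> and \<open>g = Evol(q)\<close>. With \<open>X = \<omega>\<^sub>e(T\<Lambda>\<^bsup>g\<inverse>\<^esup>(v))\<close>, so that \<open>\<omega>(v) = Ad(g)X\<close> for \<open>v\<close> tangent at \<open>gH\<close>,
  the infinitesimal action of \<open>\<omega>(v)\<close> at \<open>gH\<close> is \<open>T\<Lambda>\<^bsup>g\<^esup>(T\<pi> X) = v\<close>. Hence \<open>c\<close> and \<open>t \<mapsto> g(t)c\<^sub>0\<close> solve the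
  same differential equation, which means that \<open>g\<inverse>c\<close> has velocity \<open>0\<close> and is constant. The same
  argument for the action of \<open>G\<close> on itself shows that \<open>Evol\<close> is well defined, once solutions exist: locally by
  Picard-Lindeloef in a chart around the identity, globally because right translates of solutions are
  solutions. Smoothness of \<open>q\<close> comes from local lifts of \<open>c\<close> to \<open>G\<close>, given by the inverse function theorem.

  The model spaces are Banach spaces with a finite spanning set, not instances of \<open>euclidean_space\<close>, so
  the inverse function theorem of HOL-Analysis does not apply to them.
\<close>


section \<open>Smooth maps on finite-dimensional normed spaces\<close>

text \<open>A tangent vector is stored in the chart chosen at its base point, and these choices vary
  with the point without any continuity. So the velocity of a curve cannot be differentiated or
  compared between points as it stands. Two devices deal with this: derivatives are converted to one
  fixed chart (\<open>frechet_derivative_chart\<close>); and where smooth dependence has to be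
  shown, vectors are moved to the identity of the group, or to its coset, where the chosen chart is
  always the same.

  Smoothness is an iterated condition on derivatives in fixed directions. The chain rule and the
  inversion of operators produce moving directions, and coordinates with respect to a finite set
  bring them back to fixed ones.

  \<open>Evol\<close> is a definite description, and \<open>theta\<close> and \<open>rho\<close> are
  restricted to smooth arguments. Hence existence, uniqueness, smoothness of the velocity curve in
  the tangent bundle and smoothness of its image under the form must all be known before the
  composition can be evaluated. Curves on [0,1] are extended past the endpoints, which makes all
  derivatives two-sided.\<close>

text \<open>
  The coordinates are required to be bounded functionals, so that every linear map on such a space is bounded.
\<close>

definition fin_dim :: "'a::real_normed_vector itself \<Rightarrow> bool" where
  "fin_dim _ \<longleftrightarrow> (\<exists>(B::'a set) \<kappa>. finite B \<and> (\<forall>b\<in>B. bounded_linear (\<kappa> b)) \<and> (\<forall>x. x = (\<Sum>b\<in>B. \<kappa> b x *\<^sub>R b)))"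

lemma fin_dimE:
  assumes "fin_dim TYPE('a::real_normed_vector)"
  obtains B :: "'a::real_normed_vector set" and \<kappa> where "finite B" "\<And>b. b \<in> B \<Longrightarrow> bounded_linear (\<kappa> b)"
    "\<And>x. (\<Sum>b\<in>B. \<kappa> b x *\<^sub>R b) = x"
  using assms unfolding fin_dim_def by metis

text \<open>Induction on the basis. A vector outside the span of \<open>B\<close> has positive
  distance from it: the coordinates of a sequence in the span approaching it would be Cauchy by the
  induction hypothesis, and their limits would put the vector into the span. This distance bounds
  the new coordinate, and removing its term reduces the other coordinates to the old bound.\<close>

lemma coefficients_bounded:
  fixes B :: "'a::real_normed_vector set"
  assumes "finite B" "independent B"
  shows "\<exists>C\<ge>0. \<forall>a. \<forall>b\<in>B. \<bar>a b\<bar> \<le> C * norm (\<Sum>b\<in>B. a b *\<^sub>R b)"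
  using assms
proof (induction B rule: finite_induct)
  case empty
  then show ?case by (intro exI[of _ 0]) auto
next
  case (insert b0 B)
  have ind: "independent B" and b0: "b0 \<notin> span B"
    using insert by (auto simp: independent_insert)
  obtain C where C: "C \<ge> 0" "\<And>a b. b \<in> B \<Longrightarrow> \<bar>a b\<bar> \<le> C * norm (\<Sum>b\<in>B. a b *\<^sub>R b)"
    using insert.IH[OF ind] by blast
  have "\<exists>d>0. \<forall>x\<in>span B. norm (b0 - x) \<ge> d"
  proof (rule ccontr)
    assume "\<not> ?thesis"
    moreover have "1 / real (Suc n) > 0" for n by simp
    ultimately have "\<exists>x\<in>span B. norm (b0 - x) < 1 / real (Suc n)" for n
      by (meson not_le)
    then obtain x where x: "\<And>n. x n \<in> span B" "\<And>n. norm (b0 - x n) < 1 / real (Suc n)"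
      by metis
    have xl: "x \<longlonglongrightarrow> b0"
    proof (rule LIMSEQ_I)
      fix r :: real assume "r > 0"
      then obtain N where N: "1 / real (Suc N) < r" by (metis nat_approx_posE)
      have "norm (x n - b0) < r" if "n \<ge> N" for n
      proof -
        have "norm (x n - b0) < 1 / real (Suc n)" using x(2)[of n] by (simp add: norm_minus_commute)
        also have "\<dots> \<le> 1 / real (Suc N)" using that by (simp add: frac_le)
        finally show ?thesis using N by simp
      qed
      then show "\<exists>N. \<forall>n\<ge>N. norm (x n - b0) < r" by blast
    qed
    have "\<exists>u. x n = (\<Sum>b\<in>B. u b *\<^sub>R b)" for n
      using x(1)[of n] insert.hyps(1) by (auto simp: span_finite)
    then obtain u where u: "\<And>n. x n = (\<Sum>b\<in>B. u n b *\<^sub>R b)" by metis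
    have diff: "\<bar>u m b - u n b\<bar> \<le> C * norm (x m - x n)" if "b \<in> B" for m n b
      using C(2)[OF that, of "\<lambda>b. u m b - u n b"] by (simp add: u scaleR_left_diff_distrib sum_subtractf)
    have "convergent (\<lambda>n. u n b)" if "b \<in> B" for b
    proof -
      have "Cauchy x" using xl by (rule LIMSEQ_imp_Cauchy)
      have "Cauchy (\<lambda>n. u n b)"
      proof (rule CauchyI)
        fix e :: real assume "e > 0"
        \<comment> \<open>\<open>C\<close> may be 0, whence the division by
          \<open>C + 1\<close>.\<close>
        then have "e / (C + 1) > 0" using C(1) by simp
        then obtain M where M: "\<And>m n. m \<ge> M \<Longrightarrow> n \<ge> M \<Longrightarrow> norm (x m - x n) < e / (C + 1)"
          using CauchyD[OF \<open>Cauchy x\<close>] by blast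
        have "norm (u m b - u n b) < e" if "m \<ge> M" "n \<ge> M" for m n
        proof -
          have "norm (u m b - u n b) \<le> C * norm (x m - x n)" using diff[OF \<open>b \<in> B\<close>] by simp
          also have "\<dots> \<le> (C + 1) * norm (x m - x n)" by (simp add: mult_right_mono)
          also have "\<dots> < (C + 1) * (e / (C + 1))" using M[OF that] C(1) by (intro mult_strict_left_mono) auto
          finally show ?thesis using C(1) by simp
        qed
        then show "\<exists>M. \<forall>m\<ge>M. \<forall>n\<ge>M. norm (u m b - u n b) < e" by blast
      qed
      then show ?thesis by (simp add: Cauchy_convergent_iff)
    qed
    then obtain w where w: "\<And>b. b \<in> B \<Longrightarrow> (\<lambda>n. u n b) \<longlonglongrightarrow> w b"
      unfolding convergent_def by metis
    have "(\<lambda>n. \<Sum>b\<in>B. u n b *\<^sub>R b) \<longlonglongrightarrow> (\<Sum>b\<in>B. w b *\<^sub>R b)"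
      by (intro tendsto_sum tendsto_scaleR w tendsto_const)
    then have "x \<longlonglongrightarrow> (\<Sum>b\<in>B. w b *\<^sub>R b)" using u by presburger
    then have "b0 = (\<Sum>b\<in>B. w b *\<^sub>R b)" using xl LIMSEQ_unique by blast
    then show False using b0 by (simp add: span_sum span_scale span_base)
  qed
  then obtain d where d: "d > 0" "\<And>x. x \<in> span B \<Longrightarrow> norm (b0 - x) \<ge> d" by blast
  \<comment> \<open>The first value serves the coefficient of \<open>b0\<close>. The second serves
    the old coefficients: removing the \<open>b0\<close> term raises the norm by at most
    \<open>norm b0 / d\<close> times the norm of the whole sum.\<close>
  define K where "K = max (1 / d) (C * (1 + norm b0 / d))"
  have "\<bar>a b\<bar> \<le> K * norm (\<Sum>b\<in>insert b0 B. a b *\<^sub>R b)" if "b \<in> insert b0 B" for a b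
  proof -
    let ?x = "\<Sum>b\<in>B. a b *\<^sub>R b"
    let ?y = "\<Sum>b\<in>insert b0 B. a b *\<^sub>R b"
    have y: "?y = a b0 *\<^sub>R b0 + ?x" using insert.hyps by simp
    have xs: "?x \<in> span B" by (simp add: span_sum span_scale span_base)
    have a0: "\<bar>a b0\<bar> \<le> norm ?y / d"
    proof (cases "a b0 = 0")
      case True then show ?thesis using d(1) by simp
    next
      case False
      have "?y = a b0 *\<^sub>R (b0 - (- (1 / a b0)) *\<^sub>R ?x)"
        using False y by (simp add: scaleR_right_distrib)
      then have "norm ?y = \<bar>a b0\<bar> * norm (b0 - (- (1 / a b0)) *\<^sub>R ?x)" by (metis norm_scaleR)
      also have "\<dots> \<ge> \<bar>a b0\<bar> * d" using d(2)[OF span_scale[OF xs, of "- (1 / a b0)"]] by (intro mult_left_mono) auto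
      finally show ?thesis using d(1) by (simp add: field_simps)
    qed
    show ?thesis
    proof (cases "b = b0")
      case True
      have "norm ?y / d \<le> K * norm ?y"
        using mult_right_mono[of "1/d" K "norm ?y"] by (simp add: K_def)
      then show ?thesis unfolding True using a0 by linarith
    next
      case False
      then have "\<bar>a b\<bar> \<le> C * norm ?x" using that C(2) by blast
      also have "norm ?x \<le> norm ?y + \<bar>a b0\<bar> * norm b0"
        using norm_triangle_ineq4[of ?y "a b0 *\<^sub>R b0"] y by simp
      also have "\<dots> \<le> norm ?y + norm ?y / d * norm b0"
        using mult_right_mono[OF a0, of "norm b0"] by simp
      also have "C * (\<dots>) = (C * (1 + norm b0 / d)) * norm ?y" by (simp add: algebra_simps)
      also have "\<dots> \<le> K * norm ?y" by (intro mult_right_mono) (auto simp: K_def)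
      finally show ?thesis using C(1) by (simp add: mult_left_mono)
    qed
  qed
  moreover have "K \<ge> 0" using d(1) by (simp add: K_def le_max_iff_disj)
  ultimately show ?case by blast
qed

text \<open>Turns the spanning condition of \<open>smooth_manifold\<close> into bounded coordinates:
  a basis is extracted from the spanning set, and \<open>coefficients_bounded\<close> makes its
  coordinate functionals bounded.\<close>

lemma fin_dim_spanning:
  fixes S :: "'a::real_normed_vector set"
  assumes "finite S" "span S = UNIV"
  shows "fin_dim TYPE('a)"
proof -
  obtain B where B: "B \<subseteq> S" "independent B" "S \<subseteq> span B"
    using maximal_independent_subset .
  have fB: "finite B" using B(1) assms(1) finite_subset by blast
  have sB: "span B = UNIV" using B(3) assms(2) by (metis span_minimal subspace_span top.extremum_unique)
  obtain C where C: "C \<ge> 0" "\<And>a b. b \<in> B \<Longrightarrow> \<bar>a b\<bar> \<le> C * norm (\<Sum>b\<in>B. a b *\<^sub>R b)"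
    using coefficients_bounded[OF fB B(2)] by blast
  have rep: "(\<Sum>b\<in>B. representation B x b *\<^sub>R b) = x" for x
    using sum_representation_eq[OF B(2) _ fB subset_refl, of x] sB by simp
  have "bounded_linear (\<lambda>x. representation B x b)" if "b \<in> B" for b
  proof (rule bounded_linear_intro[of _ C])
    fix x y r
    show "representation B (x + y) b = representation B x b + representation B y b"
      using representation_add[OF B(2)] sB by simp
    show "representation B (r *\<^sub>R x) b = r *\<^sub>R representation B x b"
      using representation_scale[OF B(2)] sB by simp
    show "norm (representation B x b) \<le> norm x * C"
      using C(2)[OF that, of "representation B x"] rep by (simp add: mult.commute)
  qed
  then show ?thesis unfolding fin_dim_def using fB rep
    by (intro exI[of _ B] exI[of _ "\<lambda>b x. representation B x b"]) auto
qed

lemma fin_dim_real: "fin_dim TYPE(real)"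
  by (rule fin_dim_spanning[of "{1}"]) (auto simp: span_singleton intro: range_eqI)

lemma fin_dim_prod:
  assumes "fin_dim TYPE('a::real_normed_vector)" "fin_dim TYPE('b::real_normed_vector)"
  shows "fin_dim TYPE('a \<times> 'b)"
proof -
  obtain B :: "'a set" and \<kappa> where B: "finite B" "\<And>b. b \<in> B \<Longrightarrow> bounded_linear (\<kappa> b)"
    "\<And>x. (\<Sum>b\<in>B. \<kappa> b x *\<^sub>R b) = x" using fin_dimE[OF assms(1)] by metis
  obtain C :: "'b set" and \<mu> where C: "finite C" "\<And>b. b \<in> C \<Longrightarrow> bounded_linear (\<mu> b)"
    "\<And>x. (\<Sum>b\<in>C. \<mu> b x *\<^sub>R b) = x" using fin_dimE[OF assms(2)] by metis
  define S where "S = (\<lambda>b. (b, 0::'b)) ` B \<union> (\<lambda>c. (0::'a, c)) ` C"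
  have "(x, y) \<in> span S" for x :: 'a and y :: 'b
  proof -
    have 1: "(\<Sum>b\<in>B. \<kappa> b x *\<^sub>R (b, 0::'b)) \<in> span S"
      by (intro span_sum span_scale span_base) (auto simp: S_def)
    have 2: "(\<Sum>c\<in>C. \<mu> c y *\<^sub>R (0::'a, c)) \<in> span S"
      by (intro span_sum span_scale span_base) (auto simp: S_def)
    have "(\<Sum>b\<in>B. \<kappa> b x *\<^sub>R (b, 0::'b)) = (\<Sum>b\<in>B. \<kappa> b x *\<^sub>R b, 0)"
      using B(1) by (simp add: prod_eq_iff fst_sum snd_sum)
    moreover have "(\<Sum>c\<in>C. \<mu> c y *\<^sub>R (0::'a, c)) = (0, \<Sum>c\<in>C. \<mu> c y *\<^sub>R c)"
      using C(1) by (simp add: prod_eq_iff fst_sum snd_sum)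
    ultimately show ?thesis using span_add[OF 1 2] B(3) C(3) by simp
  qed
  then show ?thesis
    using B(1) C(1) by (intro fin_dim_spanning[of S]) (auto simp: S_def)
qed

lemma linear_eq_sum_coordinates:
  assumes "linear f" "(\<Sum>b\<in>B. \<kappa> b x *\<^sub>R b) = x"
  shows "f x = (\<Sum>b\<in>B. \<kappa> b x *\<^sub>R f b)"
proof -
  have "f x = f (\<Sum>b\<in>B. \<kappa> b x *\<^sub>R b)" using assms(2) by simp
  then show ?thesis by (simp add: linear_sum[OF assms(1)] linear_scale[OF assms(1)])
qed

lemma linear_bounded_fin_dim:
  fixes f :: "'a::real_normed_vector \<Rightarrow> 'b::real_normed_vector"
  assumes "fin_dim TYPE('a)" "linear f"
  shows "bounded_linear f"
proof -
  obtain B :: "'a set" and \<kappa> where B: "finite B" "\<And>b. b \<in> B \<Longrightarrow> bounded_linear (\<kappa> b)"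
    "\<And>x. (\<Sum>b\<in>B. \<kappa> b x *\<^sub>R b) = x" using fin_dimE[OF assms(1)] by metis
  have "f = (\<lambda>x. \<Sum>b\<in>B. \<kappa> b x *\<^sub>R f b)"
    by (rule ext, rule linear_eq_sum_coordinates[where \<kappa> = \<kappa>, OF assms(2) B(3)])
  moreover have "bounded_linear (\<lambda>x. \<Sum>b\<in>B. \<kappa> b x *\<^sub>R f b)"
    by (intro bounded_linear_sum bounded_linear_scaleR_const B)
  ultimately show ?thesis by simp
qed

text \<open>A linear map is determined by its values on finitely many vectors, so continuity in each
  fixed direction already gives closeness in operator norm near \<open>x0\<close>.
  \<open>Ck_on\<close> supplies only the former, the contraction arguments need the latter.\<close>

lemma pointwise_continuous_operators:
  fixes L :: "'x::topological_space \<Rightarrow> 'a::real_normed_vector \<Rightarrow> 'b::real_normed_vector"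
  assumes fd: "fin_dim TYPE('a)" and lin: "\<And>x. x \<in> S \<Longrightarrow> linear (L x)"
    and cont: "\<And>v. continuous_on S (\<lambda>x. L x v)" and "x0 \<in> S" "open S" "e > 0"
  shows "\<exists>V. open V \<and> x0 \<in> V \<and> V \<subseteq> S \<and> (\<forall>x\<in>V. \<forall>v. norm (L x v - L x0 v) \<le> e * norm v)"
proof -
  obtain B :: "'a set" and \<kappa> where B: "finite B" "\<And>b. b \<in> B \<Longrightarrow> bounded_linear (\<kappa> b)"
    "\<And>x. (\<Sum>b\<in>B. \<kappa> b x *\<^sub>R b) = x" using fin_dimE[OF fd] by metis
  \<comment> \<open>The summand 1 makes \<open>K\<close> positive, also when \<open>B\<close> is
    empty.\<close>
  define K where "K = (\<Sum>b\<in>B. onorm (\<kappa> b)) + 1"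
  have K: "K > 0" unfolding K_def using B(2) by (smt (verit, best) onorm_pos_le sum_nonneg)
  define V where "V = S \<inter> (\<Inter>b\<in>B. {x\<in>S. L x b \<in> ball (L x0 b) (e / K)})"
  have oV: "open V" unfolding V_def
  proof (intro open_Int open_INT assms B(1) ballI)
    fix b assume "b \<in> B"
    have "{x \<in> S. L x b \<in> ball (L x0 b) (e / K)} = S \<inter> (\<lambda>x. L x b) -` ball (L x0 b) (e / K)"
      by blast
    then show "open {x \<in> S. L x b \<in> ball (L x0 b) (e / K)}"
      by (simp only: continuous_open_preimage[OF cont \<open>open S\<close> open_ball])
  qed
  have "norm (L x v - L x0 v) \<le> e * norm v" if "x \<in> V" for x v
  proof -
    have xS: "x \<in> S" using that V_def by auto
    have Lv: "L y v = (\<Sum>b\<in>B. \<kappa> b v *\<^sub>R L y b)" if "y \<in> S" for y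
      by (rule linear_eq_sum_coordinates[where \<kappa> = \<kappa>, OF lin[OF that] B(3)])
    have "L x v - L x0 v = (\<Sum>b\<in>B. \<kappa> b v *\<^sub>R (L x b - L x0 b))"
      by (simp add: Lv[OF xS] Lv[OF \<open>x0 \<in> S\<close>] scaleR_diff_right sum_subtractf)
    also have "norm \<dots> \<le> (\<Sum>b\<in>B. norm (\<kappa> b v *\<^sub>R (L x b - L x0 b)))" by (rule norm_sum)
    also have "\<dots> \<le> (\<Sum>b\<in>B. onorm (\<kappa> b) * norm v * (e / K))"
    proof (rule sum_mono)
      fix b assume b: "b \<in> B"
      have 1: "norm (\<kappa> b v) \<le> onorm (\<kappa> b) * norm v" using B(2)[OF b] by (rule onorm)
      have 2: "norm (L x b - L x0 b) \<le> e / K"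
        using that b unfolding V_def by (auto simp: dist_norm norm_minus_commute less_imp_le)
      show "norm (\<kappa> b v *\<^sub>R (L x b - L x0 b)) \<le> onorm (\<kappa> b) * norm v * (e / K)"
        using mult_mono[OF 1 2] onorm_pos_le[OF B(2)[OF b]] by simp
    qed
    also have "\<dots> = (K - 1) * norm v * (e / K)"
    proof -
      have "K - 1 = (\<Sum>b\<in>B. onorm (\<kappa> b))" by (simp add: K_def)
      then show ?thesis by (simp only: sum_distrib_right)
    qed
    also have "\<dots> \<le> K * norm v * (e / K)"
      using K \<open>e > 0\<close> by (intro mult_right_mono) auto
    also have "\<dots> = e * norm v" using K by simp
    finally show ?thesis .
  qed
  then show ?thesis using oV \<open>x0 \<in> S\<close> \<open>e > 0\<close> K
    by (intro exI[of _ V]) (auto simp: V_def)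
qed

section \<open>Calculus of maps of class C^k\<close>

lemma Ck_on_SucD:
  "Ck_on (Suc k) f S \<Longrightarrow> x \<in> S \<Longrightarrow> (f has_derivative frechet_derivative f (at x)) (at x)"
  by (simp add: frechet_derivative_works[symmetric])

lemma Ck_on_subset: "Ck_on k f S \<Longrightarrow> T \<subseteq> S \<Longrightarrow> Ck_on k f T"
  by (induction k arbitrary: f) (auto intro: continuous_on_subset)

lemma Ck_on_cong:
  assumes "open S" "\<And>x. x \<in> S \<Longrightarrow> f x = g x" "Ck_on k f S"
  shows "Ck_on k g S"
  using assms(2,3)
proof (induction k arbitrary: f g)
  case 0
  then show ?case by (simp cong: continuous_on_cong)
next
  case (Suc k)
  have D: "(g has_derivative frechet_derivative f (at x)) (at x)" if "x \<in> S" for x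
    using has_derivative_transform_within_open[OF Ck_on_SucD[OF Suc.prems(2) that] assms(1) that] Suc.prems(1)
    by blast
  then have "frechet_derivative f (at x) = frechet_derivative g (at x)" if "x \<in> S" for x
    using that frechet_derivative_at by blast
  then have "Ck_on k (\<lambda>x. frechet_derivative g (at x) v) S" for v
    using Suc.IH[of "\<lambda>x. frechet_derivative f (at x) v" "\<lambda>x. frechet_derivative g (at x) v"] Suc.prems(2)
    by simp
  then show ?case using D by (auto simp: differentiable_def)
qed

text \<open>The derivative at a point is unique, so an explicit formula \<open>f'\<close> may
  replace \<open>frechet_derivative\<close> in the inductions on \<open>k\<close>.\<close>

lemma Ck_on_SucI:
  assumes "open S" "\<And>x. x \<in> S \<Longrightarrow> (f has_derivative f' x) (at x)" "\<And>v. Ck_on k (\<lambda>x. f' x v) S"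
  shows "Ck_on (Suc k) f S"
proof -
  have "f' x = frechet_derivative f (at x)" if "x \<in> S" for x
    using assms(2)[OF that] frechet_derivative_at by blast
  then have "Ck_on k (\<lambda>x. frechet_derivative f (at x) v) S" for v
    by (intro Ck_on_cong[OF assms(1) _ assms(3)]) auto
  then show ?thesis using assms(2) by (auto simp: differentiable_def)
qed

lemma Ck_on_Suc_imp: "Ck_on (Suc k) f S \<Longrightarrow> Ck_on k f S"
proof (induction k arbitrary: f)
  case 0
  then show ?case
    by (auto intro!: continuous_at_imp_continuous_on differentiable_imp_continuous_within)
next
  case (Suc k)
  then show ?case by (metis Ck_on.simps(2))
qed

lemma Ck_on_local:
  assumes "\<And>x. x \<in> S \<Longrightarrow> \<exists>V. open V \<and> x \<in> V \<and> Ck_on k f V"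
  shows "Ck_on k f S"
  using assms
proof (induction k arbitrary: f)
  case 0
  have "continuous (at x) f" if "x \<in> S" for x
    using 0[OF that] by (auto simp: continuous_on_eq_continuous_at)
  then show ?case by (simp add: continuous_at_imp_continuous_on)
next
  case (Suc k)
  have "Ck_on k (\<lambda>x. frechet_derivative f (at x) v) S" for v
    by (rule Suc.IH) (use Suc.prems in fastforce)
  moreover have "f differentiable (at x)" if "x \<in> S" for x
    using Suc.prems[OF that] by auto
  ultimately show ?case by auto
qed

lemma Ck_on_const: "Ck_on k (\<lambda>x. c) S"
proof (induction k arbitrary: c)
  case (Suc k)
  then show ?case by (auto simp: frechet_derivative_const)
qed auto

lemma Ck_on_bounded_linear:
  assumes "open S" "bounded_linear L" "Ck_on k f S"
  shows "Ck_on k (\<lambda>x. L (f x)) S"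
  using assms(3)
proof (induction k arbitrary: f)
  case 0
  then show ?case using bounded_linear.continuous_on[OF assms(2)] by simp
next
  case (Suc k)
  show ?case
    by (rule Ck_on_SucI[OF assms(1) bounded_linear.has_derivative[OF assms(2) Ck_on_SucD[OF Suc.prems]] Suc.IH])
      (use Suc.prems in auto)
qed

lemma Ck_on_ident: "open S \<Longrightarrow> Ck_on k (\<lambda>x. x) S"
  by (cases k) (auto intro!: Ck_on_SucI[of S "\<lambda>x. x" "\<lambda>x v. v"] Ck_on_const continuous_on_id simp del: Ck_on.simps(2))

lemma Ck_on_add:
  assumes "open S" "Ck_on k f S" "Ck_on k g S"
  shows "Ck_on k (\<lambda>x. f x + g x) S"
  using assms(2,3)
proof (induction k arbitrary: f g)
  case 0
  then show ?case by (simp add: continuous_on_add)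
next
  case (Suc k)
  show ?case
    by (rule Ck_on_SucI[OF assms(1) has_derivative_add[OF Ck_on_SucD[OF Suc.prems(1)] Ck_on_SucD[OF Suc.prems(2)]] Suc.IH])
      (use Suc.prems in auto)
qed

lemma Ck_on_sum:
  assumes "open S" "\<And>i. i \<in> I \<Longrightarrow> Ck_on k (f i) S"
  shows "Ck_on k (\<lambda>x. \<Sum>i\<in>I. f i x) S"
  using assms(2)
  by (induction I rule: infinite_finite_induct) (auto intro!: Ck_on_add[OF assms(1)] Ck_on_const)

lemma Ck_on_bilinear:
  assumes "open S" "bounded_bilinear P" "Ck_on k f S" "Ck_on k g S"
  shows "Ck_on k (\<lambda>x. P (f x) (g x)) S"
  using assms(3,4)
proof (induction k arbitrary: f g)
  case 0
  then show ?case using bounded_bilinear.continuous_on[OF assms(2)] by simp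
next
  case (Suc k)
  note c = Suc.prems[THEN Ck_on_Suc_imp]
  show ?case
    by (rule Ck_on_SucI[OF assms(1) bounded_bilinear.FDERIV[OF assms(2) Ck_on_SucD[OF Suc.prems(1)] Ck_on_SucD[OF Suc.prems(2)]]])
      (use Suc.prems c in \<open>auto intro!: Ck_on_add[OF assms(1)] Suc.IH\<close>)
qed

lemmas Ck_on_scaleR = Ck_on_bilinear[OF _ bounded_bilinear_scaleR]

lemma Ck_on_Pair:
  assumes "open S" "Ck_on k f S" "Ck_on k g S"
  shows "Ck_on k (\<lambda>x. (f x, g x)) S"
proof -
  have "Ck_on k (\<lambda>x. (f x, 0) + (0, g x)) S"
    by (intro Ck_on_add assms Ck_on_bounded_linear[OF assms(1) _ assms(2), of "\<lambda>x. (x, 0)"]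
      Ck_on_bounded_linear[OF assms(1) _ assms(3), of "\<lambda>x. (0, x)"] bounded_linear_intros)
  then show ?thesis by simp
qed

text \<open>The hypothesis on \<open>L\<close> concerns fixed directions only. Expanding the moving
  vector \<open>y x\<close> in coordinates gives a finite sum of scalar functions times values of
  \<open>L x\<close> on fixed vectors.\<close>

lemma Ck_on_operator_apply:
  fixes L :: "'x::real_normed_vector \<Rightarrow> 'a::real_normed_vector \<Rightarrow> 'b::real_normed_vector"
  assumes fd: "fin_dim TYPE('a)" and "open S" and lin: "\<And>x. x \<in> S \<Longrightarrow> linear (L x)"
    and L: "\<And>v. Ck_on k (\<lambda>x. L x v) S" and y: "Ck_on k y S"
  shows "Ck_on k (\<lambda>x. L x (y x)) S"
proof -
  obtain B :: "'a set" and \<kappa> where B: "finite B" "\<And>b. b \<in> B \<Longrightarrow> bounded_linear (\<kappa> b)"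
    "\<And>x. (\<Sum>b\<in>B. \<kappa> b x *\<^sub>R b) = x" using fin_dimE[OF fd] by metis
  have eq: "(\<Sum>b\<in>B. \<kappa> b (y x) *\<^sub>R L x b) = L x (y x)" if "x \<in> S" for x
    by (rule sym, rule linear_eq_sum_coordinates[where \<kappa> = \<kappa>, OF lin[OF that] B(3)])
  have "Ck_on k (\<lambda>x. \<Sum>b\<in>B. \<kappa> b (y x) *\<^sub>R L x b) S"
    by (intro Ck_on_sum Ck_on_scaleR \<open>open S\<close> L Ck_on_bounded_linear[OF _ B(2) y])
  from Ck_on_cong[OF \<open>open S\<close> eq this] show ?thesis .
qed

text \<open>By the chain rule, the derivative of \<open>f\<close> at \<open>g x\<close> is applied
  to a direction that itself depends on \<open>x\<close>. \<open>Ck_on_operator_apply\<close> deals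
  with this, which is where the finite dimension of the intermediate space enters.\<close>

lemma Ck_on_compose:
  fixes f :: "'b::real_normed_vector \<Rightarrow> 'c::real_normed_vector" and g :: "'a::real_normed_vector \<Rightarrow> 'b"
  assumes fd: "fin_dim TYPE('b)" and "open S" "open T" "g ` S \<subseteq> T" "Ck_on k f T" "Ck_on k g S"
  shows "Ck_on k (\<lambda>x. f (g x)) S"
  using assms(5,6)
proof (induction k arbitrary: f)
  case 0
  then show ?case using continuous_on_compose2[of T f S g] assms(4) by simp
next
  case (Suc k)
  have gT: "g x \<in> T" if "x \<in> S" for x using assms(4) that by blast
  show ?case
  proof (rule Ck_on_SucI[OF assms(2)])
    show "((\<lambda>x. f (g x)) has_derivative (\<lambda>v. frechet_derivative f (at (g x)) (frechet_derivative g (at x) v))) (at x)"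
      if "x \<in> S" for x
      using has_derivative_compose[OF Ck_on_SucD[OF Suc.prems(2) that] Ck_on_SucD[OF Suc.prems(1) gT[OF that]]]
      by simp
    show "Ck_on k (\<lambda>x. frechet_derivative f (at (g x)) (frechet_derivative g (at x) v)) S" for v
    proof (rule Ck_on_operator_apply[OF fd assms(2)])
      show "linear (frechet_derivative f (at (g x)))" if "x \<in> S" for x
        using Suc.prems(1) gT[OF that] linear_frechet_derivative by auto
      show "Ck_on k (\<lambda>x. frechet_derivative f (at (g x)) w) S" for w
        using Suc.IH[of "\<lambda>x. frechet_derivative f (at x) w"] Suc.prems Ck_on_Suc_imp by auto
    qed (use Suc.prems in auto)
  qed
qed

text \<open>At a zero of the scalar factor the product rule asks for mere continuity of the other
  factor. This breaks the circle in \<open>Ck_on_operator_inverse\<close>, where the inverse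
  operator is known to be continuous before it is known to be differentiable.\<close>

lemma has_derivative_scaleR_zero:
  fixes u :: "'x::real_normed_vector \<Rightarrow> real" and a :: "'x \<Rightarrow> 'b::real_normed_vector"
  assumes u: "(u has_derivative u') (at x0)" "u x0 = 0" and a: "isCont a x0"
  shows "((\<lambda>x. u x *\<^sub>R a x) has_derivative (\<lambda>h. u' h *\<^sub>R a x0)) (at x0)"
proof -
  interpret u': bounded_linear u' using u(1) by (rule has_derivative_bounded_linear)
  obtain K where K: "K > 0" "\<And>h. norm (u' h) \<le> norm h * K" using u'.pos_bounded by blast
  have lim: "(\<lambda>y. norm (u y - u x0 - u' (y - x0)) / norm (y - x0)) \<midarrow>x0\<rightarrow> 0"
    using u(1) by (simp add: has_derivative_iff_norm)
  have "((\<lambda>x. u x *\<^sub>R (a x - a x0)) has_derivative (\<lambda>h. 0)) (at x0)"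
    unfolding has_derivative_iff_norm
  proof (intro conjI)
    show "bounded_linear (\<lambda>h::'x. 0::'b)" by simp
    have "(\<lambda>y. (norm (u y - u x0 - u' (y - x0)) / norm (y - x0) + K) * norm (a y - a x0)) \<midarrow>x0\<rightarrow> (0 + K) * norm (a x0 - a x0)"
      by (intro tendsto_intros lim) (use a in \<open>simp add: isCont_def\<close>)
    then have l: "(\<lambda>y. (norm (u y - u x0 - u' (y - x0)) / norm (y - x0) + K) * norm (a y - a x0)) \<midarrow>x0\<rightarrow> 0" by simp
    show "(\<lambda>y. norm (u y *\<^sub>R (a y - a x0) - u x0 *\<^sub>R (a x0 - a x0) - 0) / norm (y - x0)) \<midarrow>x0\<rightarrow> 0"
    proof (rule Lim_null_comparison[OF _ l], rule eventually_mono[OF eventually_True])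
      fix y
      have "norm (u y) \<le> norm (u y - u x0 - u' (y - x0)) + norm (u' (y - x0))"
        using norm_triangle_ineq[of "u y - u x0 - u' (y - x0)" "u' (y - x0)"] u(2) by simp
      also have "\<dots> \<le> norm (u y - u x0 - u' (y - x0)) + norm (y - x0) * K" using K(2) by simp
      finally have "norm (u y) / norm (y - x0) \<le> norm (u y - u x0 - u' (y - x0)) / norm (y - x0) + K"
        using K(1) by (cases "y = x0") (auto simp: field_simps)
      from mult_right_mono[OF this, of "norm (a y - a x0)"]
      show "norm (norm (u y *\<^sub>R (a y - a x0) - u x0 *\<^sub>R (a x0 - a x0) - 0) / norm (y - x0))
        \<le> (norm (u y - u x0 - u' (y - x0)) / norm (y - x0) + K) * norm (a y - a x0)"
        by (simp add: u(2))
    qed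
  qed
  from has_derivative_add[OF this has_derivative_scaleR_left[OF u(1), of "a x0"]]
  show ?thesis by (simp add: scaleR_diff_right)
qed

text \<open>The uniform bound \<open>K\<close> gives continuity of \<open>M\<close>. Its derivative
  in direction \<open>h\<close> is \<open>- M (D M v)\<close>, where \<open>D\<close> differentiates
  \<open>L\<close> in direction \<open>h\<close>. The right-hand side involves \<open>M\<close> only
  to the order known from the induction hypothesis, so each step gains one order.\<close>

lemma Ck_on_operator_inverse:
  fixes L M :: "'x::real_normed_vector \<Rightarrow> 'a::real_normed_vector \<Rightarrow> 'a"
  assumes fd: "fin_dim TYPE('a)" and "open S" and lin: "\<And>x. x \<in> S \<Longrightarrow> linear (L x)"
    and linM: "\<And>x. x \<in> S \<Longrightarrow> linear (M x)"
    and inv: "\<And>x v. x \<in> S \<Longrightarrow> L x (M x v) = v" "\<And>x v. x \<in> S \<Longrightarrow> M x (L x v) = v"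
    and K: "\<And>x v. x \<in> S \<Longrightarrow> norm (M x v) \<le> K * norm v"
    and L: "\<And>v. Ck_on k (\<lambda>x. L x v) S"
  shows "Ck_on k (\<lambda>x. M x v) S"
  using L
proof (induction k arbitrary: v)
  case 0
  have "continuous (at x0) (\<lambda>x. M x v)" if x0: "x0 \<in> S" for x0
  proof -
    have "isCont (\<lambda>x. L x (M x0 v)) x0" using 0[of "M x0 v"] x0 \<open>open S\<close> by (simp add: continuous_on_eq_continuous_at)
    then have "(\<lambda>x. L x (M x0 v)) \<midarrow>x0\<rightarrow> v" using inv(1)[OF x0] by (simp add: isCont_def)
    then have l: "(\<lambda>x. K * norm (v - L x (M x0 v))) \<midarrow>x0\<rightarrow> K * norm (v - v)" by (intro tendsto_intros)
    have "(\<lambda>x. M x v - M x0 v) \<midarrow>x0\<rightarrow> 0"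
    proof (rule Lim_null_comparison)
      show "(\<lambda>x. K * norm (v - L x (M x0 v))) \<midarrow>x0\<rightarrow> 0" using l by simp
      show "\<forall>\<^sub>F x in at x0. norm (M x v - M x0 v) \<le> K * norm (v - L x (M x0 v))"
      proof (rule eventually_at_in_open'[OF \<open>open S\<close> x0, THEN eventually_mono])
        fix x assume x: "x \<in> S"
        \<comment> \<open>Since \<open>v = L x0 (M x0 v)\<close>, this is the resolvent identity
          \<open>M x - M x0 = M x (L x0 - L x) M x0\<close>, evaluated at \<open>v\<close>.\<close>
        have "M x v - M x0 v = M x (v - L x (M x0 v))"
          by (simp add: inv(2)[OF x] linear_diff[OF linM[OF x]])
        then show "norm (M x v - M x0 v) \<le> K * norm (v - L x (M x0 v))" using K[OF x] by simp
      qed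
    qed
    then show ?thesis by (simp add: isCont_def LIM_zero_iff)
  qed
  then show ?case by (simp add: continuous_at_imp_continuous_on)
next
  case (Suc k)
  have IH: "Ck_on k (\<lambda>x. M x v) S" for v using Suc.IH Suc.prems Ck_on_Suc_imp by blast
  have c: "continuous_on S (\<lambda>x. M x v)" for v
  proof -
    have "Ck_on k f S \<Longrightarrow> continuous_on S f" for f :: "'x \<Rightarrow> 'a"
    proof (induction k arbitrary: f)
      case (Suc k) then show ?case using Ck_on_Suc_imp by blast
    qed simp
    then show ?thesis using IH by blast
  qed
  obtain B :: "'a set" and \<kappa> where B: "finite B" "\<And>b. b \<in> B \<Longrightarrow> bounded_linear (\<kappa> b)"
    "\<And>x. (\<Sum>b\<in>B. \<kappa> b x *\<^sub>R b) = x" using fin_dimE[OF fd] by metis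
  define D where "D x w = frechet_derivative (\<lambda>x. L x w) (at x)" for x w
  have D: "((\<lambda>x. L x w) has_derivative D x w) (at x)" if "x \<in> S" for x w
    using Ck_on_SucD[OF Suc.prems that] by (simp add: D_def)
  have der: "((\<lambda>x. M x v) has_derivative (\<lambda>h. - M x0 (D x0 (M x0 v) h))) (at x0)" if x0: "x0 \<in> S" for x0
  proof -
    define w where "w = M x0 v"
    have Mexp: "M x z = (\<Sum>b\<in>B. \<kappa> b z *\<^sub>R M x b)" if "x \<in> S" for x z
      by (rule linear_eq_sum_coordinates[where \<kappa> = \<kappa>, OF linM[OF that] B(3)])
    \<comment> \<open>In coordinates this is \<open>M x v = w - M x (L x w - v)\<close>. The
      coefficients vanish at \<open>x0\<close>, so continuity of each \<open>M x b\<close>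
      suffices.\<close>
    have "((\<lambda>x. w - (\<Sum>b\<in>B. \<kappa> b (L x w - v) *\<^sub>R M x b)) has_derivative
      (\<lambda>h. 0 - (\<Sum>b\<in>B. \<kappa> b (D x0 w h) *\<^sub>R M x0 b))) (at x0)"
    proof (intro has_derivative_diff has_derivative_const has_derivative_sum has_derivative_scaleR_zero)
      fix b assume b: "b \<in> B"
      have "((\<lambda>x. L x w - v) has_derivative D x0 w) (at x0)"
        using has_derivative_diff[OF D[OF x0, of w] has_derivative_const[of v]] by simp
      then show "((\<lambda>x. \<kappa> b (L x w - v)) has_derivative (\<lambda>h. \<kappa> b (D x0 w h))) (at x0)"
        using bounded_linear.has_derivative[OF B(2)[OF b]] by blast
      show "\<kappa> b (L x0 w - v) = 0" by (simp add: w_def inv(1)[OF x0] linear_simps(3)[OF B(2)[OF b]])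
      show "isCont (\<lambda>x. M x b) x0" using c[of b] x0 \<open>open S\<close> by (simp add: continuous_on_eq_continuous_at)
    qed
    then have "((\<lambda>x. w - (\<Sum>b\<in>B. \<kappa> b (L x w - v) *\<^sub>R M x b)) has_derivative
      (\<lambda>h. - M x0 (D x0 w h))) (at x0)"
      by (simp only: Mexp[OF x0, symmetric] diff_0)
    then show ?thesis unfolding w_def[symmetric]
    proof (rule has_derivative_transform_within_open[OF _ \<open>open S\<close> x0])
      fix x assume x: "x \<in> S"
      show "w - (\<Sum>b\<in>B. \<kappa> b (L x w - v) *\<^sub>R M x b) = M x v"
        unfolding Mexp[OF x, symmetric] by (simp add: inv(2)[OF x] linear_diff[OF linM[OF x]])
    qed
  qed
  show ?case
  proof (rule Ck_on_SucI[OF \<open>open S\<close> der])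
    fix h
    have "Ck_on k (\<lambda>x. M x (D x (M x v) h)) S"
    proof (rule Ck_on_operator_apply[OF fd \<open>open S\<close> linM IH])
      show "Ck_on k (\<lambda>x. D x (M x v) h) S"
      proof (rule Ck_on_operator_apply[OF fd \<open>open S\<close>, of "\<lambda>x w. D x w h"])
        show "Ck_on k (\<lambda>x. D x w h) S" for w using Suc.prems[of w] by (simp add: D_def)
        show "Ck_on k (\<lambda>x. M x v) S" by (rule IH)
        fix x assume x: "x \<in> S"
        \<comment> \<open>Linearity in \<open>w\<close> allows the moving vector
          \<open>M x v\<close> to be inserted for \<open>w\<close>. It follows from uniqueness of
          derivatives, because \<open>L x\<close> is linear.\<close>
        show "linear (\<lambda>w. D x w h)"
        proof (rule linearI)
          fix w1 w2 :: 'a and r :: real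
          have e1: "D x (w1 + w2) = (\<lambda>h. D x w1 h + D x w2 h)"
          proof (rule has_derivative_unique)
            show "((\<lambda>x. L x (w1 + w2)) has_derivative D x (w1 + w2)) (at x)" by (rule D[OF x])
            show "((\<lambda>x. L x (w1 + w2)) has_derivative (\<lambda>h. D x w1 h + D x w2 h)) (at x)"
              by (rule has_derivative_transform_within_open[OF has_derivative_add[OF D[OF x, of w1] D[OF x, of w2]] \<open>open S\<close> x])
                (simp add: linear_add[OF lin])
          qed
          have e2: "D x (r *\<^sub>R w1) = (\<lambda>h. r *\<^sub>R D x w1 h)"
          proof (rule has_derivative_unique)
            show "((\<lambda>x. L x (r *\<^sub>R w1)) has_derivative D x (r *\<^sub>R w1)) (at x)" by (rule D[OF x])
            show "((\<lambda>x. L x (r *\<^sub>R w1)) has_derivative (\<lambda>h. r *\<^sub>R D x w1 h)) (at x)"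
              by (rule has_derivative_transform_within_open[OF has_derivative_scaleR_right[OF D[OF x, of w1]] \<open>open S\<close> x])
                (simp add: linear_scale[OF lin])
          qed
          show "D x (w1 + w2) h = D x w1 h + D x w2 h" by (simp add: e1)
          show "D x (r *\<^sub>R w1) h = r *\<^sub>R D x w1 h" by (simp add: e2)
        qed
      qed
    qed
    from Ck_on_bounded_linear[OF \<open>open S\<close> bounded_linear_minus[OF bounded_linear_ident] this]
    show "Ck_on k (\<lambda>x. - M x (D x (M x v) h)) S" .
  qed
qed


section \<open>Inverse functions and ordinary differential equations\<close>

definition Cinf_on :: "'a::real_normed_vector set \<Rightarrow> ('a \<Rightarrow> 'b::real_normed_vector) \<Rightarrow> bool" where
  "Cinf_on S f \<longleftrightarrow> (\<forall>k. Ck_on k f S)"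

lemma Cinf_on_subset: "Cinf_on S f \<Longrightarrow> T \<subseteq> S \<Longrightarrow> Cinf_on T f"
  unfolding Cinf_on_def using Ck_on_subset by blast

lemma Cinf_on_cong:
  assumes "open S" "\<And>x. x \<in> S \<Longrightarrow> f x = g x" "Cinf_on S f"
  shows "Cinf_on S g"
  using assms(3) unfolding Cinf_on_def by (intro allI Ck_on_cong[of S f g]) (auto simp: assms)

lemma Cinf_on_local:
  assumes "\<And>x. x \<in> S \<Longrightarrow> \<exists>V. open V \<and> x \<in> V \<and> Cinf_on V f"
  shows "Cinf_on S f"
  unfolding Cinf_on_def
proof
  fix k show "Ck_on k f S" by (rule Ck_on_local) (use assms in \<open>unfold Cinf_on_def, blast\<close>)
qed

lemma Cinf_on_const: "Cinf_on S (\<lambda>x. c)"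
  by (simp add: Cinf_on_def Ck_on_const)

lemma Cinf_on_ident: "open S \<Longrightarrow> Cinf_on S (\<lambda>x. x)"
  by (simp add: Cinf_on_def Ck_on_ident)

lemma Cinf_on_bounded_linear:
  "open S \<Longrightarrow> bounded_linear L \<Longrightarrow> Cinf_on S f \<Longrightarrow> Cinf_on S (\<lambda>x. L (f x))"
  by (simp add: Cinf_on_def Ck_on_bounded_linear)

lemma Cinf_on_add: "open S \<Longrightarrow> Cinf_on S f \<Longrightarrow> Cinf_on S g \<Longrightarrow> Cinf_on S (\<lambda>x. f x + g x)"
  by (simp add: Cinf_on_def Ck_on_add)

lemma Cinf_on_Pair: "open S \<Longrightarrow> Cinf_on S f \<Longrightarrow> Cinf_on S g \<Longrightarrow> Cinf_on S (\<lambda>x. (f x, g x))"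
  by (simp add: Cinf_on_def Ck_on_Pair)

lemma Cinf_on_operator_apply:
  fixes L :: "'x::real_normed_vector \<Rightarrow> 'a::real_normed_vector \<Rightarrow> 'b::real_normed_vector"
  assumes "fin_dim TYPE('a)" "open S" "\<And>x. x \<in> S \<Longrightarrow> linear (L x)"
    "\<And>v. Cinf_on S (\<lambda>x. L x v)" "Cinf_on S y"
  shows "Cinf_on S (\<lambda>x. L x (y x))"
  unfolding Cinf_on_def
  by (rule allI, rule Ck_on_operator_apply[OF assms(1-3)]) (use assms(4,5) in \<open>auto simp: Cinf_on_def\<close>)

lemma Cinf_on_compose:
  fixes f :: "'b::real_normed_vector \<Rightarrow> 'c::real_normed_vector" and g :: "'a::real_normed_vector \<Rightarrow> 'b"
  assumes "fin_dim TYPE('b)" "open S" "open T" "g ` S \<subseteq> T" "Cinf_on T f" "Cinf_on S g"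
  shows "Cinf_on S (\<lambda>x. f (g x))"
  unfolding Cinf_on_def
  by (rule allI, rule Ck_on_compose[OF assms(1-4)]) (use assms(5,6) in \<open>auto simp: Cinf_on_def\<close>)

lemma Cinf_on_has_derivative:
  "Cinf_on S f \<Longrightarrow> x \<in> S \<Longrightarrow> (f has_derivative frechet_derivative f (at x)) (at x)"
  unfolding Cinf_on_def using Ck_on_SucD by blast

lemma Cinf_on_frechet_derivative: "Cinf_on S f \<Longrightarrow> Cinf_on S (\<lambda>x. frechet_derivative f (at x) v)"
  unfolding Cinf_on_def by (metis Ck_on.simps(2))

lemma Cinf_on_continuous: "Cinf_on S f \<Longrightarrow> continuous_on S f"
  unfolding Cinf_on_def by (metis Ck_on.simps(1))

lemma Cinf_on_smooth_on:
  assumes "open S"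
  shows "smooth_on S f \<longleftrightarrow> Cinf_on S f"
proof
  assume s: "smooth_on S f"
  show "Cinf_on S f"
  proof (rule Cinf_on_local)
    fix x assume "x \<in> S"
    then obtain W F where W: "open W" "x \<in> W" "\<forall>k. Ck_on k F W" "\<forall>y\<in>S \<inter> W. f y = F y"
      using s unfolding smooth_on_def by blast
    have "Cinf_on (S \<inter> W) f"
      by (rule Cinf_on_cong[of _ F]) (use W assms in \<open>auto simp: Cinf_on_def intro: Ck_on_subset\<close>)
    then show "\<exists>V. open V \<and> x \<in> V \<and> Cinf_on V f"
      using W assms \<open>x \<in> S\<close> by (intro exI[of _ "S \<inter> W"]) auto
  qed
next
  assume "Cinf_on S f"
  then show "smooth_on S f" using assms unfolding smooth_on_def Cinf_on_def by blast
qed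

text \<open>The equation \<open>h u = y\<close> says that \<open>u\<close> is a fixed point of
  \<open>u \<mapsto> y - (h u - u)\<close>. As the derivative of \<open>h\<close> at 0 is the
  identity, this map contracts by the factor 1/2 on a small closed ball. The general case is reduced
  to this normal form by \<open>submersion_local_section\<close>.\<close>

lemma local_inverse:
  fixes h :: "'a::banach \<Rightarrow> 'a"
  assumes fd: "fin_dim TYPE('a)" and \<Omega>: "open \<Omega>" "0 \<in> \<Omega>" and h: "Cinf_on \<Omega> h"
    and h0: "(h has_derivative (\<lambda>v. v)) (at 0)"
  obtains Y k where "open Y" "h 0 \<in> Y" "Cinf_on Y k" "k ` Y \<subseteq> \<Omega>" "\<And>y. y \<in> Y \<Longrightarrow> h (k y) = y" "k (h 0) = 0"
proof -
  define D where "D x = frechet_derivative h (at x)" for x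
  have D: "(h has_derivative D x) (at x)" if "x \<in> \<Omega>" for x
    using Cinf_on_has_derivative[OF h that] by (simp add: D_def)
  have blD: "bounded_linear (D x)" if "x \<in> \<Omega>" for x using D[OF that] has_derivative_bounded_linear by blast
  have D0: "D 0 = (\<lambda>v. v)" using has_derivative_unique[OF D[OF \<Omega>(2)] h0] .
  have "\<exists>V. open V \<and> 0 \<in> V \<and> V \<subseteq> \<Omega> \<and> (\<forall>x\<in>V. \<forall>v. norm (D x v - D 0 v) \<le> 1/2 * norm v)"
  proof (rule pointwise_continuous_operators[OF fd])
    show "continuous_on \<Omega> (\<lambda>x. D x v)" for v
      unfolding D_def by (rule Cinf_on_continuous[OF Cinf_on_frechet_derivative[OF h]])
  qed (use blD \<Omega> in \<open>auto intro: bounded_linear.linear\<close>)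
  then obtain V where V: "open V" "0 \<in> V" "V \<subseteq> \<Omega>" "\<And>x v. x \<in> V \<Longrightarrow> norm (D x v - v) \<le> 1/2 * norm v"
    unfolding D0 by blast
  obtain r where r: "r > 0" "cball 0 r \<subseteq> V" using V(1,2) open_contains_cball by blast
  define \<Phi> where "\<Phi> u = h u - u" for u
  have \<Phi>: "norm (\<Phi> u - \<Phi> w) \<le> 1/2 * norm (u - w)" if "u \<in> cball 0 r" "w \<in> cball 0 r" for u w
  proof (rule differentiable_bound[of "cball 0 r" \<Phi> "\<lambda>x v. D x v - v", OF _ _ _ that])
    fix x :: 'a assume x: "x \<in> cball 0 r"
    then have "x \<in> \<Omega>" using r V by blast
    show "(\<Phi> has_derivative (\<lambda>v. D x v - v)) (at x within cball 0 r)"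
      unfolding \<Phi>_def by (intro has_derivative_diff has_derivative_ident has_derivative_at_withinI[OF D[OF \<open>x \<in> \<Omega>\<close>]])
    show "onorm (\<lambda>v. D x v - v) \<le> 1/2"
      by (rule onorm_bound) (use V(4)[of x] x r in auto)
  qed auto
  have inj: "norm (u - w) \<le> 2 * norm (h u - h w)" if "u \<in> cball 0 r" "w \<in> cball 0 r" for u w
  proof -
    have "u - w = (h u - h w) - (\<Phi> u - \<Phi> w)" by (simp add: \<Phi>_def)
    then have "norm (u - w) \<le> norm (h u - h w) + norm (\<Phi> u - \<Phi> w)" by (metis norm_triangle_ineq4)
    then show ?thesis using \<Phi>[OF that] by linarith
  qed
  \<comment> \<open>The radius keeps the iteration inside \<open>cball 0 r\<close>: \<open>y\<close>
    contributes at most \<open>r/2\<close>, and the contraction another \<open>r/2\<close>.\<close>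
  define Y where "Y = ball (h 0) (r/2)"
  have "\<exists>u. u \<in> cball 0 r \<and> h u = y" if "y \<in> Y" for y
  proof -
    have "\<exists>!u\<in>cball 0 r. y - \<Phi> u = u"
    proof (rule Banach_fix[of _ "1/2"])
      show "complete (cball (0::'a) r)" by (simp add: complete_eq_closed)
      show "(\<lambda>u. y - \<Phi> u) ` cball 0 r \<subseteq> cball 0 r"
      proof clarify
        fix u :: 'a assume u: "u \<in> cball 0 r"
        have "y - \<Phi> u = (y - h 0) - (\<Phi> u - \<Phi> 0)" by (simp add: \<Phi>_def)
        then have "norm (y - \<Phi> u) \<le> norm (y - h 0) + norm (\<Phi> u - \<Phi> 0)" by (metis norm_triangle_ineq4)
        also have "\<dots> \<le> r/2 + 1/2 * norm u" using \<Phi>[OF u, of 0] that r(1)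
          by (simp add: Y_def dist_norm norm_minus_commute)
        also have "\<dots> \<le> r" using u by simp
        finally show "y - \<Phi> u \<in> cball 0 r" by simp
      qed
      show "dist (y - \<Phi> u) (y - \<Phi> w) \<le> 1/2 * dist u w" if "u \<in> cball 0 r" "w \<in> cball 0 r" for u w
        using \<Phi>[OF that(2,1)] by (simp add: dist_norm norm_minus_commute)
    qed (use r(1) in auto)
    then obtain u where "u \<in> cball 0 r" "y - \<Phi> u = u" by blast
    then show ?thesis by (intro exI[of _ u]) (auto simp: \<Phi>_def algebra_simps)
  qed
  then obtain k where k: "\<And>y. y \<in> Y \<Longrightarrow> k y \<in> cball 0 r" "\<And>y. y \<in> Y \<Longrightarrow> h (k y) = y" by metis
  have Y: "open Y" "h 0 \<in> Y" using r(1) by (auto simp: Y_def)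
  have k0: "k (h 0) = 0" using inj[OF k(1)[OF Y(2)], of 0] k(2)[OF Y(2)] r(1) by simp
  have kV: "k y \<in> V" if "y \<in> Y" for y using k(1)[OF that] r(2) by blast
  have lip: "norm (k y - k z) \<le> 2 * norm (y - z)" if "y \<in> Y" "z \<in> Y" for y z
    using inj[OF k(1)[OF that(1)] k(1)[OF that(2)]] k(2) that by simp
  have contk: "continuous_on Y k"
  proof (rule lipschitz_on_continuous_on)
    show "2-lipschitz_on Y k" by (rule lipschitz_onI) (use lip in \<open>auto simp: dist_norm\<close>)
  qed
  have injD: "norm v \<le> 2 * norm (D u v)" if "u \<in> V" for u v
  proof -
    have "norm v \<le> norm (D u v) + norm (D u v - v)"
      using norm_triangle_ineq4[of "D u v" "D u v - v"] by simp
    then show ?thesis using V(4)[OF that, of v] by linarith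
  qed
  have surjD: "\<exists>x. D u x = v" if "u \<in> V" for u v
  proof -
    have lin: "linear (D u)" using that V(3) blD bounded_linear.linear by blast
    \<comment> \<open>The contraction argument once more, now for the linear map \<open>D u\<close>
      on the whole space: \<open>D u\<close> differs from the identity by at most 1/2 in norm, hence
      is onto.\<close>
    have "\<exists>!x. v - (D u x - x) = x"
    proof (rule banach_fix_type[of "1/2"])
      show "\<forall>x y. dist (v - (D u x - x)) (v - (D u y - y)) \<le> 1/2 * dist x y"
      proof (intro allI)
        fix x y
        have "dist (v - (D u x - x)) (v - (D u y - y)) = norm (D u (y - x) - (y - x))"
          by (simp add: dist_norm linear_diff[OF lin] algebra_simps)
        then show "dist (v - (D u x - x)) (v - (D u y - y)) \<le> 1/2 * dist x y"
          using V(4)[OF that, of "y - x"] by (simp add: dist_norm norm_minus_commute)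
      qed
    qed auto
    then obtain x where "v - (D u x - x) = x" by blast
    then show ?thesis by (intro exI[of _ x]) (simp add: algebra_simps)
  qed
  define M where "M y v = (SOME x. D (k y) x = v)" for y v
  have DM: "D (k y) (M y v) = v" if "y \<in> Y" for y v
    unfolding M_def by (rule someI_ex) (rule surjD[OF kV[OF that]])
  have inj': "v = w" if "y \<in> Y" "D (k y) v = D (k y) w" for y v w
    using injD[OF kV[OF that(1)], of "v - w"] that V(3) kV blD by (simp add: linear_simps(2) subset_iff)
  have lD: "linear (D (k y))" if "y \<in> Y" for y using kV[OF that] V(3) blD bounded_linear.linear by blast
  have MD: "M y (D (k y) v) = v" if "y \<in> Y" for y v
    by (rule inj'[OF that]) (rule DM[OF that])
  have linM: "linear (M y)" if "y \<in> Y" for y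
    by (rule linearI) (rule inj'[OF that], simp add: DM[OF that] linear_add[OF lD[OF that]] linear_scale[OF lD[OF that]])+
  have bM: "norm (M y v) \<le> 2 * norm v" if "y \<in> Y" for y v
    using injD[OF kV[OF that], of "M y v"] DM[OF that] by simp
  have derk: "(k has_derivative M y) (at y)" if "y \<in> Y" for y
  proof (rule has_derivative_inverse_basic[of h "D (k y)" k y "M y" Y])
    show "(h has_derivative D (k y)) (at (k y))" using D V(3) kV[OF that] by blast
    show "bounded_linear (M y)" by (rule linear_bounded_fin_dim[OF fd linM[OF that]])
    show "M y \<circ> D (k y) = id" using MD[OF that] by auto
    show "continuous (at y) k" using contk Y(1) that by (simp add: continuous_on_eq_continuous_at)
  qed (use Y that k in auto)
  \<comment> \<open>Bootstrap: if \<open>k\<close> is of class C^n, then so is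
    \<open>y \<mapsto> D (k y)\<close> in every direction, hence also its inverse \<open>M\<close>,
    which is the derivative of \<open>k\<close>.\<close>
  have "Ck_on n k Y" for n
  proof (induction n)
    case 0 show ?case using contk by simp
  next
    case (Suc n)
    show ?case
    proof (rule Ck_on_SucI[OF Y(1) derk])
      fix v
      show "Ck_on n (\<lambda>y. M y v) Y"
      proof (rule Ck_on_operator_inverse[OF fd Y(1), of "\<lambda>y. D (k y)" M 2])
        show "Ck_on n (\<lambda>y. D (k y) v) Y" for v
          by (rule Ck_on_compose[OF fd Y(1) \<Omega>(1) _ _ Suc])
            (use kV V(3) Cinf_on_frechet_derivative[OF h, of v] in \<open>auto simp: D_def Cinf_on_def\<close>)
      qed (auto simp: lD linM DM MD bM)
    qed
  qed
  then have "Cinf_on Y k" by (simp add: Cinf_on_def)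
  then show ?thesis using that[of Y k] Y k(2) k0 kV V(3) by blast
qed

text \<open>A linear right inverse \<open>R\<close> of the derivative selects a slice through
  \<open>x0\<close> on which \<open>u \<mapsto> f (x0 + R u)\<close> has the identity as its
  derivative at 0. The section is the local inverse of this map, carried back to the slice.\<close>

lemma submersion_local_section:
  fixes f :: "'a::banach \<Rightarrow> 'b::banach"
  assumes fa: "fin_dim TYPE('a)" and fb: "fin_dim TYPE('b)" and \<Omega>: "open \<Omega>" "x0 \<in> \<Omega>" and f: "Cinf_on \<Omega> f"
    and surj: "surj (frechet_derivative f (at x0))"
  obtains Y \<sigma> where "open Y" "f x0 \<in> Y" "Cinf_on Y \<sigma>" "\<sigma> ` Y \<subseteq> \<Omega>" "\<And>y. y \<in> Y \<Longrightarrow> f (\<sigma> y) = y" "\<sigma> (f x0) = x0"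
proof -
  let ?D = "frechet_derivative f (at x0)"
  have D: "(f has_derivative ?D) (at x0)" using Cinf_on_has_derivative[OF f \<Omega>(2)] .
  obtain R where R: "linear R" "?D \<circ> R = id"
    using linear_surjective_right_inverse[of ?D] surj D has_derivative_linear by blast
  have bR: "bounded_linear R" using linear_bounded_fin_dim[OF fb R(1)] .
  define \<Omega>' where "\<Omega>' = (\<lambda>u. x0 + R u) -` \<Omega>"
  have cR: "continuous_on UNIV (\<lambda>u. x0 + R u)"
    by (intro continuous_intros linear_continuous_on bR)
  have o': "open \<Omega>'" unfolding \<Omega>'_def using \<Omega>(1) cR by (rule open_vimage)
  have R0: "R 0 = 0" using R(1) by (rule linear_0)
  have z: "0 \<in> \<Omega>'" using \<Omega>(2) by (simp add: \<Omega>'_def R0)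
  have sm: "Cinf_on \<Omega>' (\<lambda>u. x0 + R u)"
    by (intro Cinf_on_add Cinf_on_const Cinf_on_bounded_linear[OF _ bR] Cinf_on_ident o')
  have h: "Cinf_on \<Omega>' (\<lambda>u. f (x0 + R u))"
    by (rule Cinf_on_compose[OF fa o' \<Omega>(1) _ f sm]) (auto simp: \<Omega>'_def)
  have "((\<lambda>u. x0 + R u) has_derivative R) (at 0)"
    using has_derivative_add[OF has_derivative_const[of x0] bounded_linear_imp_has_derivative[OF bR]] by simp
  then have "((\<lambda>u. f (x0 + R u)) has_derivative (\<lambda>v. ?D (R v))) (at 0)"
    using has_derivative_compose[of "\<lambda>u. x0 + R u" R 0 UNIV f ?D] D R0 by simp
  moreover have "(\<lambda>v. ?D (R v)) = (\<lambda>v. v)" using R(2) by (metis comp_apply id_apply)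
  ultimately have d: "((\<lambda>u. f (x0 + R u)) has_derivative (\<lambda>v. v)) (at 0)" by simp
  obtain Y k where Y: "open Y" "f (x0 + R 0) \<in> Y" "Cinf_on Y k" "k ` Y \<subseteq> \<Omega>'"
    "\<And>y. y \<in> Y \<Longrightarrow> f (x0 + R (k y)) = y" "k (f (x0 + R 0)) = 0"
    by (rule local_inverse[OF fb o' z h d]) blast
  show ?thesis
  proof (rule that[of Y "\<lambda>y. x0 + R (k y)"])
    show "Cinf_on Y (\<lambda>y. x0 + R (k y))"
      by (intro Cinf_on_add Cinf_on_const Cinf_on_bounded_linear[OF _ bR] Y)
  qed (use Y R0 in \<open>auto simp: \<Omega>'_def\<close>)
qed

section \<open>Local solutions of ordinary differential equations\<close>

lemma norm_diff_le_vector_derivative: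
  fixes g :: "real \<Rightarrow> 'a::real_normed_vector"
  assumes "convex I" "\<And>t. t \<in> I \<Longrightarrow> (g has_vector_derivative \<phi> t) (at t within I)"
    "\<And>t. t \<in> I \<Longrightarrow> norm (\<phi> t) \<le> B" "s \<in> I" "t \<in> I"
  shows "norm (g s - g t) \<le> B * \<bar>s - t\<bar>"
proof -
  have "norm (g s - g t) \<le> B * norm (s - t)"
  proof (rule differentiable_bound[OF assms(1) _ _ assms(4,5)])
    fix x assume x: "x \<in> I"
    show "(g has_derivative (\<lambda>h. h *\<^sub>R \<phi> x)) (at x within I)"
      using assms(2)[OF x] by (simp add: has_vector_derivative_def)
    show "onorm (\<lambda>h. h *\<^sub>R \<phi> x) \<le> B"
      by (rule onorm_bound) (use order_trans[OF norm_ge_zero assms(3)[OF x]] assms(3)[OF x] in \<open>auto simp: mult.commute[of B] intro: mult_left_mono\<close>)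
  qed
  then show ?thesis by simp
qed

text \<open>Picard iteration in the complete space of bounded continuous functions on the line. The
  right-hand side depends smoothly on time and state together, so smoothness of the solution follows
  by bootstrapping.\<close>

lemma ode_local_solution:
  fixes F :: "real \<times> 'a::banach \<Rightarrow> 'a"
  assumes fd: "fin_dim TYPE('a)" and \<Omega>: "open \<Omega>" "(t0, x0) \<in> \<Omega>" and F: "Cinf_on \<Omega> F"
  obtains d x where "d > 0" "x t0 = x0" "Cinf_on (ball t0 d) x"
    "\<And>t. t \<in> ball t0 d \<Longrightarrow> (t, x t) \<in> \<Omega>"
    "\<And>t. t \<in> ball t0 d \<Longrightarrow> (x has_vector_derivative F (t, x t)) (at t)"
proof -
  have fd2: "fin_dim TYPE(real \<times> 'a)" using fin_dim_prod[OF fin_dim_real fd] .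
  define D where "D p = frechet_derivative F (at p)" for p
  have D: "(F has_derivative D p) (at p)" if "p \<in> \<Omega>" for p
    using Cinf_on_has_derivative[OF F that] by (simp add: D_def)
  have blD: "bounded_linear (D x)" if "x \<in> \<Omega>" for x using D[OF that] has_derivative_bounded_linear by blast
  have contF: "continuous_on \<Omega> F" using Cinf_on_continuous[OF F] .
  have "\<exists>V. open V \<and> (t0, x0) \<in> V \<and> V \<subseteq> \<Omega> \<and> (\<forall>x\<in>V. \<forall>v. norm (D x v - D (t0, x0) v) \<le> 1 * norm v)"
  proof (rule pointwise_continuous_operators[OF fd2])
    show "continuous_on \<Omega> (\<lambda>x. D x v)" for v
      unfolding D_def by (rule Cinf_on_continuous[OF Cinf_on_frechet_derivative[OF F]])
  qed (use blD \<Omega> in \<open>auto intro: bounded_linear.linear\<close>)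
  then obtain V where V: "open V" "(t0, x0) \<in> V" "V \<subseteq> \<Omega>"
    "\<And>x v. x \<in> V \<Longrightarrow> norm (D x v - D (t0, x0) v) \<le> norm v" by auto
  define L where "L = onorm (D (t0, x0)) + 1"
  have L: "L > 0" using onorm_pos_le[OF blD[OF \<Omega>(2)]] by (simp add: L_def)
  have DL: "norm (D p v) \<le> L * norm v" if "p \<in> V" for p v
  proof -
    have "norm (D p v) \<le> norm (D (t0, x0) v) + norm (D p v - D (t0, x0) v)"
      by (rule norm_triangle_sub)
    also have "\<dots> \<le> onorm (D (t0, x0)) * norm v + norm v"
      using V(4)[OF that, of v] onorm[OF blD[OF \<Omega>(2)], of v] by linarith
    finally show ?thesis by (simp add: L_def algebra_simps)
  qed
  define M where "M = norm (F (t0, x0)) + 1"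
  have M: "M > 0" by (simp add: M_def add_nonneg_pos)
  define V' where "V' = V \<inter> (\<Omega> \<inter> F -` ball (F (t0, x0)) 1)"
  have "open V'" unfolding V'_def
    by (intro open_Int V continuous_open_preimage[OF contF] \<Omega>(1)) auto
  moreover have "(t0, x0) \<in> V'" using V \<Omega> by (simp add: V'_def)
  ultimately obtain A1 A2 where A: "open A1" "t0 \<in> A1" "open A2" "x0 \<in> A2" "A1 \<times> A2 \<subseteq> V'"
    by (metis mem_Sigma_iff open_prod_elim)
  obtain a1 where a1: "a1 > 0" "cball t0 a1 \<subseteq> A1" using A open_contains_cball by blast
  obtain a2 where a2: "a2 > 0" "cball x0 a2 \<subseteq> A2" using A open_contains_cball by blast
  define Q where "Q = cball t0 a1 \<times> cball x0 a2"
  have Q: "Q \<subseteq> V'" using a1 a2 A(5) by (auto simp: Q_def)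
  have QO: "Q \<subseteq> \<Omega>" using Q V(3) by (auto simp: V'_def)
  have FM: "norm (F p) \<le> M" if "p \<in> Q" for p
  proof -
    have "norm (F p - F (t0, x0)) < 1" using that Q by (auto simp: V'_def dist_norm norm_minus_commute)
    then show ?thesis using norm_triangle_sub[of "F p" "F (t0, x0)"] by (simp add: M_def)
  qed
  have Lip: "norm (F (t, x) - F (t, y)) \<le> L * norm (x - y)" if "(t, x) \<in> Q" "(t, y) \<in> Q" for t x y
  proof -
    have "norm (F (t, x) - F (t, y)) \<le> L * norm ((t, x) - (t, y))"
    proof (rule differentiable_bound[of Q F D, OF _ _ _ that])
      show "convex Q" unfolding Q_def by (intro convex_Times) auto
      fix p assume p: "p \<in> Q"
      then have pV: "p \<in> V" using Q by (auto simp: V'_def)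
      show "(F has_derivative D p) (at p within Q)" using D pV V(3) has_derivative_at_withinI by blast
      show "onorm (D p) \<le> L" by (rule onorm_bound) (use L DL[OF pV] in auto)
    qed
    then show ?thesis by (simp add: norm_Pair)
  qed
  \<comment> \<open>\<open>a1\<close> keeps time in the box \<open>Q\<close>, \<open>a2 / M\<close>
    keeps the values in \<open>cball x0 a2\<close>, and \<open>1 / (2 * L)\<close> gives the
    contraction factor 1/2.\<close>
  define d where "d = min a1 (min (a2 / M) (1 / (2 * L)))"
  have d: "d > 0" "d \<le> a1" "M * d \<le> a2" "L * d \<le> 1/2"
  proof -
    have "d \<le> a2 / M" "d \<le> 1 / (2 * L)" by (auto simp: d_def)
    then show "M * d \<le> a2" "L * d \<le> 1/2" using M L by (simp_all add: field_simps)
  qed (use a1 a2 M L in \<open>auto simp: d_def\<close>)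
  define l u where "l = t0 - d" and "u = t0 + d"
  have lu: "l \<le> u" "t0 \<in> {l..u}" using d(1) by (auto simp: l_def u_def)
  define S where "S = (PiC UNIV (\<lambda>_. cball x0 a2) :: (real \<Rightarrow>\<^sub>C 'a) set)"
  have tQ: "(t, x) \<in> Q" if "t \<in> {l..u}" "x \<in> cball x0 a2" for t x
    using that d(2) by (auto simp: Q_def l_def u_def dist_real_def)
  define \<phi> where "\<phi> f t = F (t, apply_bcontfun f t)" for f t
  define G where "G f t = integral {l..t} (\<phi> f)" for f t
  have S: "apply_bcontfun f t \<in> cball x0 a2" if "f \<in> S" for f t
    using that unfolding S_def by (auto simp: mem_PiC_iff)
  have cont\<phi>: "continuous_on {l..u} (\<phi> f)" if "f \<in> S" for f
    unfolding \<phi>_def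
    by (rule continuous_on_compose2[OF contF]) (use tQ S[OF that] QO in \<open>auto intro!: continuous_intros\<close>)
  have derG: "(G f has_vector_derivative \<phi> f t) (at t within {l..u})" if "f \<in> S" "t \<in> {l..u}" for f t
    unfolding G_def by (rule integral_has_vector_derivative[OF cont\<phi>[OF that(1)] that(2)])
  \<comment> \<open>Time is clamped to \<open>{l..u}\<close>, so that the iterates are defined and
    bounded on the whole line, as the type of bounded continuous functions requires.\<close>
  define c where "c t = max l (min u t)" for t
  have c: "c t \<in> {l..u}" for t using lu by (auto simp: c_def)
  have cid: "c t = t" if "t \<in> {l..u}" for t using that by (auto simp: c_def)
  \<comment> \<open>The integral \<open>G\<close> starts at the left end \<open>l\<close>;
    subtracting \<open>G f t0\<close> moves its base point to \<open>t0\<close>.\<close>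
  define P where "P f t = x0 + (G f (c t) - G f t0)" for f t
  have Pball: "P f t \<in> cball x0 a2" if "f \<in> S" for f t
  proof -
    have "norm (G f (c t) - G f t0) \<le> M * \<bar>c t - t0\<bar>"
      by (rule norm_diff_le_vector_derivative[OF _ derG[OF that]])
        (use lu c FM tQ S[OF that] in \<open>auto simp: \<phi>_def\<close>)
    also have "\<dots> \<le> M * d" using c[of t] M by (intro mult_left_mono) (auto simp: l_def u_def)
    finally show ?thesis using d(3) by (simp add: P_def dist_norm norm_minus_commute)
  qed
  have Pbc: "P f \<in> bcontfun" if "f \<in> S" for f
  proof -
    have "continuous_on {l..u} (G f)"
      using derG[OF that] has_vector_derivative_continuous continuous_on_eq_continuous_within by blast
    then have "continuous_on UNIV (\<lambda>t. G f (c t))"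
      by (rule continuous_on_compose2) (use c in \<open>auto simp: c_def intro!: continuous_intros\<close>)
    then have "continuous_on UNIV (P f)" unfolding P_def by (intro continuous_intros)
    moreover have "bounded (range (P f))"
      by (rule bounded_subset[OF bounded_cball[of x0 a2]]) (use Pball[OF that] in blast)
    ultimately show ?thesis by (simp add: bcontfun_def)
  qed
  have appP: "apply_bcontfun (Bcontfun (P f)) = P f" if "f \<in> S" for f
    using Bcontfun_inverse[OF Pbc[OF that]] .
  have "\<exists>!f\<in>S. Bcontfun (P f) = f"
  proof (rule Banach_fix[of _ "1/2"])
    show "complete S" unfolding complete_eq_closed S_def by (rule closed_PiC) auto
    have "const_bcontfun x0 \<in> S" using a2(1) by (auto simp: S_def mem_PiC_iff const_bcontfun.rep_eq)
    then show "S \<noteq> {}" by blast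
    show "(\<lambda>f. Bcontfun (P f)) ` S \<subseteq> S"
    proof clarify
      fix f assume f: "f \<in> S"
      show "Bcontfun (P f) \<in> S" using Pball[OF f] unfolding S_def by (auto simp: mem_PiC_iff appP[OF f])
    qed
    show "dist (Bcontfun (P f)) (Bcontfun (P g)) \<le> 1/2 * dist f g" if fg: "f \<in> S" "g \<in> S" for f g
    proof (rule dist_bound)
      fix t
      have "norm ((G f (c t) - G g (c t)) - (G f t0 - G g t0)) \<le> (L * dist f g) * \<bar>c t - t0\<bar>"
      proof (rule norm_diff_le_vector_derivative[of "{l..u}" "\<lambda>t. G f t - G g t" "\<lambda>t. \<phi> f t - \<phi> g t"])
        fix s assume s: "s \<in> {l..u}"
        show "((\<lambda>t. G f t - G g t) has_vector_derivative \<phi> f s - \<phi> g s) (at s within {l..u})"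
          by (intro has_vector_derivative_diff derG fg s)
        have "norm (\<phi> f s - \<phi> g s) \<le> L * norm (apply_bcontfun f s - apply_bcontfun g s)"
          unfolding \<phi>_def by (rule Lip) (use tQ s S fg in auto)
        also have "\<dots> \<le> L * dist f g" using dist_bounded[of f s g] L by (simp add: dist_norm)
        finally show "norm (\<phi> f s - \<phi> g s) \<le> L * dist f g" .
      qed (use lu c in auto)
      also have "\<dots> \<le> (L * dist f g) * d"
        using c[of t] L by (intro mult_left_mono) (auto simp: l_def u_def)
      also have "\<dots> = (L * d) * dist f g" by simp
      also have "\<dots> \<le> 1/2 * dist f g" using d(4) by (rule mult_right_mono) auto
      finally show "dist (apply_bcontfun (Bcontfun (P f)) t) (apply_bcontfun (Bcontfun (P g)) t) \<le> 1/2 * dist f g"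
        unfolding appP[OF fg(1)] appP[OF fg(2)] by (simp add: dist_norm P_def algebra_simps)
    qed
  qed auto
  then obtain f where f: "f \<in> S" "Bcontfun (P f) = f" by blast
  define x where "x = apply_bcontfun f"
  have xP: "x = P f" using appP[OF f(1)] f(2) by (simp add: x_def)
  have ballI: "t \<in> {l<..<u}" if "t \<in> ball t0 d" for t
    using that by (auto simp: l_def u_def dist_real_def)
  have x0: "x t0 = x0" using cid[OF lu(2)] by (simp add: xP P_def)
  have xQ: "(t, x t) \<in> \<Omega>" if "t \<in> ball t0 d" for t
    using tQ[of t "x t"] S[OF f(1), of t] ballI[OF that] QO by (auto simp: x_def)
  have der: "(x has_vector_derivative F (t, x t)) (at t)" if "t \<in> ball t0 d" for t
  proof -
    have tl: "t \<in> {l<..<u}" using ballI[OF that] .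
    have "((\<lambda>t. x0 + (G f t - G f t0)) has_vector_derivative (0 + (\<phi> f t - 0))) (at t within {l..u})"
      by (intro has_vector_derivative_add has_vector_derivative_diff has_vector_derivative_const derG f(1)) (use tl in auto)
    then have "((\<lambda>t. x0 + (G f t - G f t0)) has_vector_derivative (\<phi> f t)) (at t)"
      using at_within_interior[of t "{l..u}"] tl by simp
    then have "(x has_vector_derivative (\<phi> f t)) (at t)"
      by (rule has_vector_derivative_transform_within_open[of _ _ _ "{l<..<u}"])
        (use tl cid in \<open>auto simp: xP P_def\<close>)
    then show ?thesis by (simp add: \<phi>_def x_def)
  qed
  \<comment> \<open>Bootstrap: if \<open>x\<close> is of class C^n, then so is
    \<open>t \<mapsto> F (t, x t)\<close>, the derivative of \<open>x\<close>.\<close>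
  have "Ck_on n x (ball t0 d)" for n
  proof (induction n)
    case 0 show ?case by (simp add: x_def continuous_on_apply_bcontfun)
  next
    case (Suc n)
    show ?case
    proof (rule Ck_on_SucI)
      show "(x has_derivative (\<lambda>h. h *\<^sub>R F (t, x t))) (at t)" if "t \<in> ball t0 d" for t
        using der[OF that] by (simp add: has_vector_derivative_def)
      have "Ck_on n (\<lambda>t. F (t, x t)) (ball t0 d)"
        by (rule Ck_on_compose[OF fd2 _ \<Omega>(1) _ _ Ck_on_Pair[OF _ Ck_on_ident Suc]])
          (use xQ F in \<open>auto simp: Cinf_on_def\<close>)
      then show "Ck_on n (\<lambda>t. h *\<^sub>R F (t, x t)) (ball t0 d)" for h
        by (intro Ck_on_scaleR Ck_on_const) auto
    qed auto
  qed
  then have "Cinf_on (ball t0 d) x" by (simp add: Cinf_on_def)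
  then show ?thesis using that[of d x] d(1) x0 xQ der by blast
qed


section \<open>Smooth maps from normed spaces into manifolds\<close>

text \<open>
  Smooth maps from open subsets of a normed space into a manifold. Charts, curves and their combinations
  are all of this kind, which keeps charts out of the arguments below.
\<close>

definition plot :: "('p, 'e::banach) atlas \<Rightarrow> 'x::real_normed_vector set \<Rightarrow> ('x \<Rightarrow> 'p) \<Rightarrow> bool" where
  "plot A W f \<longleftrightarrow> open W \<and> f ` W \<subseteq> points_of A \<and>
    (\<forall>(U, \<phi>)\<in>A. open {x\<in>W. f x \<in> U} \<and> Cinf_on {x\<in>W. f x \<in> U} (\<lambda>x. \<phi> (f x)))"

text \<open>The derivative is read in the chart chosen at \<open>f x\<close>, consistently with \<open>velocity\<close> and \<open>tderiv\<close>.\<close>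

definition pder :: "('p, 'e::banach) atlas \<Rightarrow> ('x::real_normed_vector \<Rightarrow> 'p) \<Rightarrow> 'x \<Rightarrow> 'x \<Rightarrow> 'e" where
  "pder A f x = frechet_derivative (\<lambda>y. chart_map A (f x) (f y)) (at x)"

section \<open>Elementary properties of plots and their derivatives\<close>

lemma plotI_charts:
  assumes "open W" "\<And>x. x \<in> W \<Longrightarrow> f x \<in> points_of A" "\<And>U \<phi>. (U, \<phi>) \<in> A \<Longrightarrow> open {x\<in>W. f x \<in> U}"
    "\<And>U \<phi>. (U, \<phi>) \<in> A \<Longrightarrow> Cinf_on {x\<in>W. f x \<in> U} (\<lambda>x. \<phi> (f x))"
  shows "plot A W f"
  using assms unfolding plot_def by blast

lemma plot_open: "plot A W f \<Longrightarrow> open W"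
  by (simp add: plot_def)

lemma plot_in: "plot A W f \<Longrightarrow> x \<in> W \<Longrightarrow> f x \<in> points_of A"
  by (auto simp: plot_def)

lemma plot_chart_open: "plot A W f \<Longrightarrow> (U, \<phi>) \<in> A \<Longrightarrow> open {x\<in>W. f x \<in> U}"
  by (auto simp: plot_def)

lemma plot_chart: "plot A W f \<Longrightarrow> (U, \<phi>) \<in> A \<Longrightarrow> Cinf_on {x\<in>W. f x \<in> U} (\<lambda>x. \<phi> (f x))"
  by (auto simp: plot_def)

lemma chart_at_mem:
  assumes "p \<in> points_of A"
  shows "(fst (chart_at A p), chart_map A p) \<in> A" "p \<in> fst (chart_at A p)"
proof -
  have "\<exists>c. c \<in> A \<and> p \<in> fst c" using assms by (auto simp: points_of_def)
  then have "chart_at A p \<in> A \<and> p \<in> fst (chart_at A p)"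
    unfolding chart_at_def by (rule someI_ex)
  then show "(fst (chart_at A p), chart_map A p) \<in> A" "p \<in> fst (chart_at A p)"
    by (auto simp: chart_map_def)
qed

lemma chart_subset_points: "(U, \<phi>) \<in> A \<Longrightarrow> U \<subseteq> points_of A"
  by (force simp: points_of_def)

lemma plot_subset:
  assumes "plot A W f" "open T" "T \<subseteq> W"
  shows "plot A T f"
proof -
  have eq: "{x\<in>T. f x \<in> U} = T \<inter> {x\<in>W. f x \<in> U}" for U using assms(3) by blast
  show ?thesis
    using assms unfolding plot_def
    by (auto simp: eq intro: Cinf_on_subset)
qed

lemma plot_cong:
  assumes "plot A W f" "\<And>x. x \<in> W \<Longrightarrow> f x = g x"
  shows "plot A W g"
proof -
  have eq: "{x\<in>W. g x \<in> U} = {x\<in>W. f x \<in> U}" for U using assms(2) by auto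
  have "g ` W = f ` W" using assms(2) by force
  moreover have "Cinf_on {x\<in>W. f x \<in> U} (\<lambda>x. \<phi> (g x))" if "(U, \<phi>) \<in> A" for U \<phi>
    by (rule Cinf_on_cong[OF plot_chart_open[OF assms(1) that] _ plot_chart[OF assms(1) that]]) (simp add: assms(2))
  ultimately show ?thesis using assms(1) unfolding plot_def eq by blast
qed

lemma plot_local:
  assumes "open W" and loc: "\<And>x. x \<in> W \<Longrightarrow> \<exists>V. open V \<and> x \<in> V \<and> plot A V f"
  shows "plot A W f"
proof (rule plotI_charts[OF assms(1)])
  show "f x \<in> points_of A" if "x \<in> W" for x using loc[OF that] plot_in by metis
  fix U \<phi> assume c: "(U, \<phi>) \<in> A"
  show "open {x\<in>W. f x \<in> U}"
  proof (rule open_subopen[THEN iffD2, OF ballI])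
    fix x assume x: "x \<in> {x\<in>W. f x \<in> U}"
    then obtain V where V: "open V" "x \<in> V" "plot A V f" using loc by blast
    show "\<exists>T. open T \<and> x \<in> T \<and> T \<subseteq> {x \<in> W. f x \<in> U}"
      using plot_chart_open[OF V(3) c] assms(1) x V(2)
      by (intro exI[of _ "W \<inter> {x\<in>V. f x \<in> U}"]) auto
  qed
  show "Cinf_on {x\<in>W. f x \<in> U} (\<lambda>x. \<phi> (f x))"
  proof (rule Cinf_on_local)
    fix x assume x: "x \<in> {x\<in>W. f x \<in> U}"
    then obtain V where V: "open V" "x \<in> V" "plot A V f" using loc by blast
    show "\<exists>T. open T \<and> x \<in> T \<and> Cinf_on T (\<lambda>x. \<phi> (f x))"
      using plot_chart_open[OF V(3) c] plot_chart[OF V(3) c] x V(2)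
      by (intro exI[of _ "{x\<in>V. f x \<in> U}"]) auto
  qed
qed

lemma plot_compose:
  fixes f :: "'x::real_normed_vector \<Rightarrow> 'p" and g :: "'y::real_normed_vector \<Rightarrow> 'x"
  assumes "fin_dim TYPE('x)" "plot A W f" "open N" "Cinf_on N g" "g ` N \<subseteq> W"
  shows "plot A N (\<lambda>y. f (g y))"
proof (rule plotI_charts[OF assms(3)])
  show "f (g y) \<in> points_of A" if "y \<in> N" for y using assms(2,5) plot_in that by blast
  fix U \<phi> assume c: "(U, \<phi>) \<in> A"
  have eq: "{y\<in>N. f (g y) \<in> U} = N \<inter> g -` {x\<in>W. f x \<in> U}" using assms(5) by auto
  show op: "open {y\<in>N. f (g y) \<in> U}"
    unfolding eq using assms(3) Cinf_on_continuous[OF assms(4)] plot_chart_open[OF assms(2) c]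
    by (intro continuous_open_preimage) auto
  show "Cinf_on {y\<in>N. f (g y) \<in> U} (\<lambda>y. \<phi> (f (g y)))"
    by (rule Cinf_on_compose[OF assms(1) op plot_chart_open[OF assms(2) c] _ plot_chart[OF assms(2) c] Cinf_on_subset[OF assms(4)]])
      (use assms(5) in auto)
qed

lemma plot_const: "open W \<Longrightarrow> p \<in> points_of A \<Longrightarrow> plot A W (\<lambda>x. p)"
proof (rule plotI_charts)
  show "open {x\<in>W. p \<in> U}" if "open W" for U
    using that by (cases "p \<in> U") auto
qed (simp_all add: Cinf_on_const)

lemma plot_chart_has_derivative:
  assumes "plot A W f" "(U, \<phi>) \<in> A" "x \<in> W" "f x \<in> U"
  shows "((\<lambda>y. \<phi> (f y)) has_derivative frechet_derivative (\<lambda>y. \<phi> (f y)) (at x)) (at x)"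
  using Cinf_on_has_derivative[OF plot_chart[OF assms(1,2)]] assms(3,4) by simp

lemma pder_works:
  assumes "plot A W f" "x \<in> W"
  shows "((\<lambda>y. chart_map A (f x) (f y)) has_derivative pder A f x) (at x)"
  unfolding pder_def
  using plot_chart_has_derivative[OF assms(1) _ assms(2)] chart_at_mem[OF plot_in[OF assms]] by blast

lemma linear_pder:
  assumes "plot A W f" "x \<in> W"
  shows "linear (pder A f x)"
  using pder_works[OF assms] has_derivative_linear by blast

lemma pder_eqI:
  assumes "((\<lambda>y. chart_map A (f x) (f y)) has_derivative f') (at x)"
  shows "pder A f x = f'"
  using frechet_derivative_at[OF assms] by (simp add: pder_def)

lemma pder_cong:
  assumes "open N" "x \<in> N" "\<And>y. y \<in> N \<Longrightarrow> f y = g y" "plot A W f" "x \<in> W"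
  shows "pder A g x = pder A f x"
proof (rule pder_eqI)
  show "((\<lambda>y. chart_map A (g x) (g y)) has_derivative pder A f x) (at x)"
    by (rule has_derivative_transform_within_open[OF pder_works[OF assms(4,5)] assms(1,2)]) (simp add: assms(2,3))
qed

lemma pder_compose:
  assumes "plot A W f" "(g has_derivative g') (at y)" "g y \<in> W"
  shows "pder A (\<lambda>y. f (g y)) y v = pder A f (g y) (g' v)"
  using pder_eqI[of A "\<lambda>y. f (g y)", OF has_derivative_compose[OF assms(2) pder_works[OF assms(1,3)]]] by simp

lemma pder_const: "pder A (\<lambda>x. p) x v = 0"
  by (subst pder_eqI[of A "\<lambda>x. p" x "\<lambda>v. 0"]) auto

section \<open>Plots, differentials and smooth maps over a smooth atlas\<close>

locale charted =
  fixes A :: "('p, 'e::banach) atlas"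
  assumes atlas: "smooth_atlas A" and fin_dim: "fin_dim TYPE('e)"
begin

lemma chart_inj: "(U, \<phi>) \<in> A \<Longrightarrow> inj_on \<phi> U"
  using atlas unfolding smooth_atlas_def by blast

lemma overlap_open: "(U, \<phi>) \<in> A \<Longrightarrow> (V, \<psi>) \<in> A \<Longrightarrow> open (\<phi> ` (U \<inter> V))"
  using atlas unfolding smooth_atlas_def by blast

lemma chart_image_open: "(U, \<phi>) \<in> A \<Longrightarrow> open (\<phi> ` U)"
  using overlap_open[of U \<phi> U \<phi>] by simp

lemma transition_Cinf:
  assumes "(U, \<phi>) \<in> A" "(V, \<psi>) \<in> A"
  shows "Cinf_on (\<phi> ` (U \<inter> V)) (\<lambda>y. \<psi> (inv_into U \<phi> y))"
proof -
  have "smooth_on (\<phi> ` (U \<inter> V)) (\<psi> \<circ> inv_into U \<phi>)"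
    using atlas assms unfolding smooth_atlas_def by blast
  then show ?thesis unfolding Cinf_on_smooth_on[OF overlap_open[OF assms]] by (simp add: o_def)
qed

text \<open>One chart around each value is enough: the transition maps carry smoothness over to
  every other chart that contains the value.\<close>

lemma plotI:
  assumes W: "open W" and loc: "\<And>x. x \<in> W \<Longrightarrow> \<exists>V U \<phi>. (U, \<phi>) \<in> A \<and> open V \<and> x \<in> V \<and> V \<subseteq> W \<and> f ` V \<subseteq> U \<and> Cinf_on V (\<lambda>x. \<phi> (f x))"
  shows "plot A W f"
proof -
  have key: "\<exists>N. open N \<and> x \<in> N \<and> N \<subseteq> W \<and> f ` N \<subseteq> U' \<and> Cinf_on N (\<lambda>x. \<phi>' (f x))"
    if c': "(U', \<phi>') \<in> A" and x: "x \<in> W" "f x \<in> U'" for U' \<phi>' x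
  proof -
    obtain V U \<phi> where V: "(U, \<phi>) \<in> A" "open V" "x \<in> V" "V \<subseteq> W" "f ` V \<subseteq> U" "Cinf_on V (\<lambda>x. \<phi> (f x))"
      using loc[OF x(1)] by blast
    let ?O = "\<phi> ` (U \<inter> U')"
    let ?N = "V \<inter> (\<lambda>x. \<phi> (f x)) -` ?O"
    have opN: "open ?N"
      by (rule continuous_open_preimage[OF Cinf_on_continuous[OF V(6)] V(2) overlap_open[OF V(1) c']])
    have N: "f y \<in> U'" if "y \<in> ?N" for y
    proof -
      have "\<phi> (f y) \<in> ?O" using that by simp
      then obtain z where z: "\<phi> (f y) = \<phi> z" "z \<in> U \<inter> U'" by (rule imageE)
      then have "f y = z" using chart_inj[OF V(1)] V(5) that by (auto dest: inj_onD)
      then show ?thesis using z by simp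
    qed
    have 1: "Cinf_on ?N (\<lambda>x. \<phi>' (inv_into U \<phi> (\<phi> (f x))))"
      by (rule Cinf_on_compose[OF fin_dim opN overlap_open[OF V(1) c'] _ transition_Cinf[OF V(1) c'] Cinf_on_subset[OF V(6)]]) auto
    have 2: "\<phi>' (inv_into U \<phi> (\<phi> (f x))) = \<phi>' (f x)" if "x \<in> ?N" for x
      using inv_into_f_f[OF chart_inj[OF V(1)], of "f x"] V(5) that by (metis IntD1 image_subset_iff)
    have "Cinf_on ?N (\<lambda>x. \<phi>' (f x))" using Cinf_on_cong[OF opN 2 1] .
    moreover have "x \<in> ?N" using V x by auto
    ultimately show ?thesis using opN N V(4) by (intro exI[of _ ?N]) auto
  qed
  show ?thesis
  proof (rule plotI_charts[OF W])
    show "f x \<in> points_of A" if "x \<in> W" for x using loc[OF that] chart_subset_points by blast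
    fix U \<phi> assume c: "(U, \<phi>) \<in> A"
    show "open {x\<in>W. f x \<in> U}"
    proof (rule open_subopen[THEN iffD2, OF ballI])
      fix x assume "x \<in> {x\<in>W. f x \<in> U}"
      then obtain N where "open N" "x \<in> N" "N \<subseteq> W" "f ` N \<subseteq> U" using key[OF c, of x] by blast
      then show "\<exists>T. open T \<and> x \<in> T \<and> T \<subseteq> {x\<in>W. f x \<in> U}" by (intro exI[of _ N]) auto
    qed
    show "Cinf_on {x\<in>W. f x \<in> U} (\<lambda>x. \<phi> (f x))"
    proof (rule Cinf_on_local)
      fix x assume "x \<in> {x\<in>W. f x \<in> U}"
      then show "\<exists>V. open V \<and> x \<in> V \<and> Cinf_on V (\<lambda>x. \<phi> (f x))" using key[OF c, of x] by blast
    qed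
  qed
qed

lemma plot_inv_chart:
  assumes "(U, \<phi>) \<in> A"
  shows "plot A (\<phi> ` U) (inv_into U \<phi>)"
proof (rule plotI[OF chart_image_open[OF assms]])
  fix x assume "x \<in> \<phi> ` U"
  have "Cinf_on (\<phi> ` U) (\<lambda>y. \<phi> (inv_into U \<phi> y))"
    by (rule Cinf_on_cong[OF chart_image_open[OF assms] _ Cinf_on_ident[OF chart_image_open[OF assms]]])
      (simp add: f_inv_into_f)
  then show "\<exists>V U' \<phi>'. (U', \<phi>') \<in> A \<and> open V \<and> x \<in> V \<and> V \<subseteq> \<phi> ` U \<and> inv_into U \<phi> ` V \<subseteq> U' \<and> Cinf_on V (\<lambda>x. \<phi>' (inv_into U \<phi> x))"
    using assms chart_image_open[OF assms] \<open>x \<in> \<phi> ` U\<close>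
    by (intro exI[of _ "\<phi> ` U"] exI[of _ U] exI[of _ \<phi>]) (auto intro: inv_into_into)
qed

lemma plot_chart_inv:
  assumes "p \<in> points_of A"
  shows "plot A (chart_map A p ` fst (chart_at A p)) (chart_inv A p)"
  unfolding chart_inv_def using plot_inv_chart[OF chart_at_mem(1)[OF assms]] .

lemma chart_inv_chart:
  assumes "p \<in> points_of A" "q \<in> fst (chart_at A p)"
  shows "chart_inv A p (chart_map A p q) = q"
  unfolding chart_inv_def using chart_inj[OF chart_at_mem(1)[OF assms(1)]] assms(2) by (rule inv_into_f_f)

lemma chart_inv_point: "p \<in> points_of A \<Longrightarrow> chart_inv A p (chart_map A p p) = p"
  using chart_inv_chart[OF _ chart_at_mem(2)] by blast

text \<open>Reduces differentials of maps to derivatives of plots, the plot being the inverse of the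
  chosen chart followed by the map. The rules for \<open>tderiv\<close> below all come from rules
  for \<open>pder\<close> in this way.\<close>

lemma tderiv_eq_pder:
  assumes "p \<in> points_of A"
  shows "tderiv A C F p = pder C (\<lambda>y. F (chart_inv A p y)) (chart_map A p p)"
  unfolding tderiv_def pder_def using chart_inv_point[OF assms] by (simp add: o_def)

lemma openin_image:
  assumes "openin (mtopology A) S" "(U, \<phi>) \<in> A"
  shows "open (\<phi> ` (S \<inter> U))" "S \<subseteq> points_of A"
  using assms openin_mtopology[OF atlas] by auto

lemma plot_open_preimage:
  assumes "plot A W f" "openin (mtopology A) S"
  shows "open {x\<in>W. f x \<in> S}"
proof (rule open_subopen[THEN iffD2, OF ballI])
  fix x assume x: "x \<in> {x\<in>W. f x \<in> S}"
  let ?U = "fst (chart_at A (f x))" and ?\<phi> = "chart_map A (f x)"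
  have px: "f x \<in> points_of A" using plot_in[OF assms(1)] x by blast
  note c = chart_at_mem[OF px]
  let ?W = "{y\<in>W. f y \<in> ?U}"
  let ?N = "?W \<inter> (\<lambda>y. ?\<phi> (f y)) -` (?\<phi> ` (S \<inter> ?U))"
  have "open ?N"
    by (rule continuous_open_preimage[OF Cinf_on_continuous[OF plot_chart[OF assms(1) c(1)]]
      plot_chart_open[OF assms(1) c(1)] openin_image(1)[OF assms(2) c(1)]])
  moreover have "f y \<in> S" if "y \<in> ?N" for y
    using that chart_inj[OF c(1)] by (auto dest: inj_onD)
  moreover have "x \<in> ?N" using x c by auto
  ultimately show "\<exists>T. open T \<and> x \<in> T \<and> T \<subseteq> {x \<in> W. f x \<in> S}"
    by (intro exI[of _ ?N]) auto
qed

lemma plot_smooth_map: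
  assumes B: "charted B" and F: "smooth_map A B F" and f: "plot A W f"
  shows "plot B W (\<lambda>x. F (f x))"
proof (rule charted.plotI[OF B plot_open[OF f]])
  fix x assume x: "x \<in> W"
  then have "f x \<in> points_of A" using plot_in[OF f] by blast
  then obtain U \<phi> V \<psi> S where S: "(U, \<phi>) \<in> A" "(V, \<psi>) \<in> B" "openin (mtopology A) S" "f x \<in> S" "S \<subseteq> U" "F ` S \<subseteq> V"
    "smooth_on (\<phi> ` S) (\<psi> \<circ> F \<circ> inv_into U \<phi>)"
    using F unfolding smooth_map_def by fast
  have oS: "open (\<phi> ` S)" using openin_image[OF S(3,1)] S(5) by (simp add: Int_absorb2)
  have C: "Cinf_on (\<phi> ` S) (\<lambda>y. \<psi> (F (inv_into U \<phi> y)))"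
    using S(7) unfolding Cinf_on_smooth_on[OF oS] by (simp add: o_def)
  let ?N = "{x\<in>W. f x \<in> S}"
  have oN: "open ?N" using plot_open_preimage[OF f S(3)] .
  have sub: "?N \<subseteq> {x\<in>W. f x \<in> U}" using S(5) by blast
  have "Cinf_on ?N (\<lambda>x. \<psi> (F (inv_into U \<phi> (\<phi> (f x)))))"
    by (rule Cinf_on_compose[OF fin_dim oN oS _ C Cinf_on_subset[OF plot_chart[OF f S(1)] sub]]) auto
  then have "Cinf_on ?N (\<lambda>x. \<psi> (F (f x)))"
    by (rule Cinf_on_cong[OF oN, rotated]) (use S(5) chart_inj[OF S(1)] in \<open>auto simp: inv_into_f_f\<close>)
  then show "\<exists>V U \<phi>. (U, \<phi>) \<in> B \<and> open V \<and> x \<in> V \<and> V \<subseteq> W \<and> (\<lambda>x. F (f x)) ` V \<subseteq> U \<and> Cinf_on V (\<lambda>x. \<phi> (F (f x)))"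
    using S oN x by (intro exI[of _ ?N] exI[of _ V] exI[of _ \<psi>]) auto
qed

text \<open>Near \<open>x\<close> the plot \<open>f\<close> can be written as the inverse of the
  chart chosen at \<open>f x\<close> after its coordinate expression, so this is the ordinary chain
  rule between normed spaces.\<close>

lemma pder_smooth_map:
  assumes B: "charted B" and F: "smooth_map A B F" and f: "plot A W f" and x: "x \<in> W"
  shows "pder B (\<lambda>x. F (f x)) x v = tderiv A B F (f x) (pder A f x v)"
proof -
  let ?\<phi> = "chart_map A (f x)" and ?U = "fst (chart_at A (f x))"
  have p: "f x \<in> points_of A" using plot_in[OF f x] .
  note c = chart_at_mem[OF p]
  have FP: "plot B (?\<phi> ` ?U) (\<lambda>y. F (chart_inv A (f x) y))"
    using plot_smooth_map[OF B F plot_chart_inv[OF p]] .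
  have "pder B (\<lambda>y. F (chart_inv A (f x) (?\<phi> (f y)))) x = pder B (\<lambda>x. F (f x)) x"
    by (rule pder_cong[of "{y\<in>W. f y \<in> ?U}", OF plot_chart_open[OF f c(1)] _ _ plot_smooth_map[OF B F f] x])
      (use x c(2) chart_inv_chart[OF p] in auto)
  then show ?thesis
    using pder_compose[OF FP pder_works[OF f x], of v] c(2) tderiv_eq_pder[OF p, of B F] by simp
qed

lemma chart_point_in: "p \<in> points_of A \<Longrightarrow> chart_map A p p \<in> chart_map A p ` fst (chart_at A p)"
  by (rule imageI) (rule chart_at_mem(2))

lemma pder_chart_inv:
  assumes p: "p \<in> points_of A"
  shows "pder A (chart_inv A p) (chart_map A p p) v = v"
proof -
  have "((\<lambda>y. chart_map A p (chart_inv A p y)) has_derivative (\<lambda>v. v)) (at (chart_map A p p))"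
    by (rule has_derivative_transform_within_open[OF has_derivative_ident chart_image_open[OF chart_at_mem(1)[OF p]] chart_point_in[OF p]])
      (simp add: chart_inv_def f_inv_into_f)
  then have "pder A (chart_inv A p) (chart_map A p p) = (\<lambda>v. v)"
    by (intro pder_eqI) (simp add: chart_inv_point[OF p])
  then show ?thesis by simp
qed

lemma tderiv_ident: "p \<in> points_of A \<Longrightarrow> tderiv A A (\<lambda>x. x) p v = v"
  by (simp add: tderiv_eq_pder pder_chart_inv)

lemma tderiv_compose:
  assumes B: "charted B" and C: "charted C" and F: "smooth_map A B F" and E: "smooth_map B C E"
    and p: "p \<in> points_of A"
  shows "tderiv A C (\<lambda>x. E (F x)) p v = tderiv B C E (F p) (tderiv A B F p v)"
  using charted.pder_smooth_map[OF B C E plot_smooth_map[OF B F plot_chart_inv[OF p]] chart_point_in[OF p], of v]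
  by (simp add: tderiv_eq_pder[OF p] chart_inv_point[OF p])

lemma tderiv_cong:
  assumes B: "charted B" and F: "smooth_map A B F" and eq: "\<And>x. x \<in> points_of A \<Longrightarrow> F x = F' x"
    and p: "p \<in> points_of A"
  shows "tderiv A B F' p = tderiv A B F p"
  unfolding tderiv_eq_pder[OF p]
  by (rule pder_cong[OF plot_open[OF plot_chart_inv[OF p]] chart_point_in[OF p] _
        plot_smooth_map[OF B F plot_chart_inv[OF p]] chart_point_in[OF p]])
    (use eq plot_in[OF plot_chart_inv[OF p]] in blast)

text \<open>The linear map on the right is the change of coordinates that
  \<open>tangent_atlas\<close> uses. The left-hand side involves a chart that stays fixed when
  \<open>x\<close> moves, which makes derivatives at different points comparable.\<close>

lemma frechet_derivative_chart:
  assumes f: "plot A W f" and c: "(U, \<phi>) \<in> A" and x: "x \<in> W" "f x \<in> U"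
  shows "frechet_derivative (\<lambda>y. \<phi> (f y)) (at x) v
    = frechet_derivative (\<lambda>z. \<phi> (chart_inv A (f x) z)) (at (chart_map A (f x) (f x))) (pder A f x v)"
proof -
  note p = plot_in[OF f x(1)]
  note ch = chart_at_mem[OF p]
  let ?h = "\<lambda>z. \<phi> (chart_inv A (f x) z)"
  let ?y = "chart_map A (f x) (f x)"
  have "(?h has_derivative frechet_derivative ?h (at ?y)) (at ?y)"
    by (rule plot_chart_has_derivative[OF plot_chart_inv[OF p] c chart_point_in[OF p]])
      (simp add: chart_inv_point[OF p] x(2))
  from has_derivative_compose[OF pder_works[OF f x(1)] this]
  have "((\<lambda>y. \<phi> (f y)) has_derivative (\<lambda>v. frechet_derivative ?h (at ?y) (pder A f x v))) (at x)"
    by (rule has_derivative_transform_within_open[OF _ plot_chart_open[OF f ch(1)]])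
      (use x ch(2) chart_inv_chart[OF p] in auto)
  from fun_cong[OF frechet_derivative_at[OF this], of v] show ?thesis by (rule sym)
qed

lemma linear_tderiv:
  assumes B: "charted B" and F: "smooth_map A B F" and p: "p \<in> points_of A"
  shows "linear (tderiv A B F p)"
  unfolding tderiv_eq_pder[OF p]
  by (rule linear_pder[OF plot_smooth_map[OF B F plot_chart_inv[OF p]]]) (use chart_at_mem[OF p] in blast)

text \<open>Converse of \<open>plot_smooth_map\<close>: the inverse charts suffice as test plots.
  The open set demanded by \<open>smooth_map\<close> is the part of a chart domain that
  \<open>F\<close> sends into one chart of \<open>B\<close>.\<close>

lemma smooth_mapI:
  assumes B: "charted B" and F: "\<And>U \<phi>. (U, \<phi>) \<in> A \<Longrightarrow> plot B (\<phi> ` U) (\<lambda>y. F (inv_into U \<phi> y))"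
  shows "smooth_map A B F"
proof -
  have Fp: "F p \<in> points_of B" if "p \<in> points_of A" for p
  proof -
    note c = chart_at_mem[OF that]
    show ?thesis using plot_in[OF F[OF c(1)], of "chart_map A p p"] c(2) chart_inv_point[OF that]
      by (simp add: chart_inv_def)
  qed
  have "\<exists>(U, \<phi>)\<in>A. \<exists>(V, \<psi>)\<in>B. \<exists>W. openin (mtopology A) W \<and> p \<in> W \<and> W \<subseteq> U \<and> F ` W \<subseteq> V \<and>
      smooth_on (\<phi> ` W) (\<psi> \<circ> F \<circ> inv_into U \<phi>)" if p: "p \<in> points_of A" for p
  proof -
    let ?U = "fst (chart_at A p)" and ?\<phi> = "chart_map A p"
    let ?V = "fst (chart_at B (F p))" and ?\<psi> = "chart_map B (F p)"
    note c = chart_at_mem[OF p]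
    note d = chart_at_mem[OF Fp[OF p]]
    let ?W = "{q\<in>?U. F q \<in> ?V}"
    have opW: "open (\<phi> ` (?W \<inter> U))" if uc: "(U, \<phi>) \<in> A" for U \<phi>
    proof -
      have "\<phi> ` (?W \<inter> U) = {y\<in>\<phi> ` U. inv_into U \<phi> y \<in> ?U} \<inter> {y\<in>\<phi> ` U. F (inv_into U \<phi> y) \<in> ?V}"
        using inv_into_f_f[OF chart_inj[OF uc]] by (auto simp: image_iff)
      then show ?thesis
        using plot_chart_open[OF plot_inv_chart[OF uc] c(1)] plot_chart_open[OF F[OF uc] d(1)] by auto
    qed
    have oW: "openin (mtopology A) ?W"
      unfolding openin_mtopology[OF atlas] using opW chart_subset_points[OF c(1)] by auto
    have ow: "open (?\<phi> ` ?W)" using openin_image(1)[OF oW c(1)] by (simp add: Int_absorb2)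
    have "Cinf_on (?\<phi> ` ?W) (\<lambda>y. ?\<psi> (F (inv_into ?U ?\<phi> y)))"
      by (rule Cinf_on_subset[OF plot_chart[OF F[OF c(1)] d(1)]])
        (use inv_into_f_f[OF chart_inj[OF c(1)]] in auto)
    then have "smooth_on (?\<phi> ` ?W) (?\<psi> \<circ> F \<circ> inv_into ?U ?\<phi>)"
      unfolding Cinf_on_smooth_on[OF ow] by (simp add: o_def)
    then show ?thesis
      using oW c d by (intro bexI[OF _ c(1)] bexI[OF _ d(1)] case_prodI exI[of _ ?W]) auto
  qed
  then show ?thesis unfolding smooth_map_def using Fp by blast
qed

section \<open>Curves on intervals and their extension to plots\<close>

lemma plot_imp_smooth_curve:
  assumes f: "plot A J f" and "K \<subseteq> J" and eq: "\<And>t. t \<in> K \<Longrightarrow> c t = f t"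
  shows "smooth_curve A K c"
  unfolding smooth_curve_def
proof
  fix t assume t: "t \<in> K"
  note ch = chart_at_mem[OF plot_in[OF f, of t]]
  let ?U = "fst (chart_at A (f t))" and ?\<phi> = "chart_map A (f t)"
  have tJ: "t \<in> J" using t assms(2) by blast
  let ?V = "{s\<in>J. f s \<in> ?U}"
  have "open ?V" "t \<in> ?V" using plot_chart_open[OF f ch(1)[OF tJ]] ch(2)[OF tJ] tJ by auto
  then obtain \<epsilon> where \<epsilon>: "\<epsilon> > 0" "ball t \<epsilon> \<subseteq> ?V" using open_contains_ball by blast
  have "Cinf_on (ball t \<epsilon>) (\<lambda>s. ?\<phi> (f s))"
    using Cinf_on_subset[OF plot_chart[OF f ch(1)[OF tJ]] \<epsilon>(2)] .
  then have "smooth_on (K \<inter> ball t \<epsilon>) (?\<phi> \<circ> c)"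
    unfolding smooth_on_def Cinf_on_def
    by (intro ballI exI[of _ "ball t \<epsilon>"] exI[of _ "\<lambda>s. ?\<phi> (f s)"]) (auto simp: eq)
  then show "\<exists>(U, \<phi>)\<in>A. \<exists>\<epsilon>>0. c ` (K \<inter> ball t \<epsilon>) \<subseteq> U \<and> smooth_on (K \<inter> ball t \<epsilon>) (\<phi> \<circ> c)"
    using \<epsilon> eq by (intro bexI[OF _ ch(1)[OF tJ]] case_prodI exI[of _ \<epsilon>]) auto
qed

lemma smooth_curve_imp_plot:
  assumes "open J" "smooth_curve A J c"
  shows "plot A J c"
proof (rule plotI[OF assms(1)])
  fix t assume t: "t \<in> J"
  then obtain U \<phi> \<epsilon> where U: "(U, \<phi>) \<in> A" "\<epsilon> > 0" "c ` (J \<inter> ball t \<epsilon>) \<subseteq> U" "smooth_on (J \<inter> ball t \<epsilon>) (\<phi> \<circ> c)"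
    using assms(2) unfolding smooth_curve_def by blast
  have o: "open (J \<inter> ball t \<epsilon>)" using assms by auto
  show "\<exists>V U \<phi>. (U, \<phi>) \<in> A \<and> open V \<and> t \<in> V \<and> V \<subseteq> J \<and> c ` V \<subseteq> U \<and> Cinf_on V (\<lambda>x. \<phi> (c x))"
    using U o t Cinf_on_smooth_on[OF o, of "\<phi> \<circ> c"]
    by (intro exI[of _ "J \<inter> ball t \<epsilon>"] exI[of _ U] exI[of _ \<phi>]) (auto simp: o_def)
qed

text \<open>A velocity taken within \<open>K\<close>, possibly one-sided, equals the two-sided
  derivative of any plot that extends the curve, because \<open>t\<close> is a limit point of
  \<open>K\<close> and the derivative within \<open>K\<close> is therefore unique.\<close>

lemma velocity_eq_pder:
  assumes f: "plot A J f" and "t \<in> J" "t \<in> K" and eq: "\<And>s. s \<in> K \<Longrightarrow> c s = f s" and nt: "at t within K \<noteq> bot"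
  shows "velocity A K c t = pder A f t 1"
proof -
  have "(\<lambda>v. v *\<^sub>R pder A f t 1) = pder A f t"
  proof
    fix v show "v *\<^sub>R pder A f t 1 = pder A f t v"
      using linear_scale[OF linear_pder[OF f \<open>t \<in> J\<close>], of v 1] by simp
  qed
  then have "((\<lambda>s. chart_map A (f t) (f s)) has_vector_derivative pder A f t 1) (at t)"
    unfolding has_vector_derivative_def using pder_works[OF f \<open>t \<in> J\<close>] by simp
  then have "((\<lambda>s. chart_map A (f t) (f s)) has_vector_derivative pder A f t 1) (at t within K)"
    by (rule has_vector_derivative_at_within)
  then have "((\<lambda>s. chart_map A (c t) (c s)) has_vector_derivative pder A f t 1) (at t within K)"
    by (rule has_vector_derivative_transform[rotated 2]) (use eq \<open>t \<in> K\<close> in auto)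
  then show ?thesis
    unfolding velocity_def o_def using vector_derivative_within[OF nt] by blast
qed

lemma smooth_curve_local_extension:
  assumes "smooth_curve A K c" "t \<in> K"
  shows "\<exists>\<delta>>0. \<exists>f. plot A (ball t \<delta>) f \<and> (\<forall>s\<in>K \<inter> ball t \<delta>. f s = c s)"
proof -
  obtain U \<phi> \<epsilon> where U: "(U, \<phi>) \<in> A" "\<epsilon> > 0" "c ` (K \<inter> ball t \<epsilon>) \<subseteq> U" "smooth_on (K \<inter> ball t \<epsilon>) (\<phi> \<circ> c)"
    using assms unfolding smooth_curve_def by blast
  have "t \<in> K \<inter> ball t \<epsilon>" using assms(2) U(2) by simp
  then obtain W F where W: "open W" "t \<in> W" "\<forall>k. Ck_on k F W" "\<forall>s\<in>K \<inter> ball t \<epsilon> \<inter> W. (\<phi> \<circ> c) s = F s"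
    using U(4) unfolding smooth_on_def by blast
  have F: "Cinf_on W F" using W(3) by (simp add: Cinf_on_def)
  \<comment> \<open>Off \<open>K\<close> the extension \<open>F\<close> could leave the image of the
    chart; shrinking the domain keeps it where the inverse chart makes sense.\<close>
  let ?V = "ball t \<epsilon> \<inter> (W \<inter> F -` (\<phi> ` U))"
  have "F t = \<phi> (c t)" using W(2,4) assms(2) U(2) by auto
  moreover have "c t \<in> U" using U(2,3) assms(2) by auto
  ultimately have "t \<in> ?V" using W(2) U(2,3) assms(2) by auto
  moreover have "open ?V"
    by (intro open_Int open_ball continuous_open_preimage[OF Cinf_on_continuous[OF F] W(1) chart_image_open[OF U(1)]])
  ultimately obtain \<delta> where \<delta>: "\<delta> > 0" "ball t \<delta> \<subseteq> ?V" using open_contains_ball by blast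
  have "plot A (ball t \<delta>) (\<lambda>s. inv_into U \<phi> (F s))"
    by (rule plot_compose[OF fin_dim plot_inv_chart[OF U(1)] open_ball Cinf_on_subset[OF F]]) (use \<delta>(2) in auto)
  moreover have "inv_into U \<phi> (F s) = c s" if "s \<in> K \<inter> ball t \<delta>" for s
  proof -
    have "s \<in> K \<inter> ball t \<epsilon> \<inter> W" using that \<delta>(2) by blast
    then have "F s = \<phi> (c s)" "c s \<in> U" using W(4) U(3) by auto
    then show ?thesis using inv_into_f_f[OF chart_inj[OF U(1)]] by simp
  qed
  ultimately show ?thesis using \<delta>(1) by (intro exI[of _ \<delta>] conjI exI[of _ "\<lambda>s. inv_into U \<phi> (F s)"]) auto
qed

text \<open>Only the two endpoints need an extension. Gluing it to \<open>c\<close> is harmless,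
  since near each endpoint a single plot agrees with \<open>c\<close> inside the interval and
  supplies the values outside.\<close>

lemma smooth_curve_extension:
  assumes "smooth_curve A {0..1} c"
  obtains e f where "e > 0" "plot A {-e<..<1+e} f" "\<And>t. t \<in> {0..1} \<Longrightarrow> f t = c t"
proof -
  have u: "(0::real) \<in> {0..1}" "(1::real) \<in> {0..1}" by auto
  obtain d0 f0 where d0: "d0 > 0" "plot A (ball 0 d0) f0" "\<And>s. s \<in> {0..1} \<inter> ball 0 d0 \<Longrightarrow> f0 s = c s"
    using smooth_curve_local_extension[OF assms u(1)] by blast
  obtain d1 f1 where d1: "d1 > 0" "plot A (ball 1 d1) f1" "\<And>s. s \<in> {0..1} \<inter> ball 1 d1 \<Longrightarrow> f1 s = c s"
    using smooth_curve_local_extension[OF assms u(2)] by blast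
  \<comment> \<open>With \<open>e \<le> 1\<close> the ball around one endpoint does not reach past
    the other, so it meets only one of the two extensions.\<close>
  define e where "e = min (min d0 d1) (1::real)"
  have e: "e > 0" "e \<le> d0" "e \<le> d1" "e \<le> 1" using d0(1) d1(1) by (auto simp: e_def)
  define f where "f t = (if t < 0 then f0 t else if t > 1 then f1 t else c t)" for t
  have "plot A {-e<..<1+e} f"
  proof (rule plot_local)
    fix t assume t: "t \<in> {-e<..<1+e}"
    consider "t < e" | "t > 1 - e" | "0 < t" "t < 1" using e by force
    then show "\<exists>V. open V \<and> t \<in> V \<and> plot A V f"
    proof cases
      case 1
      have "plot A (ball 0 e) f"
        by (rule plot_cong[OF plot_subset[OF d0(2)]]) (use e d0(3) in \<open>auto simp: f_def\<close>)
      then show ?thesis using t 1 by (intro exI[of _ "ball 0 e"]) auto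
    next
      case 2
      have "plot A (ball 1 e) f"
        by (rule plot_cong[OF plot_subset[OF d1(2)]]) (use e d1(3) in \<open>auto simp: f_def dist_real_def\<close>)
      then show ?thesis using t 2 by (intro exI[of _ "ball 1 e"]) (auto simp: dist_real_def)
    next
      case 3
      then obtain d g where d: "d > 0" "plot A (ball t d) g" "\<forall>s\<in>{0..1} \<inter> ball t d. g s = c s"
        using smooth_curve_local_extension[OF assms, of t] by (metis atLeastAtMost_iff less_imp_le)
      have "plot A (ball t d \<inter> {0<..<1}) f"
        by (rule plot_cong[OF plot_subset[OF d(2)]]) (use d(3) in \<open>auto simp: f_def\<close>)
      then show ?thesis using 3 d(1) by (intro exI[of _ "ball t d \<inter> {0<..<1}"]) auto
    qed
  qed auto
  then show ?thesis using that[of e f] e(1) by (auto simp: f_def)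
qed

text \<open>In the chart chosen at \<open>f a\<close> the derivative vanishes on a convex
  neighbourhood of \<open>a\<close> in \<open>K\<close>, so the coordinates are constant there, and
  so is \<open>f\<close> by injectivity of the chart. Connectedness of \<open>K\<close> makes this
  global.\<close>

lemma locally_constant_plot:
  fixes f :: "real \<Rightarrow> 'p"
  assumes f: "plot A W f" and K: "K \<subseteq> W" "is_interval K" and d: "\<And>t. t \<in> K \<Longrightarrow> pder A f t 1 = 0"
    and st: "s \<in> K" "t \<in> K"
  shows "f s = f t"
proof (rule connected_local_const[of K s t f])
  show "connected K" using K(2) is_interval_connected by blast
  show "\<forall>a\<in>K. eventually (\<lambda>b. f a = f b) (at a within K)"
  proof
    fix a assume a: "a \<in> K"
    then have aW: "a \<in> W" using K by blast
    note ch = chart_at_mem[OF plot_in[OF f aW]]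
    let ?U = "fst (chart_at A (f a))" and ?\<phi> = "chart_map A (f a)"
    obtain r where r: "r > 0" "ball a r \<subseteq> {x\<in>W. f x \<in> ?U}"
      using plot_chart_open[OF f ch(1)] aW ch(2) open_contains_ball by (metis (mono_tags, lifting) mem_Collect_eq)
    let ?S = "K \<inter> ball a r"
    have conv: "convex ?S" using K(2) is_interval_convex by (intro convex_Int) auto
    \<comment> \<open>The hypothesis at \<open>b\<close> refers to the chart chosen at
      \<open>f b\<close>, not to \<open>?\<phi>\<close>; the change of coordinates is linear and so
      sends 0 to 0.\<close>
    have "((\<lambda>y. ?\<phi> (f y)) has_derivative (\<lambda>h. 0)) (at b within ?S)" if b: "b \<in> ?S" for b
    proof -
      have bW: "b \<in> W" "f b \<in> ?U" using b r(2) by auto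
      have p0: "pder A f b v = 0" for v
        using linear_scale[OF linear_pder[OF f bW(1)], of v 1] d[of b] b by simp
      let ?h = "\<lambda>z. ?\<phi> (chart_inv A (f b) z)"
      let ?y = "chart_map A (f b) (f b)"
      note pb = plot_in[OF f bW(1)]
      have "(?h has_derivative frechet_derivative ?h (at ?y)) (at ?y)"
        by (rule plot_chart_has_derivative[OF plot_chart_inv[OF pb] ch(1) chart_point_in[OF pb]])
          (simp add: chart_inv_point[OF pb] bW(2))
      from linear_0[OF has_derivative_linear[OF this]]
      have "frechet_derivative (\<lambda>y. ?\<phi> (f y)) (at b) = (\<lambda>v. 0)"
        by (intro ext) (simp add: frechet_derivative_chart[OF f ch(1) bW] p0)
      with plot_chart_has_derivative[OF f ch(1) bW]
      have "((\<lambda>y. ?\<phi> (f y)) has_derivative (\<lambda>v. 0)) (at b)" by simp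
      then show ?thesis by (rule has_derivative_at_withinI)
    qed
    from has_derivative_zero_constant[OF conv this]
    obtain k where k: "\<And>b. b \<in> ?S \<Longrightarrow> ?\<phi> (f b) = k" by blast
    have "f a = f b" if "b \<in> ?S" for b
    proof (rule inj_onD[OF chart_inj[OF ch(1)]])
      show "?\<phi> (f a) = ?\<phi> (f b)" using k that a r(1) by (metis IntI centre_in_ball)
    qed (use that r(2) ch(2) in auto)
    then show "eventually (\<lambda>b. f a = f b) (at a within K)"
      unfolding eventually_at using r(1) by (intro exI[of _ r]) (auto simp: dist_commute)
  qed
qed (use st in auto)

end

section \<open>Products and maps of two variables\<close>

lemma charted_prod:
  fixes A :: "('p, 'e::banach) atlas" and B :: "('q, 'f::banach) atlas"
  assumes "charted A" "charted B"
  shows "charted (prod_atlas A B)"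
proof -
  interpret A: charted A by fact
  interpret B: charted B by fact
  have fd: "fin_dim TYPE('e \<times> 'f)" using fin_dim_prod[OF A.fin_dim B.fin_dim] .
  have inv: "inv_into (U \<times> V) (map_prod \<phi> \<psi>) (\<phi> u, \<psi> v) = (u, v)"
    if "(U, \<phi>) \<in> A" "(V, \<psi>) \<in> B" "u \<in> U" "v \<in> V" for U \<phi> V \<psi> u v
    using inv_into_f_f[OF map_prod_inj_on[OF A.chart_inj[OF that(1)] B.chart_inj[OF that(2)]], of "(u, v)"] that(3,4) by simp
  have "open (map_prod \<phi> \<psi> ` ((U \<times> V) \<inter> (U' \<times> V'))) \<and>
    smooth_on (map_prod \<phi> \<psi> ` ((U \<times> V) \<inter> (U' \<times> V'))) (map_prod \<phi>' \<psi>' \<circ> inv_into (U \<times> V) (map_prod \<phi> \<psi>))"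
    if c: "(U, \<phi>) \<in> A" "(V, \<psi>) \<in> B" "(U', \<phi>') \<in> A" "(V', \<psi>') \<in> B" for U \<phi> V \<psi> U' \<phi>' V' \<psi>'
  proof -
    let ?O1 = "\<phi> ` (U \<inter> U')" and ?O2 = "\<psi> ` (V \<inter> V')"
    have im: "map_prod \<phi> \<psi> ` ((U \<times> V) \<inter> (U' \<times> V')) = ?O1 \<times> ?O2"
      by (auto simp: Times_Int_Times)
    have o1: "open ?O1" and o2: "open ?O2" using A.overlap_open B.overlap_open c by blast+
    then have o: "open (?O1 \<times> ?O2)" by (rule open_Times)
    have "Cinf_on (?O1 \<times> ?O2) (\<lambda>p. (\<phi>' (inv_into U \<phi> (fst p)), \<psi>' (inv_into V \<psi> (snd p))))"
      by (intro Cinf_on_Pair o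
        Cinf_on_compose[OF A.fin_dim o o1 _ A.transition_Cinf[OF c(1,3)] Cinf_on_bounded_linear[OF o bounded_linear_fst Cinf_on_ident[OF o]]]
        Cinf_on_compose[OF B.fin_dim o o2 _ B.transition_Cinf[OF c(2,4)] Cinf_on_bounded_linear[OF o bounded_linear_snd Cinf_on_ident[OF o]]]) auto
    then have "Cinf_on (?O1 \<times> ?O2) (map_prod \<phi>' \<psi>' \<circ> inv_into (U \<times> V) (map_prod \<phi> \<psi>))"
      by (rule Cinf_on_cong[OF o, rotated])
        (use inv[OF c(1,2)] inv_into_f_f[OF A.chart_inj[OF c(1)]] inv_into_f_f[OF B.chart_inj[OF c(2)]] in auto)
    then show ?thesis unfolding im using o Cinf_on_smooth_on[OF o] by blast
  qed
  moreover have "inj_on (map_prod \<phi> \<psi>) (U \<times> V)" if "(U, \<phi>) \<in> A" "(V, \<psi>) \<in> B" for U \<phi> V \<psi>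
    using map_prod_inj_on[OF A.chart_inj[OF that(1)] B.chart_inj[OF that(2)]] .
  ultimately have "smooth_atlas (prod_atlas A B)"
    unfolding smooth_atlas_def prod_atlas_def by (auto simp: split_beta)
  then show ?thesis using fd by (simp add: charted_def)
qed

lemma points_of_prod_atlas: "points_of (prod_atlas A B) = points_of A \<times> points_of B"
  unfolding points_of_def prod_atlas_def by force

lemma plot_Pair:
  assumes A: "charted A" and B: "charted B" and f: "plot A W f" and g: "plot B W g"
  shows "plot (prod_atlas A B) W (\<lambda>x. (f x, g x))"
proof (rule plotI_charts[OF plot_open[OF f]])
  show "(f x, g x) \<in> points_of (prod_atlas A B)" if "x \<in> W" for x
    using plot_in[OF f that] plot_in[OF g that] by (simp add: points_of_prod_atlas)
  fix C \<gamma> assume "(C, \<gamma>) \<in> prod_atlas A B"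
  then obtain U \<phi> V \<psi> where c: "(U, \<phi>) \<in> A" "(V, \<psi>) \<in> B" "C = U \<times> V" "\<gamma> = map_prod \<phi> \<psi>"
    unfolding prod_atlas_def by auto
  have eq: "{x\<in>W. (f x, g x) \<in> C} = {x\<in>W. f x \<in> U} \<inter> {x\<in>W. g x \<in> V}" using c(3) by auto
  show o: "open {x\<in>W. (f x, g x) \<in> C}"
    unfolding eq by (intro open_Int plot_chart_open[OF f c(1)] plot_chart_open[OF g c(2)])
  have "Cinf_on {x\<in>W. (f x, g x) \<in> C} (\<lambda>x. (\<phi> (f x), \<psi> (g x)))"
    by (intro Cinf_on_Pair o Cinf_on_subset[OF plot_chart[OF f c(1)]] Cinf_on_subset[OF plot_chart[OF g c(2)]])
      (auto simp: eq)
  then show "Cinf_on {x\<in>W. (f x, g x) \<in> C} (\<lambda>x. \<gamma> (f x, g x))" by (simp add: c(4))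
qed

text \<open>The test plots live on the model space \<open>'e \<times> 'f\<close> of the product,
  because a premise cannot quantify over the domain type. Inverse product charts are of this kind,
  so nothing more general is required.\<close>

lemma smooth_map_prodI:
  fixes A :: "('p, 'e::banach) atlas" and B :: "('q, 'f::banach) atlas" and C :: "('r, 'h::banach) atlas"
  assumes A: "charted A" and B: "charted B" and C: "charted C"
    and F: "\<And>W (f :: 'e \<times> 'f \<Rightarrow> 'p) (g :: 'e \<times> 'f \<Rightarrow> 'q). plot A W f \<Longrightarrow> plot B W g \<Longrightarrow> plot C W (\<lambda>x. F (f x, g x))"
  shows "smooth_map (prod_atlas A B) C F"
proof (rule charted.smooth_mapI[OF charted_prod[OF A B] C])
  interpret A: charted A by fact
  interpret B: charted B by fact
  fix D \<gamma> assume "(D, \<gamma>) \<in> prod_atlas A B"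
  then obtain U \<phi> V \<psi> where c: "(U, \<phi>) \<in> A" "(V, \<psi>) \<in> B" "D = U \<times> V" "\<gamma> = map_prod \<phi> \<psi>"
    unfolding prod_atlas_def by auto
  have im: "\<gamma> ` D = \<phi> ` U \<times> \<psi> ` V" by (auto simp: c)
  have o: "open (\<gamma> ` D)" unfolding im by (intro open_Times A.chart_image_open B.chart_image_open c)
  have 1: "plot A (\<gamma> ` D) (\<lambda>y. inv_into U \<phi> (fst y))"
    by (rule plot_compose[OF A.fin_dim A.plot_inv_chart[OF c(1)] o Cinf_on_bounded_linear[OF o bounded_linear_fst Cinf_on_ident[OF o]]])
      (auto simp: im)
  have 2: "plot B (\<gamma> ` D) (\<lambda>y. inv_into V \<psi> (snd y))"
    by (rule plot_compose[OF B.fin_dim B.plot_inv_chart[OF c(2)] o Cinf_on_bounded_linear[OF o bounded_linear_snd Cinf_on_ident[OF o]]])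
      (auto simp: im)
  have "(inv_into U \<phi> (fst y), inv_into V \<psi> (snd y)) = inv_into D \<gamma> y" if "y \<in> \<gamma> ` D" for y
  proof -
    have "fst y \<in> \<phi> ` U" "snd y \<in> \<psi> ` V" using that unfolding im by auto
    then obtain u v where "u \<in> U" "fst y = \<phi> u" "v \<in> V" "snd y = \<psi> v" by blast
    then have uv: "u \<in> U" "v \<in> V" "y = (\<phi> u, \<psi> v)" by (auto simp: prod_eq_iff)
    have "inv_into D \<gamma> (\<gamma> (u, v)) = (u, v)"
      by (rule inv_into_f_f) (use uv c(3,4) map_prod_inj_on[OF A.chart_inj[OF c(1)] B.chart_inj[OF c(2)]] in auto)
    then show ?thesis
      using uv inv_into_f_f[OF A.chart_inj[OF c(1)] uv(1)] inv_into_f_f[OF B.chart_inj[OF c(2)] uv(2)] by (simp add: c(4))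
  qed
  then show "plot C (\<gamma> ` D) (\<lambda>y. F (inv_into D \<gamma> y))"
    by (intro plot_cong[OF F[OF 1 2]]) simp
qed

lemma plot_binary:
  assumes A: "charted A" and B: "charted B" and C: "charted C" and F: "smooth_map (prod_atlas A B) C F"
    and f: "plot A W f" and g: "plot B W g"
  shows "plot C W (\<lambda>x. F (f x, g x))"
  using charted.plot_smooth_map[OF charted_prod[OF A B] C F plot_Pair[OF A B f g]] .

lemma smooth_map_partial:
  assumes A: "charted A" and B: "charted B" and C: "charted C" and F: "smooth_map (prod_atlas A B) C F"
  shows "q \<in> points_of B \<Longrightarrow> smooth_map A C (\<lambda>p. F (p, q))"
    and "p \<in> points_of A \<Longrightarrow> smooth_map B C (\<lambda>q. F (p, q))"
proof -
  show "smooth_map A C (\<lambda>p. F (p, q))" if "q \<in> points_of B"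
    by (rule charted.smooth_mapI[OF A C], rule plot_binary[OF A B C F charted.plot_inv_chart[OF A]
      plot_const[OF charted.chart_image_open[OF A] that]])
  show "smooth_map B C (\<lambda>q. F (p, q))" if "p \<in> points_of A"
    by (rule charted.smooth_mapI[OF B C], rule plot_binary[OF A B C F
      plot_const[OF charted.chart_image_open[OF B] that] charted.plot_inv_chart[OF B]])
qed

text \<open>Product rule for an arbitrary smooth map of two variables. The two occurrences of
  \<open>x\<close> are made independent, giving a plot \<open>P\<close> on
  \<open>W \<times> W\<close>; its derivative at the diagonal is applied to
  \<open>(v, v) = (v, 0) + (0, v)\<close>.\<close>

lemma pder_binary:
  fixes f :: "'x::real_normed_vector \<Rightarrow> 'p" and g :: "'x \<Rightarrow> 'q"
  assumes X: "fin_dim TYPE('x)"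
    and A: "charted A" and B: "charted B" and C: "charted C" and F: "smooth_map (prod_atlas A B) C F"
    and f: "plot A W f" and g: "plot B W g" and x: "x \<in> W"
  shows "pder C (\<lambda>x. F (f x, g x)) x v
    = tderiv A C (\<lambda>p. F (p, g x)) (f x) (pder A f x v) + tderiv B C (\<lambda>q. F (f x, q)) (g x) (pder B g x v)"
proof -
  have o: "open (W \<times> W)" using plot_open[OF f] by (intro open_Times) auto
  have 1: "plot A (W \<times> W) (\<lambda>z. f (fst z))"
    by (rule plot_compose[OF X f o Cinf_on_bounded_linear[OF o bounded_linear_fst Cinf_on_ident[OF o]]]) auto
  have 2: "plot B (W \<times> W) (\<lambda>z. g (snd z))"
    by (rule plot_compose[OF X g o Cinf_on_bounded_linear[OF o bounded_linear_snd Cinf_on_ident[OF o]]]) auto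
  define P where "P z = F (f (fst z), g (snd z))" for z
  have P: "plot C (W \<times> W) P" unfolding P_def by (rule plot_binary[OF A B C F 1 2])
  have xx: "(x, x) \<in> W \<times> W" using x by simp
  have d1: "((\<lambda>s. (s, x)) has_derivative (\<lambda>v. (v, 0))) (at x)" by (auto intro!: derivative_eq_intros)
  have d2: "((\<lambda>s. (x, s)) has_derivative (\<lambda>v. (0, v))) (at x)" by (auto intro!: derivative_eq_intros)
  have d3: "((\<lambda>s. (s, s)) has_derivative (\<lambda>v. (v, v))) (at x)" by (auto intro!: derivative_eq_intros)
  have "pder C (\<lambda>x. F (f x, g x)) x v = pder C P (x, x) (v, v)"
    using pder_compose[OF P d3 xx] by (simp add: P_def)
  also have "\<dots> = pder C P (x, x) ((v, 0) + (0, v))" by simp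
  also have "\<dots> = pder C P (x, x) (v, 0) + pder C P (x, x) (0, v)"
    by (rule linear_add[OF linear_pder[OF P xx]])
  also have "pder C P (x, x) (v, 0) = pder C (\<lambda>s. F (f s, g x)) x v"
    using pder_compose[OF P d1 xx] by (simp add: P_def)
  also have "\<dots> = tderiv A C (\<lambda>p. F (p, g x)) (f x) (pder A f x v)"
    by (rule charted.pder_smooth_map[OF A C smooth_map_partial(1)[OF A B C F plot_in[OF g x]] f x])
  also have "pder C P (x, x) (0, v) = pder C (\<lambda>s. F (f x, g s)) x v"
    using pder_compose[OF P d2 xx] by (simp add: P_def)
  also have "\<dots> = tderiv B C (\<lambda>q. F (f x, q)) (g x) (pder B g x v)"
    by (rule charted.pder_smooth_map[OF B C smooth_map_partial(2)[OF A B C F plot_in[OF f x]] g x])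
  finally show ?thesis .
qed


section \<open>Smooth actions and the evolution map\<close>

lemma at_unit_int_nontrivial: "t \<in> {0..1::real} \<Longrightarrow> at t within {0..1} \<noteq> bot"
  by (simp add: trivial_limit_within islimpt_Icc)

sublocale smooth_manifold \<subseteq> charted A
  using finite_dim smooth_atlas by unfold_locales (auto intro: fin_dim_spanning)

locale smooth_action = lie_group G A + B: charted B
  for G :: "('g, 'b) monoid_scheme" (structure) and A :: "('g, 'e::banach) atlas" and B :: "('q, 'f::banach) atlas" +
  fixes act :: "'g \<Rightarrow> 'q \<Rightarrow> 'q"
  assumes smooth_act: "smooth_map (prod_atlas A B) B (\<lambda>(g, p). act g p)"
    and act_one: "p \<in> points_of B \<Longrightarrow> act \<one> p = p"
    and act_mult: "\<lbrakk>g \<in> carrier G; h \<in> carrier G; p \<in> points_of B\<rbrakk> \<Longrightarrow> act (g \<otimes> h) p = act g (act h p)"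
begin

lemma plot_act: "plot A W g \<Longrightarrow> plot B W c \<Longrightarrow> plot B W (\<lambda>x. act (g x) (c x))"
  using plot_binary[OF charted_axioms B.charted_axioms B.charted_axioms smooth_act, of W g c] by simp

lemma smooth_act_left: "g \<in> carrier G \<Longrightarrow> smooth_map B B (act g)"
  using smooth_map_partial(2)[OF charted_axioms B.charted_axioms B.charted_axioms smooth_act, of g]
  by (simp add: points_of_eq)

lemma smooth_act_right: "p \<in> points_of B \<Longrightarrow> smooth_map A B (\<lambda>g. act g p)"
  using smooth_map_partial(1)[OF charted_axioms B.charted_axioms B.charted_axioms smooth_act, of p] by simp

lemma pder_act:
  assumes "fin_dim TYPE('x::real_normed_vector)" "plot A W g" "plot B W c" "(x::'x) \<in> W"
  shows "pder B (\<lambda>x. act (g x) (c x)) x v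
    = tderiv A B (\<lambda>h. act h (c x)) (g x) (pder A g x v) + tderiv B B (act (g x)) (c x) (pder B c x v)"
  using pder_binary[OF assms(1) charted_axioms B.charted_axioms B.charted_axioms smooth_act assms(2-4), of v] by simp

lemma tderiv_act_inverse:
  assumes g: "g \<in> carrier G" and p: "p \<in> points_of B"
  shows "tderiv B B (act g) (act (inv g) p) (tderiv B B (act (inv g)) p v) = v"
proof -
  note sm = smooth_act_left[OF g] smooth_act_left[OF inv_closed[OF g]]
  have "tderiv B B (\<lambda>p. act g (act (inv g) p)) p = tderiv B B (\<lambda>p. p) p"
  proof (rule B.tderiv_cong[OF B.charted_axioms _ _ p])
    show "smooth_map B B (\<lambda>p. p)"
      by (rule B.smooth_mapI[OF B.charted_axioms B.plot_inv_chart])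
    show "x = act g (act (inv g) x)" if "x \<in> points_of B" for x
      using act_mult[OF g inv_closed[OF g] that] act_one[OF that] g by simp
  qed
  then show ?thesis
    using B.tderiv_compose[OF B.charted_axioms B.charted_axioms sm(2,1) p, of v] B.tderiv_ident[OF p] by simp
qed

end

section \<open>Group multiplication as a smooth action\<close>

context lie_group
begin

lemma one_in_points: "\<one> \<in> points_of A"
  by (simp add: points_of_eq)

lemma mult_action: "smooth_action G A A (\<otimes>)"
  by unfold_locales (use smooth_mult in \<open>auto simp: points_of_eq m_assoc\<close>)

lemma plot_mult: "plot A W f \<Longrightarrow> plot A W g \<Longrightarrow> plot A W (\<lambda>x. f x \<otimes> g x)"
  using smooth_action.plot_act[OF mult_action] .

lemma plot_inv: "plot A W f \<Longrightarrow> plot A W (\<lambda>x. inv (f x))"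
  using plot_smooth_map[OF charted_axioms smooth_inv] .

lemma plot_carrier: "plot A W f \<Longrightarrow> x \<in> W \<Longrightarrow> f x \<in> carrier G"
  using plot_in[of A W f x] by (simp add: points_of_eq)

lemma smooth_right_mult: "g \<in> carrier G \<Longrightarrow> smooth_map A A (\<lambda>x. x \<otimes> g)"
  using smooth_action.smooth_act_right[OF mult_action] by (simp add: points_of_eq)

lemma tderiv_right_mult_compose:
  assumes "g \<in> carrier G" "h \<in> carrier G"
  shows "tderiv A A (\<lambda>x. x \<otimes> h) g (tderiv A A (\<lambda>x. x \<otimes> g) \<one> v) = tderiv A A (\<lambda>x. x \<otimes> (g \<otimes> h)) \<one> v"
proof -
  have "tderiv A A (\<lambda>x. x \<otimes> g \<otimes> h) \<one> = tderiv A A (\<lambda>x. x \<otimes> (g \<otimes> h)) \<one>"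
    by (rule tderiv_cong[OF charted_axioms smooth_right_mult _ one_in_points])
      (use assms in \<open>auto simp: points_of_eq m_assoc\<close>)
  then show ?thesis
    using tderiv_compose[OF charted_axioms charted_axioms smooth_right_mult[OF assms(1)] smooth_right_mult[OF assms(2)] one_in_points, of v]
      assms by simp
qed

lemma tderiv_right_mult_one: "tderiv A A (\<lambda>x. x \<otimes> \<one>) \<one> v = v"
proof -
  have "tderiv A A (\<lambda>x. x) \<one> = tderiv A A (\<lambda>x. x \<otimes> \<one>) \<one>"
    by (rule tderiv_cong[OF charted_axioms smooth_right_mult _ one_in_points])
      (auto simp: points_of_eq)
  then show ?thesis using tderiv_ident[OF one_in_points] by metis
qed

lemma pder_right_translate:
  assumes "plot A W g" "t \<in> W" "h \<in> carrier G" "pder A g t v = tderiv A A (\<lambda>x. x \<otimes> g t) \<one> w"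
  shows "pder A (\<lambda>s. g s \<otimes> h) t v = tderiv A A (\<lambda>x. x \<otimes> (g t \<otimes> h)) \<one> w"
  using pder_smooth_map[OF charted_axioms smooth_right_mult[OF assms(3)] assms(1,2), of v] assms(4)
    tderiv_right_mult_compose[OF plot_carrier[OF assms(1,2)] assms(3)] by simp

end

context smooth_action
begin

text \<open>
  Fix \<open>t\<close> and write \<open>c(s) = k(s)w(s)\<close> with \<open>k(s) = g(s)g(t)\<inverse>\<close>. At \<open>s = t\<close> the product rule reads
  \<open>c'(t) = c'(t) + w'(t)\<close>, so \<open>w\<close> has velocity \<open>0\<close> there, and \<open>g\<inverse>c\<close> is a translate of \<open>w\<close>.
\<close>

lemma act_inverse_flow_constant:
  fixes g :: "real \<Rightarrow> 'g"
  assumes g: "plot A W g" and c: "plot B W c" and K: "K \<subseteq> W" "is_interval K"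
    and eg: "\<And>t. t \<in> K \<Longrightarrow> pder A g t 1 = tderiv A A (\<lambda>x. x \<otimes> g t) \<one> (q t)"
    and ec: "\<And>t. t \<in> K \<Longrightarrow> pder B c t 1 = tderiv A B (\<lambda>x. act x (c t)) \<one> (q t)"
    and st: "s \<in> K" "t \<in> K"
  shows "act (inv (g s)) (c s) = act (inv (g t)) (c t)"
proof (rule B.locally_constant_plot[OF plot_act[OF plot_inv[OF g] c] K _ st])
  fix t assume tK: "t \<in> K"
  then have t: "t \<in> W" using K by blast
  have gt: "g t \<in> carrier G" using plot_carrier[OF g t] .
  have ct: "c t \<in> points_of B" using plot_in[OF c t] .
  have W: "open W" using plot_open[OF g] .
  define k where "k s = g s \<otimes> inv (g t)" for s
  define w where "w s = act (inv (k s)) (c s)" for s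
  have k: "plot A W k"
    unfolding k_def using plot_mult[OF g plot_const[OF W]] gt by (simp add: points_of_eq)
  have w: "plot B W w" unfolding w_def by (rule plot_act[OF plot_inv[OF k] c])
  have kt: "k t = \<one>" using gt by (simp add: k_def)
  have wt: "w t = c t" using ct by (simp add: w_def kt act_one)
  \<comment> \<open>Right translation by the inverse of \<open>g t\<close> moves the equation
    satisfied by \<open>g\<close> at time \<open>t\<close> to the identity, where it reads off
    \<open>q t\<close> itself.\<close>
  have dk: "pder A k t 1 = q t"
    using pder_right_translate[OF g t inv_closed[OF gt] eg[OF tK]] gt tderiv_right_mult_one
    by (simp add: k_def[abs_def])
  have "pder B (\<lambda>s. act (k s) (w s)) t = pder B c t"
  proof (rule pder_cong[OF W t _ c t])
    fix s assume s: "s \<in> W"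
    note ks = plot_carrier[OF k s]
    show "c s = act (k s) (w s)"
      using act_mult[OF ks inv_closed[OF ks] plot_in[OF c s]] act_one[OF plot_in[OF c s]] ks by (simp add: w_def)
  qed
  moreover have "tderiv B B (act \<one>) (c t) v = v" for v
  proof -
    have "tderiv B B (\<lambda>p. p) (c t) = tderiv B B (act \<one>) (c t)"
      by (rule B.tderiv_cong[OF B.charted_axioms smooth_act_left _ ct]) (auto simp: act_one)
    then show ?thesis using B.tderiv_ident[OF ct] by metis
  qed
  ultimately have dw: "pder B w t 1 = 0"
    using pder_act[OF fin_dim_real k w t, of 1] ec[OF tK] by (simp add: kt wt dk)
  have it: "inv (g t) \<in> carrier G" using gt by simp
  have "pder B (\<lambda>s. act (inv (g s)) (c s)) t = pder B (\<lambda>s. act (inv (g t)) (w s)) t"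
  proof (rule pder_cong[OF W t _ B.plot_smooth_map[OF B.charted_axioms smooth_act_left[OF it] w] t])
    fix s assume s: "s \<in> W"
    note gs = plot_carrier[OF g s]
    have "inv (g t) \<otimes> inv (k s) = inv (g s)"
      using gs gt by (simp add: k_def inv_mult_group m_assoc[symmetric])
    then show "act (inv (g t)) (w s) = act (inv (g s)) (c s)"
      using act_mult[OF it inv_closed[OF plot_carrier[OF k s]] plot_in[OF c s]] by (simp add: w_def)
  qed
  then have "pder B (\<lambda>s. act (inv (g s)) (c s)) t 1 = tderiv B B (act (inv (g t))) (w t) 0"
    using B.pder_smooth_map[OF B.charted_axioms smooth_act_left[OF it] w t, of 1] dw by simp
  also have "\<dots> = 0"
    by (rule linear_0[OF B.linear_tderiv[OF B.charted_axioms smooth_act_left[OF it] plot_in[OF w t]]])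
  finally show "pder B (\<lambda>s. act (inv (g s)) (c s)) t 1 = 0" .
qed

end

section \<open>Uniqueness and existence of evolutions, and the value of \<open>Evol\<close>\<close>

context lie_group
begin

lemma right_log_derivative_unique:
  fixes g1 g2 :: "real \<Rightarrow> 'g"
  assumes g1: "plot A W g1" and g2: "plot A W g2" and K: "K \<subseteq> W" "is_interval K"
    and e1: "\<And>t. t \<in> K \<Longrightarrow> pder A g1 t 1 = tderiv A A (\<lambda>x. x \<otimes> g1 t) \<one> (q t)"
    and e2: "\<And>t. t \<in> K \<Longrightarrow> pder A g2 t 1 = tderiv A A (\<lambda>x. x \<otimes> g2 t) \<one> (q t)"
    and s: "s \<in> K" "g1 s = g2 s" and t: "t \<in> K"
  shows "g1 t = g2 t"
proof -
  have c: "g1 s \<in> carrier G" "g1 t \<in> carrier G" "g2 t \<in> carrier G"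
    using s t K(1) plot_carrier[OF g1] plot_carrier[OF g2] by blast+
  have "inv (g1 t) \<otimes> g2 t = inv (g1 s) \<otimes> g2 s"
    by (rule smooth_action.act_inverse_flow_constant[OF mult_action g1 g2 K e1 e2 t s(1)])
  then have "inv (g1 t) \<otimes> g2 t = \<one>" using s(2) c(1) by simp
  then show ?thesis using c by (metis inv_equality inv_inv inv_closed)
qed

text \<open>Starting at the identity lets a single chart suffice; right translation later supplies
  all other initial values. In this chart the equation has the right-hand side \<open>F\<close>, the
  derivative of the coordinate expression \<open>\<psi>\<close> of the multiplication in its first
  argument at the identity.\<close>

lemma right_log_derivative_local:
  fixes q :: "real \<Rightarrow> 'e"
  assumes J: "open J" "t0 \<in> J" and q: "Cinf_on J q"
  obtains d h where "d > 0" "ball t0 d \<subseteq> J" "plot A (ball t0 d) h" "h t0 = \<one>"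
    "\<And>t. t \<in> ball t0 d \<Longrightarrow> pder A h t 1 = tderiv A A (\<lambda>x. x \<otimes> h t) \<one> (q t)"
proof -
  let ?U = "fst (chart_at A \<one>)" and ?\<chi> = "chart_map A \<one>" and ?e = "chart_inv A \<one>"
  let ?X = "?\<chi> ` ?U" and ?a = "?\<chi> \<one>"
  note ch = chart_at_mem[OF one_in_points]
  note e = plot_chart_inv[OF one_in_points]
  have X: "open ?X" using plot_open[OF e] .
  have aX: "?a \<in> ?X" using chart_point_in[OF one_in_points] .
  have ea: "?e ?a = \<one>" using chart_inv_point[OF one_in_points] .
  have eU: "?e x \<in> ?U" "?\<chi> (?e x) = x" if "x \<in> ?X" for x
    using that chart_inv_chart[OF one_in_points] by auto
  have fd2: "fin_dim TYPE('e \<times> 'e)" using fin_dim_prod[OF fin_dim fin_dim] .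
  have XX: "open (?X \<times> ?X)" using X by (intro open_Times) auto
  have P: "plot A (?X \<times> ?X) (\<lambda>z. ?e (fst z) \<otimes> ?e (snd z))"
    by (intro plot_mult plot_compose[OF fin_dim e XX Cinf_on_bounded_linear[OF XX bounded_linear_fst Cinf_on_ident[OF XX]]]
      plot_compose[OF fin_dim e XX Cinf_on_bounded_linear[OF XX bounded_linear_snd Cinf_on_ident[OF XX]]]) auto
  define \<Omega>1 where "\<Omega>1 = {z\<in>?X \<times> ?X. ?e (fst z) \<otimes> ?e (snd z) \<in> ?U}"
  define \<psi> where "\<psi> z = ?\<chi> (?e (fst z) \<otimes> ?e (snd z))" for z
  have \<Omega>1: "open \<Omega>1" unfolding \<Omega>1_def using plot_chart_open[OF P ch(1)] .
  have \<psi>: "Cinf_on \<Omega>1 \<psi>" unfolding \<Omega>1_def \<psi>_def using plot_chart[OF P ch(1)] .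
  have ec: "?e x \<in> carrier G" if "x \<in> ?X" for x using plot_carrier[OF e that] .
  \<comment> \<open>Multiplication by the identity does not leave the chart, so
    \<open>\<psi>\<close> is smooth around every point \<open>(?a, x)\<close> at which
    \<open>F\<close> differentiates it.\<close>
  have aO: "(?a, x) \<in> \<Omega>1" if "x \<in> ?X" for x using that aX eU(1)[OF that] ec[OF that] by (auto simp: \<Omega>1_def ea)
  have \<psi>a: "\<psi> (?a, x) = x" if "x \<in> ?X" for x using eU(2)[OF that] ec[OF that] by (simp add: \<psi>_def ea)
  \<comment> \<open>the right-invariant vector field with value \<open>q t\<close> at the identity, in the chart \<open>?\<chi>\<close>\<close>
  define F where "F p = frechet_derivative \<psi> (at (?a, snd p)) (q (fst p), 0)" for p :: "real \<times> 'e"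
  have JX: "open (J \<times> ?X)" using J(1) X by (rule open_Times)
  have F: "Cinf_on (J \<times> ?X) F"
    unfolding F_def
  proof (rule Cinf_on_operator_apply[OF fin_dim JX, of "\<lambda>p w. frechet_derivative \<psi> (at (?a, snd p)) (w, 0)"])
    fix p assume p: "p \<in> J \<times> ?X"
    then have "(?a, snd p) \<in> \<Omega>1" using aO by auto
    from has_derivative_linear[OF Cinf_on_has_derivative[OF \<psi> this]]
    have l: "linear (frechet_derivative \<psi> (at (?a, snd p)))" .
    show "linear (\<lambda>w. frechet_derivative \<psi> (at (?a, snd p)) (w, 0))"
      by (rule linearI) (use linear_add[OF l, of "(_, 0)" "(_, 0)"] linear_scale[OF l, of _ "(_, 0)"] in auto)
  next
    fix w
    show "Cinf_on (J \<times> ?X) (\<lambda>p. frechet_derivative \<psi> (at (?a, snd p)) (w, 0))"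
      by (rule Cinf_on_compose[OF fd2 JX \<Omega>1 _ Cinf_on_frechet_derivative[OF \<psi>, of "(w, 0)"]
        Cinf_on_Pair[OF JX Cinf_on_const Cinf_on_bounded_linear[OF JX bounded_linear_snd Cinf_on_ident[OF JX]]]])
        (use aO in auto)
  next
    show "Cinf_on (J \<times> ?X) (\<lambda>p. q (fst p))"
      by (rule Cinf_on_compose[OF fin_dim_real JX J(1) _ q Cinf_on_bounded_linear[OF JX bounded_linear_fst Cinf_on_ident[OF JX]]]) auto
  qed
  have "(t0, ?a) \<in> J \<times> ?X" using J aX by simp
  then obtain d x where d: "d > 0" "x t0 = ?a" "Cinf_on (ball t0 d) x"
    "\<And>t. t \<in> ball t0 d \<Longrightarrow> (t, x t) \<in> J \<times> ?X"
    "\<And>t. t \<in> ball t0 d \<Longrightarrow> (x has_vector_derivative F (t, x t)) (at t)"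
    using ode_local_solution[OF fin_dim JX _ F] by metis
  define h where "h t = ?e (x t)" for t
  have h: "plot A (ball t0 d) h" unfolding h_def
    by (rule plot_compose[OF fin_dim e open_ball d(3)]) (use d(4) in auto)
  have "pder A h t 1 = tderiv A A (\<lambda>x. x \<otimes> h t) \<one> (q t)" if t: "t \<in> ball t0 d" for t
  proof -
    have xt: "x t \<in> ?X" using d(4)[OF t] by auto
    have ht: "h t \<in> carrier G" using plot_carrier[OF h t] .
    have "(x has_derivative (\<lambda>r. r *\<^sub>R F (t, x t))) (at t)"
      using d(5)[OF t] by (simp add: has_vector_derivative_def)
    from pder_compose[OF e this xt, of 1]
    have 1: "pder A h t 1 = pder A ?e (x t) (frechet_derivative \<psi> (at (?a, x t)) (q t, 0))"
      by (simp add: h_def[abs_def] F_def)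
    let ?N = "{y\<in>?X. ?e y \<otimes> h t \<in> ?U}"
    have R: "plot A ?X (\<lambda>y. ?e y \<otimes> h t)"
      using plot_smooth_map[OF charted_axioms smooth_right_mult[OF ht] e] .
    have "((\<lambda>y. (y, x t)) has_derivative (\<lambda>v. (v, 0))) (at ?a)" by (auto intro!: derivative_eq_intros)
    from has_derivative_compose[OF this Cinf_on_has_derivative[OF \<psi> aO[OF xt]]]
    have "((\<lambda>y. \<psi> (y, x t)) has_derivative (\<lambda>v. frechet_derivative \<psi> (at (?a, x t)) (v, 0))) (at ?a)" .
    from pder_compose[OF e this, of "q t"] xt
    have 2: "pder A (\<lambda>y. ?e (\<psi> (y, x t))) ?a (q t) = pder A ?e (x t) (frechet_derivative \<psi> (at (?a, x t)) (q t, 0))"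
      by (simp add: \<psi>a)
    \<comment> \<open>For \<open>y\<close> near \<open>?a\<close> the product still lies in the
      chart domain, where passing to coordinates and back changes nothing. This turns the coordinate
      field into the differential of right multiplication.\<close>
    have "pder A (\<lambda>y. ?e (\<psi> (y, x t))) ?a = pder A (\<lambda>y. ?e y \<otimes> h t) ?a"
    proof (rule pder_cong[OF plot_chart_open[OF R ch(1)] _ _ R aX])
      show "?a \<in> ?N" using aX eU(1)[OF xt] ht by (simp add: ea h_def)
      show "?e y \<otimes> h t = ?e (\<psi> (y, x t))" if "y \<in> ?N" for y
        using that chart_inv_chart[OF one_in_points] by (simp add: \<psi>_def h_def)
    qed
    then show ?thesis using 1 2 by (simp add: tderiv_eq_pder[OF one_in_points])
  qed
  moreover have "ball t0 d \<subseteq> J" using d(4) by blast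
  moreover have "h t0 = \<one>" by (simp add: h_def d(2) ea)
  ultimately show ?thesis using that[of d h] d(1) h by blast
qed

text \<open>Bisection of \<open>{a..b}\<close> replaces a continuation argument. The property that
  is propagated leaves the initial value free, so that it is local and passes to adjacent intervals;
  the open margin \<open>e\<close> makes neighbouring solutions overlap, and uniqueness lets them be
  glued.\<close>

lemma right_log_derivative_exists:
  fixes q :: "real \<Rightarrow> 'e"
  assumes J: "open J" "{a..b} \<subseteq> J" "a \<le> b" and q: "Cinf_on J q"
  obtains e g where "e > 0" "plot A {a-e<..<b+e} g" "{a-e<..<b+e} \<subseteq> J" "g a = \<one>"
    "\<And>t. t \<in> {a-e<..<b+e} \<Longrightarrow> pder A g t 1 = tderiv A A (\<lambda>x. x \<otimes> g t) \<one> (q t)"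
proof -
  define sol where "sol I g \<longleftrightarrow> plot A I g \<and> I \<subseteq> J \<and> (\<forall>t\<in>I. pder A g t 1 = tderiv A A (\<lambda>x. x \<otimes> g t) \<one> (q t))" for I g
  have sub: "sol I' g" if "sol I g" "open I'" "I' \<subseteq> I" for I I' g
    using that plot_subset[of A I g I'] unfolding sol_def by blast
  have trans: "sol I (\<lambda>s. g s \<otimes> h)" if "sol I g" "h \<in> carrier G" for I g h
    using that pder_right_translate[of I g _ h 1] plot_smooth_map[OF charted_axioms smooth_right_mult[OF that(2)], of I g]
    unfolding sol_def by blast
  have "\<exists>e>0. \<exists>g. sol {a-e<..<b+e} g"
    using J(3)
  proof (induction rule: Bolzano)
    case (trans a b c)
    obtain e1 g1 where e1: "e1 > 0" "sol {a-e1<..<b+e1} g1" using trans(1) by blast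
    obtain e2 g2 where e2: "e2 > 0" "sol {b-e2<..<c+e2} g2" using trans(2) by blast
    define e where "e = min e1 e2"
    have e: "e > 0" "e \<le> e1" "e \<le> e2" using e1(1) e2(1) by (auto simp: e_def)
    let ?I1 = "{a-e<..<b+e}" and ?I2 = "{b-e<..<c+e}" and ?K = "{b-e<..<b+e}"
    have s1: "sol ?I1 g1" by (rule sub[OF e1(2)]) (use e in auto)
    have s2: "sol ?I2 g2" by (rule sub[OF e2(2)]) (use e in auto)
    have b12: "b \<in> ?I1" "b \<in> ?I2" using e(1) trans(3,4) by auto
    have cb: "g1 b \<in> carrier G" "g2 b \<in> carrier G"
      using s1 s2 b12 plot_carrier unfolding sol_def by blast+
    \<comment> \<open>The constant right factor makes the second solution agree with the first at
      the common endpoint \<open>b\<close>; by uniqueness they then agree on the whole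
      overlap.\<close>
    define k where "k t = g2 t \<otimes> (inv (g2 b) \<otimes> g1 b)" for t
    have sk: "sol ?I2 k" unfolding k_def by (rule \<open>\<And>I g h. sol I g \<Longrightarrow> h \<in> carrier G \<Longrightarrow> sol I (\<lambda>s. g s \<otimes> h)\<close>[OF s2]) (use cb in simp)
    have kb: "k b = g1 b" using cb by (simp add: k_def m_assoc[symmetric])
    have sK: "sol ?K g1" "sol ?K k" using trans(3,4) by (auto intro: sub[OF s1] sub[OF sk])
    have agree: "g1 t = k t" if "t \<in> ?K" for t
      by (rule right_log_derivative_unique[of ?K g1 k ?K q b t])
        (use sK kb e(1) that in \<open>auto simp: sol_def is_interval_oo\<close>)
    define g where "g t = (if t \<le> b then g1 t else k t)" for t
    have g1: "g t = g1 t" if "t \<in> ?I1" for t using agree[of t] that by (auto simp: g_def)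
    have g2: "g t = k t" if "t \<in> ?I2" for t using agree[of t] that by (auto simp: g_def)
    have p1: "plot A ?I1 g" by (rule plot_cong[of A _ g1]) (use s1 g1 in \<open>auto simp: sol_def\<close>)
    have p2: "plot A ?I2 g" by (rule plot_cong[of A _ k]) (use sk g2 in \<open>auto simp: sol_def\<close>)
    have cov: "t \<in> ?I1 \<or> t \<in> ?I2" if "t \<in> {a-e<..<c+e}" for t using that e(1) by auto
    have "sol {a-e<..<c+e} g"
      unfolding sol_def
    proof (intro conjI ballI)
      show "plot A {a-e<..<c+e} g"
      proof (rule plot_local)
        fix t assume "t \<in> {a-e<..<c+e}"
        then show "\<exists>V. open V \<and> t \<in> V \<and> plot A V g"
          using cov p1 p2 open_greaterThanLessThan by blast
      qed simp
      show "{a-e<..<c+e} \<subseteq> J" using cov s1 s2 unfolding sol_def by blast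
      fix t assume "t \<in> {a-e<..<c+e}"
      then consider "t \<in> ?I1" | "t \<in> ?I2" using cov by blast
      then show "pder A g t 1 = tderiv A A (\<lambda>x. x \<otimes> g t) \<one> (q t)"
      proof cases
        case 1
        have "pder A g t = pder A g1 t"
          by (rule pder_cong[of ?I1]) (use 1 g1 s1 in \<open>auto simp: sol_def\<close>)
        then show ?thesis using s1 1 g1 unfolding sol_def by simp
      next
        case 2
        have "pder A g t = pder A k t"
          by (rule pder_cong[of ?I2]) (use 2 g2 sk in \<open>auto simp: sol_def\<close>)
        then show ?thesis using sk 2 g2 unfolding sol_def by simp
      qed
    qed
    then show ?case using e(1) by blast
  next
    case (local x)
    then have "x \<in> J" using J(2) by auto
    then obtain d h where d: "d > 0" "ball x d \<subseteq> J" "plot A (ball x d) h"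
      "\<And>t. t \<in> ball x d \<Longrightarrow> pder A h t 1 = tderiv A A (\<lambda>x. x \<otimes> h t) \<one> (q t)"
      by (rule right_log_derivative_local[OF J(1) _ q]) blast
    \<comment> \<open>Length below \<open>d/2\<close> plus a margin of \<open>d/2\<close> on either
      side keeps the interval inside \<open>ball x d\<close>.\<close>
    have "\<exists>e>0. \<exists>g. sol {a-e<..<b+e} g" if "a \<le> x" "x \<le> b" "b - a < d/2" for a b
    proof -
      have "sol {a - d/2<..<b + d/2} h"
        by (rule sub[of "ball x d"]) (use d that in \<open>auto simp: sol_def dist_real_def\<close>)
      then show ?thesis using d(1) by (intro exI[of _ "d/2"]) auto
    qed
    then show ?case using d(1) by (intro exI[of _ "d/2"]) auto
  qed
  then obtain e g where g: "e > 0" "sol {a-e<..<b+e} g" by blast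
  have a: "a \<in> {a-e<..<b+e}" using g(1) J(3) by auto
  then have ga: "g a \<in> carrier G" using g(2) plot_carrier unfolding sol_def by blast
  \<comment> \<open>The value at \<open>a\<close> is normalised to the identity only now, again by a
    right translation.\<close>
  have "sol {a-e<..<b+e} (\<lambda>t. g t \<otimes> inv (g a))" using trans[OF g(2)] ga by simp
  then show ?thesis using that[of e "\<lambda>t. g t \<otimes> inv (g a)"] g(1) ga unfolding sol_def by simp
qed

text \<open>Restriction to the unit interval makes the solution extensional, hence a candidate for
  the description that defines \<open>Evol\<close>. The equation refers to \<open>q\<close> on the
  closed interval only, so \<open>q\<close> may be a restricted function, with no regularity across
  the endpoints.\<close>

lemma Evol_eq:
  fixes q :: "real \<Rightarrow> 'e"
  assumes g: "plot A W g" "{0..1} \<subseteq> W" "g 0 = \<one>"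
    and eg: "\<And>t. t \<in> {0..1} \<Longrightarrow> pder A g t 1 = tderiv A A (\<lambda>x. x \<otimes> g t) \<one> (q t)"
  shows "Evol G A q = restrict g {0..1}"
  unfolding Evol_def
proof (rule the_equality)
  let ?g = "restrict g {0..1}"
  have "smooth_curve A {0..1} ?g" by (rule plot_imp_smooth_curve[OF g(1,2)]) auto
  then have "?g \<in> smooth_curves_from A \<one>"
    unfolding smooth_curves_from_def smooth_curves_def using g(3) by auto
  moreover have "velocity A {0..1} ?g t = pder A g t 1" if "t \<in> {0..1}" for t
    by (rule velocity_eq_pder[OF g(1) _ that _ at_unit_int_nontrivial[OF that]]) (use that g(2) in auto)
  ultimately show "?g \<in> smooth_curves_from A \<one> \<and> (\<forall>t\<in>{0..1}. velocity A {0..1} ?g t = tderiv A A (\<lambda>x. x \<otimes> ?g t) \<one> (q t))"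
    using eg by simp
next
  fix h assume h: "h \<in> smooth_curves_from A \<one> \<and> (\<forall>t\<in>{0..1}. velocity A {0..1} h t = tderiv A A (\<lambda>x. x \<otimes> h t) \<one> (q t))"
  then have hs: "smooth_curve A {0..1} h" "h \<in> extensional {0..1}" "h 0 = \<one>"
    by (auto simp: smooth_curves_from_def smooth_curves_def)
  \<comment> \<open>A competitor \<open>h\<close> satisfies the equation in terms of one-sided
    velocities at the endpoints; the uniqueness lemma speaks of plots, so \<open>h\<close> is first
    extended.\<close>
  obtain e f where f: "e > 0" "plot A {-e<..<1+e} f" "\<And>t. t \<in> {0..1} \<Longrightarrow> f t = h t"
    using smooth_curve_extension[OF hs(1)] by metis
  let ?W = "W \<inter> {-e<..<1+e}"
  have oW: "open ?W" using plot_open[OF g(1)] by auto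
  have K: "{0..1} \<subseteq> ?W" using g(2) f(1) by auto
  have "g t = f t" if "t \<in> {0..1}" for t
  proof (rule right_log_derivative_unique[of ?W g f "{0..1}" q 0 t])
    show "plot A ?W g" using plot_subset[OF g(1) oW] by blast
    show "plot A ?W f" using plot_subset[OF f(2) oW] by blast
    show "pder A f s 1 = tderiv A A (\<lambda>x. x \<otimes> f s) \<one> (q s)" if s: "s \<in> {0..1}" for s
    proof -
      have "velocity A {0..1} h s = pder A f s 1"
        by (rule velocity_eq_pder[OF f(2) _ s _ at_unit_int_nontrivial[OF s]]) (use s K f(3) in auto)
      then show ?thesis using h s f(3) by simp
    qed
    show "g 0 = f 0" using g(3) f(3)[of 0] hs(3) by simp
  qed (use K eg that in \<open>auto simp: is_interval_cc\<close>)
  then show "h = restrict g {0..1}"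
    using hs(2) f(3) by (intro extensionalityI[OF hs(2) restrict_extensional]) auto
qed

end


section \<open>Reductive homogeneous spaces\<close>

locale homogeneous = lie_group G A + B: charted B
  for G :: "('g, 'b) monoid_scheme" (structure) and A :: "('g, 'e::banach) atlas" and B :: "('g set, 'f::banach) atlas" +
  fixes H :: "'g set"
  assumes subgroup_H: "subgroup H G" and points_B: "points_of B = lcosets H"
    and submersion_proj: "submersion A B (quot_proj G H)"
begin

section \<open>Cosets, the projection and the action on the quotient\<close>

abbreviation \<pi> :: "'g \<Rightarrow> 'g set" where "\<pi> \<equiv> quot_proj G H"

lemma smooth_proj: "smooth_map A B \<pi>"
  using submersion_proj by (simp add: submersion_def)

lemma proj_in: "g \<in> carrier G \<Longrightarrow> \<pi> g \<in> points_of B"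
  using smooth_proj points_of_eq unfolding smooth_map_def by blast

lemma proj_surj:
  assumes "p \<in> points_of B"
  obtains g where "g \<in> carrier G" "\<pi> g = p"
  using assms unfolding points_B LCOSETS_def quot_proj_def by blast

lemma H_subset: "H \<subseteq> carrier G"
  using subgroup_H by (rule subgroup.subset)

lemma act_proj:
  assumes "g \<in> carrier G" "h \<in> carrier G"
  shows "quot_act G g (\<pi> h) = \<pi> (g \<otimes> h)"
  unfolding quot_act_def quot_proj_def by (rule lcos_m_assoc[OF H_subset assms])

lemma proj_mult_H:
  assumes "g \<in> carrier G" "h \<in> H"
  shows "\<pi> (g \<otimes> h) = \<pi> g"
proof -
  have "g \<otimes> h \<in> g <# H" using assms by (auto simp: l_coset_def)
  from l_repr_independence[OF this assms(1) subgroup_H] show ?thesis by (simp add: quot_proj_def)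
qed

lemma proj_eqD:
  assumes "g \<in> carrier G" "h \<in> carrier G" "\<pi> g = \<pi> h"
  shows "inv g \<otimes> h \<in> H"
proof -
  have "h \<in> g <# H" using lcos_self[OF assms(2) subgroup_H] assms(3) by (simp add: quot_proj_def)
  then show ?thesis using subgroup.lcos_module_imp[OF subgroup_H group_axioms assms(1)] by blast
qed

text \<open>Links the choice of an element of the coset in \<open>omega\<close> to the
  representatives \<open>g\<close> with \<open>\<pi> g = p\<close>.\<close>

lemma proj_eq_iff_mem:
  assumes "g \<in> carrier G" "p \<in> points_of B"
  shows "\<pi> g = p \<longleftrightarrow> g \<in> p"
proof -
  obtain k where k: "k \<in> carrier G" "\<pi> k = p" using proj_surj[OF assms(2)] .
  show ?thesis
    using lcos_self[OF assms(1) subgroup_H] l_repr_independence[OF _ k(1) subgroup_H, of g] k(2)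
    unfolding quot_proj_def by metis
qed

text \<open>In charts, \<open>\<pi>\<close> is a submersion between normed spaces. A smooth section
  through the prescribed point \<open>p\<close>, composed with the coordinates of \<open>f\<close>,
  is the lift.\<close>

lemma plot_lift:
  fixes f :: "'x::real_normed_vector \<Rightarrow> 'g set"
  assumes f: "plot B W f" and x: "x \<in> W" and p: "p \<in> carrier G" "\<pi> p = f x"
  obtains N \<gamma> where "open N" "x \<in> N" "N \<subseteq> W" "plot A N \<gamma>" "\<gamma> x = p" "\<And>y. y \<in> N \<Longrightarrow> \<pi> (\<gamma> y) = f y"
proof -
  have pA: "p \<in> points_of A" using p(1) by (simp add: points_of_eq)
  let ?\<phi> = "chart_map A p" and ?X = "chart_map A p ` fst (chart_at A p)"
  let ?\<psi> = "chart_map B (f x)" and ?V = "fst (chart_at B (f x))"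
  note ch = chart_at_mem[OF plot_in[OF f x]]
  note e = plot_chart_inv[OF pA]
  have pe: "plot B ?X (\<lambda>y. \<pi> (chart_inv A p y))" using plot_smooth_map[OF B.charted_axioms smooth_proj e] .
  define \<Omega> where "\<Omega> = {y\<in>?X. \<pi> (chart_inv A p y) \<in> ?V}"
  define F where "F y = ?\<psi> (\<pi> (chart_inv A p y))" for y
  have \<Omega>: "open \<Omega>" unfolding \<Omega>_def using plot_chart_open[OF pe ch(1)] .
  have F: "Cinf_on \<Omega> F" unfolding \<Omega>_def F_def using plot_chart[OF pe ch(1)] .
  have a: "?\<phi> p \<in> \<Omega>" using chart_point_in[OF pA] ch(2) p(2) by (simp add: \<Omega>_def chart_inv_point[OF pA])
  have Fa: "F (?\<phi> p) = ?\<psi> (f x)" by (simp add: F_def chart_inv_point[OF pA] p(2))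
  have "surj (tderiv A B \<pi> p)" using submersion_proj pA by (simp add: submersion_def)
  moreover have "tderiv A B \<pi> p = frechet_derivative F (at (?\<phi> p))"
    by (simp add: tderiv_def F_def[abs_def] o_def p(2))
  ultimately have "surj (frechet_derivative F (at (?\<phi> p)))" by simp
  then obtain Y \<sigma> where Y: "open Y" "F (?\<phi> p) \<in> Y" "Cinf_on Y \<sigma>" "\<sigma> ` Y \<subseteq> \<Omega>" "\<And>y. y \<in> Y \<Longrightarrow> F (\<sigma> y) = y"
    "\<sigma> (F (?\<phi> p)) = ?\<phi> p"
    using submersion_local_section[OF fin_dim B.fin_dim \<Omega> a F] by metis
  let ?W = "{y\<in>W. f y \<in> ?V}"
  define N where "N = ?W \<inter> (\<lambda>y. ?\<psi> (f y)) -` Y"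
  have N: "open N" unfolding N_def
    by (rule continuous_open_preimage[OF Cinf_on_continuous[OF plot_chart[OF f ch(1)]] plot_chart_open[OF f ch(1)] Y(1)])
  have 1: "Cinf_on N (\<lambda>y. ?\<psi> (f y))" by (rule Cinf_on_subset[OF plot_chart[OF f ch(1)]]) (auto simp: N_def)
  have 2: "Cinf_on N (\<lambda>y. \<sigma> (?\<psi> (f y)))"
    by (rule Cinf_on_compose[OF B.fin_dim N Y(1) _ Y(3) 1]) (auto simp: N_def)
  have \<sigma>: "\<sigma> (?\<psi> (f y)) \<in> \<Omega>" if "y \<in> N" for y using Y(4) that unfolding N_def by blast
  show ?thesis
  proof (rule that[of N "\<lambda>y. chart_inv A p (\<sigma> (?\<psi> (f y)))"])
    show "x \<in> N" using x ch(2) Y(2) Fa by (simp add: N_def)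
    show "N \<subseteq> W" by (auto simp: N_def)
    show "plot A N (\<lambda>y. chart_inv A p (\<sigma> (?\<psi> (f y))))"
      by (rule plot_compose[OF fin_dim e N 2]) (use \<sigma> \<Omega>_def in blast)
    show "chart_inv A p (\<sigma> (?\<psi> (f x))) = p" using Y(6) by (simp add: Fa chart_inv_point[OF pA])
    \<comment> \<open>The section gives equality of coordinates only. Both points lie in the chart
      domain \<open>?V\<close>, so injectivity of the chart gives equality of the points.\<close>
    show "\<pi> (chart_inv A p (\<sigma> (?\<psi> (f y)))) = f y" if y: "y \<in> N" for y
    proof (rule inj_onD[OF B.chart_inj[OF ch(1)]])
      show "?\<psi> (\<pi> (chart_inv A p (\<sigma> (?\<psi> (f y))))) = ?\<psi> (f y)"
        using Y(5)[of "?\<psi> (f y)"] y by (simp add: F_def N_def)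
      show "\<pi> (chart_inv A p (\<sigma> (?\<psi> (f y)))) \<in> ?V" using \<sigma>[OF y] by (simp add: \<Omega>_def)
      show "f y \<in> ?V" using y by (simp add: N_def)
    qed
  qed (rule N)
qed

text \<open>Smoothness is local, so the argument in the quotient may be lifted to a plot in the
  group. There the action is multiplication followed by the smooth projection.\<close>

lemma quotient_action: "smooth_action G A B (quot_act G)"
proof unfold_locales
  show "smooth_map (prod_atlas A B) B (\<lambda>(g, p). quot_act G g p)"
  proof (rule smooth_map_prodI[OF charted_axioms B.charted_axioms B.charted_axioms], simp)
    fix W and f :: "'e \<times> 'f \<Rightarrow> 'g" and g :: "'e \<times> 'f \<Rightarrow> 'g set"
    assume f: "plot A W f" and g: "plot B W g"
    show "plot B W (\<lambda>x. quot_act G (f x) (g x))"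
    proof (rule plot_local[OF plot_open[OF f]])
      fix x assume x: "x \<in> W"
      obtain p where p: "p \<in> carrier G" "\<pi> p = g x" using proj_surj[OF plot_in[OF g x]] .
      obtain N \<gamma> where N: "open N" "x \<in> N" "N \<subseteq> W" "plot A N \<gamma>" "\<And>y. y \<in> N \<Longrightarrow> \<pi> (\<gamma> y) = g y"
        using plot_lift[OF g x p] by metis
      note fN = plot_subset[OF f N(1,3)]
      have "plot B N (\<lambda>y. quot_act G (f y) (g y))"
      proof (rule plot_cong[OF plot_smooth_map[OF B.charted_axioms smooth_proj plot_mult[OF fN N(4)]]])
        fix y assume y: "y \<in> N"
        show "\<pi> (f y \<otimes> \<gamma> y) = quot_act G (f y) (g y)"
          using act_proj[OF plot_carrier[OF fN y] plot_carrier[OF N(4) y]] N(5)[OF y] by simp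
      qed
      then show "\<exists>V. open V \<and> x \<in> V \<and> plot B V (\<lambda>x. quot_act G (f x) (g x))" using N by blast
    qed
  qed
  fix p assume p: "p \<in> points_of B"
  then obtain k where k: "k \<in> carrier G" "\<pi> k = p" using proj_surj by metis
  show "quot_act G \<one> p = p" using act_proj[OF one_closed k(1)] k by simp
  show "quot_act G (g \<otimes> h) p = quot_act G g (quot_act G h p)" if "g \<in> carrier G" "h \<in> carrier G" for g h
    using that k by (simp add: k(2)[symmetric] act_proj m_assoc)
qed

sublocale act: smooth_action G A B "quot_act G"
  by (rule quotient_action)

section \<open>The differential of the projection at the identity\<close>

abbreviation d\<pi> :: "'e \<Rightarrow> 'f" where "d\<pi> \<equiv> tderiv A B \<pi> \<one>"

lemma linear_dproj: "linear d\<pi>"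
  by (rule linear_tderiv[OF B.charted_axioms smooth_proj one_in_points])

lemma surj_dproj: "surj d\<pi>"
  using submersion_proj one_in_points by (simp add: submersion_def)

text \<open>For \<open>v \<in> ker d\<pi>\<close> take a curve \<open>a\<close> in \<open>G\<close> with velocity \<open>v\<close> at the identity, and push it down and up again
  through a local section of \<open>\<pi>\<close>: this yields a curve \<open>b\<close> with velocity \<open>0\<close> in the same cosets as \<open>a\<close>,
  so that \<open>b\<^sup>-\<^sup>1a\<close> is a curve in \<open>H\<close> with velocity \<open>v\<close>.\<close>

lemma tangent_subspace_eq_kernel: "tangent_subspace A H \<one> = {v. d\<pi> v = 0}"
proof (intro equalityI subsetI)
  fix v assume "v \<in> tangent_subspace A H \<one>"
  then obtain c \<epsilon> where c: "v = velocity A {-\<epsilon><..<\<epsilon>} c 0" "\<epsilon> > 0" "smooth_curve A {-\<epsilon><..<\<epsilon>} c"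
    "c ` {-\<epsilon><..<\<epsilon>} \<subseteq> H" "c 0 = \<one>"
    unfolding tangent_subspace_def by blast
  let ?J = "{-\<epsilon><..<\<epsilon>}"
  have z: "0 \<in> ?J" using c(2) by simp
  have pc: "plot A ?J c" using smooth_curve_imp_plot[OF _ c(3)] by simp
  have nb: "at 0 within ?J \<noteq> bot" using at_within_open[OF z] by simp
  have v: "v = pder A c 0 1" using velocity_eq_pder[OF pc z z _ nb] c(1) by simp
  have "pder B (\<lambda>t. \<pi> (c t)) 0 = pder B (\<lambda>t. \<pi> \<one>) 0"
  proof (rule pder_cong[of ?J])
    show "plot B ?J (\<lambda>t. \<pi> \<one>)" by (rule plot_const) (auto intro: proj_in)
    show "\<pi> \<one> = \<pi> (c t)" if "t \<in> ?J" for t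
      using proj_mult_H[OF one_closed, of "c t"] c(4) that H_subset by (metis image_subset_iff l_one subset_iff)
  qed (use z in auto)
  then have "pder B (\<lambda>t. \<pi> (c t)) 0 1 = 0" by (simp add: pder_const)
  then show "v \<in> {v. d\<pi> v = 0}"
    using pder_smooth_map[OF B.charted_axioms smooth_proj pc z, of 1] v c(5) by simp
next
  fix v assume "v \<in> {v. d\<pi> v = 0}"
  then have v: "d\<pi> v = 0" by simp
  let ?a = "chart_map A \<one> \<one>" and ?X = "chart_map A \<one> ` fst (chart_at A \<one>)" and ?e = "chart_inv A \<one>"
  note e = plot_chart_inv[OF one_in_points]
  define N0 where "N0 = (\<lambda>t::real. ?a + t *\<^sub>R v) -` ?X"
  have N0: "open N0" unfolding N0_def by (rule open_vimage[OF plot_open[OF e]]) (intro continuous_intros)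
  have z0: "0 \<in> N0" using chart_point_in[OF one_in_points] by (simp add: N0_def)
  define a where "a t = ?e (?a + t *\<^sub>R v)" for t :: real
  have "Cinf_on N0 (\<lambda>t::real. ?a + t *\<^sub>R v)"
    by (intro Cinf_on_add Cinf_on_const Cinf_on_bounded_linear[OF N0 bounded_linear_scaleR_left] Cinf_on_ident N0)
  then have a: "plot A N0 a" unfolding a_def by (rule plot_compose[OF fin_dim e N0]) (auto simp: N0_def)
  have a0: "a 0 = \<one>" by (simp add: a_def chart_inv_point[OF one_in_points])
  have "((\<lambda>t. ?a + t *\<^sub>R v) has_derivative (\<lambda>t. t *\<^sub>R v)) (at 0)" by (auto intro!: derivative_eq_intros)
  from pder_compose[OF e this] chart_point_in[OF one_in_points]
  have da: "pder A a 0 1 = v" by (simp add: a_def[abs_def] pder_chart_inv[OF one_in_points])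
  have pa: "plot B N0 (\<lambda>t. \<pi> (a t))" using plot_smooth_map[OF B.charted_axioms smooth_proj a] .
  have dpa: "pder B (\<lambda>t. \<pi> (a t)) 0 1 = 0"
    using pder_smooth_map[OF B.charted_axioms smooth_proj a z0, of 1] by (simp add: a0 da v)
  let ?p = "\<pi> \<one>"
  have p: "?p \<in> points_of B" by (simp add: proj_in)
  note ch = chart_at_mem[OF p]
  obtain N s where N: "open N" "chart_map B ?p ?p \<in> N" "N \<subseteq> chart_map B ?p ` fst (chart_at B ?p)" "plot A N s"
    "s (chart_map B ?p ?p) = \<one>" "\<And>y. y \<in> N \<Longrightarrow> \<pi> (s y) = chart_inv B ?p y"
    using plot_lift[OF B.plot_chart_inv[OF p] B.chart_point_in[OF p] one_closed]
    by (metis B.chart_inv_point[OF p])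
  let ?W = "{t\<in>N0. \<pi> (a t) \<in> fst (chart_at B ?p)}"
  define N1 where "N1 = ?W \<inter> (\<lambda>t. chart_map B ?p (\<pi> (a t))) -` N"
  have N1: "open N1" unfolding N1_def
    by (rule continuous_open_preimage[OF Cinf_on_continuous[OF plot_chart[OF pa ch(1)]] plot_chart_open[OF pa ch(1)] N(1)])
  have z1: "0 \<in> N1" using z0 a0 ch(2) N(2) by (simp add: N1_def)
  define b where "b t = s (chart_map B ?p (\<pi> (a t)))" for t
  have b: "plot A N1 b" unfolding b_def
    by (rule plot_compose[OF B.fin_dim N(4) N1 Cinf_on_subset[OF plot_chart[OF pa ch(1)]]]) (auto simp: N1_def)
  have b0: "b 0 = \<one>" by (simp add: b_def a0 N(5))
  have "((\<lambda>t. chart_map B ?p (\<pi> (a t))) has_derivative pder B (\<lambda>t. \<pi> (a t)) 0) (at 0)"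
    using pder_works[OF pa z0] by (simp add: a0)
  from pder_compose[OF N(4) this, of 1]
  have "pder A b 0 1 = pder A s (chart_map B ?p ?p) 0" using N(2) by (simp add: b_def[abs_def] a0 dpa)
  then have db: "pder A b 0 1 = 0" using linear_0[OF linear_pder[OF N(4,2)]] by simp
  have a': "plot A N1 a" using plot_subset[OF a N1] by (auto simp: N1_def)
  define w where "w t = inv (b t) \<otimes> a t" for t
  have w: "plot A N1 w" unfolding w_def by (intro plot_mult plot_inv a' b)
  have w0: "w 0 = \<one>" by (simp add: w_def a0 b0)
  have wH: "w t \<in> H" if "t \<in> N1" for t
    unfolding w_def
  proof (rule proj_eqD[OF plot_carrier[OF b that] plot_carrier[OF a' that]])
    show "\<pi> (b t) = \<pi> (a t)"
      using that N(6)[of "chart_map B ?p (\<pi> (a t))"] B.chart_inv_chart[OF p] by (simp add: b_def N1_def)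
  qed
  \<comment> \<open>\<open>a = b w\<close> is differentiated at 0, where both factors are the
    identity: the velocity of \<open>a\<close> is the sum of the velocities of \<open>b\<close> and
    \<open>w\<close>, and that of \<open>b\<close> is 0.\<close>
  have "pder A (\<lambda>t. b t \<otimes> w t) 0 = pder A a 0"
    by (rule pder_cong[OF N1 z1 _ a' z1])
      (use plot_carrier[OF b] plot_carrier[OF a'] in \<open>simp add: w_def m_assoc[symmetric]\<close>)
  then have "v = tderiv A A (\<lambda>x. x \<otimes> \<one>) \<one> 0 + tderiv A A (\<lambda>x. \<one> \<otimes> x) \<one> (pder A w 0 1)"
    using smooth_action.pder_act[OF mult_action fin_dim_real b w z1, of 1] da db b0 w0 by simp
  moreover have "tderiv A A (\<lambda>x. \<one> \<otimes> x) \<one> u = u" for u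
  proof -
    have "tderiv A A (\<lambda>x. \<one> \<otimes> x) \<one> = tderiv A A (\<lambda>x. x) \<one>"
      by (rule sym, rule tderiv_cong[OF charted_axioms smooth_action.smooth_act_left[OF mult_action one_closed] _ one_in_points])
        (auto simp: points_of_eq)
    then show ?thesis using tderiv_ident[OF one_in_points] by simp
  qed
  ultimately have dw: "pder A w 0 1 = v" using tderiv_right_mult_one by simp
  obtain \<epsilon> where \<epsilon>: "\<epsilon> > 0" "ball 0 \<epsilon> \<subseteq> N1" using N1 z1 open_contains_ball by blast
  have J: "{-\<epsilon><..<\<epsilon>} \<subseteq> N1" using \<epsilon>(2) by (auto simp: subset_iff)
  have z: "0 \<in> {-\<epsilon><..<\<epsilon>}" using \<epsilon>(1) by simp
  have "velocity A {-\<epsilon><..<\<epsilon>} w 0 = v"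
    using velocity_eq_pder[OF w z1 z] at_within_open[OF z] dw by simp
  moreover have "smooth_curve A {-\<epsilon><..<\<epsilon>} w" by (rule plot_imp_smooth_curve[OF w J]) auto
  ultimately show "v \<in> tangent_subspace A H \<one>"
    unfolding tangent_subspace_def using \<epsilon>(1) w0 wH J by blast
qed

section \<open>The adjoint action\<close>

lemma smooth_conj: "g \<in> carrier G \<Longrightarrow> smooth_map A A (\<lambda>x. g \<otimes> x \<otimes> inv g)"
proof (rule smooth_mapI[OF charted_axioms])
  fix U \<phi> assume g: "g \<in> carrier G" and c: "(U, \<phi>) \<in> A"
  have "plot A (\<phi> ` U) (\<lambda>y. x)" if "x \<in> carrier G" for x
    using plot_const[OF chart_image_open[OF c], of x A] that points_of_eq by blast
  then show "plot A (\<phi> ` U) (\<lambda>y. g \<otimes> inv_into U \<phi> y \<otimes> inv g)"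
    using g by (intro plot_mult plot_inv_chart[OF c]) auto
qed

lemma linear_Ad: "g \<in> carrier G \<Longrightarrow> linear (Ad G A g)"
  unfolding Ad_def by (rule linear_tderiv[OF charted_axioms smooth_conj one_in_points])

lemma Ad_mult:
  assumes "g \<in> carrier G" "h \<in> carrier G"
  shows "Ad G A (g \<otimes> h) v = Ad G A g (Ad G A h v)"
proof -
  have "tderiv A A (\<lambda>x. g \<otimes> (h \<otimes> x \<otimes> inv h) \<otimes> inv g) \<one> = Ad G A (g \<otimes> h)"
    unfolding Ad_def
    by (rule tderiv_cong[OF charted_axioms smooth_conj _ one_in_points])
      (use assms in \<open>auto simp: points_of_eq inv_mult_group m_assoc\<close>)
  then show ?thesis
    using tderiv_compose[OF charted_axioms charted_axioms smooth_conj[OF assms(2)] smooth_conj[OF assms(1)] one_in_points, of v]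
      assms by (simp add: Ad_def)
qed

text \<open>Differentiate \<open>(g x inv g) (\<pi> g) = g (\<pi> x)\<close> in \<open>x\<close> at
  the identity. This equivariance turns the infinitesimal action at \<open>\<pi> g\<close> into the
  one at the base point.\<close>

lemma tderiv_act_Ad:
  assumes g: "g \<in> carrier G"
  shows "tderiv A B (\<lambda>x. quot_act G x (\<pi> g)) \<one> (Ad G A g v) = tderiv B B (quot_act G g) (\<pi> \<one>) (d\<pi> v)"
proof -
  have "tderiv A B (\<lambda>x. quot_act G (g \<otimes> x \<otimes> inv g) (\<pi> g)) \<one> = tderiv A B (\<lambda>x. quot_act G g (\<pi> x)) \<one>"
  proof (rule tderiv_cong[OF B.charted_axioms _ _ one_in_points])
    show "smooth_map A B (\<lambda>x. quot_act G g (\<pi> x))"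
      by (rule smooth_mapI[OF B.charted_axioms B.plot_smooth_map[OF B.charted_axioms act.smooth_act_left[OF g]
        plot_smooth_map[OF B.charted_axioms smooth_proj plot_inv_chart]]])
    show "quot_act G g (\<pi> x) = quot_act G (g \<otimes> x \<otimes> inv g) (\<pi> g)" if "x \<in> points_of A" for x
      using that g by (simp add: points_of_eq act_proj m_assoc)
  qed
  moreover have "tderiv A B (\<lambda>x. quot_act G (g \<otimes> x \<otimes> inv g) (\<pi> g)) \<one> v
    = tderiv A B (\<lambda>x. quot_act G x (\<pi> g)) \<one> (Ad G A g v)"
    using tderiv_compose[OF charted_axioms B.charted_axioms smooth_conj[OF g] act.smooth_act_right[OF proj_in[OF g]] one_in_points, of v] g
    by (simp add: Ad_def)
  moreover have "tderiv A B (\<lambda>x. quot_act G g (\<pi> x)) \<one> v = tderiv B B (quot_act G g) (\<pi> \<one>) (d\<pi> v)"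
    by (rule tderiv_compose[OF B.charted_axioms B.charted_axioms smooth_proj act.smooth_act_left[OF g] one_in_points])
  ultimately show ?thesis by metis
qed

end

section \<open>The one-form and its smoothness along curves\<close>

locale reductive = homogeneous G A B H
  for G :: "('g, 'b) monoid_scheme" (structure) and A :: "('g, 'e::banach) atlas" and B :: "('g set, 'f::banach) atlas" and H +
  fixes \<mm> :: "'e set"
  assumes red: "reductive_complement G A H \<mm>"
begin

lemma subspace_m: "subspace \<mm>"
  using red by (simp add: reductive_complement_def Let_def)

lemma Ad_m: "h \<in> H \<Longrightarrow> x \<in> \<mm> \<Longrightarrow> Ad G A h x \<in> \<mm>"
  using red unfolding reductive_complement_def Let_def by blast

text \<open>By \<open>tangent_subspace_eq_kernel\<close> the Lie algebra of \<open>H\<close>, which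
  is defined by curves, is the kernel of \<open>d\<pi>\<close>. A complement of the kernel of a
  surjective linear map is mapped isomorphically.\<close>

lemma bij_dproj_m: "bij_betw d\<pi> \<mm> UNIV"
  unfolding bij_betw_def
proof
  have k: "{v. d\<pi> v = 0} \<inter> \<mm> = {0}" "{x + y | x y. d\<pi> x = 0 \<and> y \<in> \<mm>} = UNIV"
    using red by (simp_all add: reductive_complement_def Let_def tangent_subspace_eq_kernel)
  show "inj_on d\<pi> \<mm>"
  proof (rule inj_onI)
    fix x y assume xy: "x \<in> \<mm>" "y \<in> \<mm>" "d\<pi> x = d\<pi> y"
    then have "x - y \<in> {v. d\<pi> v = 0} \<inter> \<mm>"
      using subspace_diff[OF subspace_m] linear_diff[OF linear_dproj] by simp
    then show "x = y" using k(1) by simp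
  qed
  have "u \<in> d\<pi> ` \<mm>" for u
  proof -
    obtain x where x: "d\<pi> x = u" using surj_dproj by (metis surjD)
    have "x \<in> {x + y | x y. d\<pi> x = 0 \<and> y \<in> \<mm>}" using k(2) by blast
    then obtain y z where "x = y + z" "d\<pi> y = 0" "z \<in> \<mm>" by blast
    then have "d\<pi> z = u" using x linear_add[OF linear_dproj] by simp
    then show ?thesis using \<open>z \<in> \<mm>\<close> by blast
  qed
  then show "d\<pi> ` \<mm> = UNIV" by blast
qed

abbreviation \<omega>\<^sub>e :: "'f \<Rightarrow> 'e" where "\<omega>\<^sub>e \<equiv> omega_e G A H B \<mm>"

lemma omega_e_in: "\<omega>\<^sub>e u \<in> \<mm>"
  unfolding omega_e_def
  by (rule the_inv_into_into) (use bij_dproj_m in \<open>auto simp: bij_betw_def\<close>)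

lemma dproj_omega_e: "d\<pi> (\<omega>\<^sub>e u) = u"
  unfolding omega_e_def
  by (rule f_the_inv_into_f_bij_betw[OF bij_dproj_m]) simp

lemma omega_e_dproj: "x \<in> \<mm> \<Longrightarrow> \<omega>\<^sub>e (d\<pi> x) = x"
  unfolding omega_e_def using bij_dproj_m by (intro the_inv_into_f_f) (auto simp: bij_betw_def)

lemma linear_omega_e: "linear \<omega>\<^sub>e"
proof (rule linearI)
  show "\<omega>\<^sub>e (x + y) = \<omega>\<^sub>e x + \<omega>\<^sub>e y" for x y
    using omega_e_dproj[OF subspace_add[OF subspace_m omega_e_in omega_e_in], of x y]
    by (simp add: linear_add[OF linear_dproj] dproj_omega_e)
  show "\<omega>\<^sub>e (r *\<^sub>R x) = r *\<^sub>R \<omega>\<^sub>e x" for r x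
    using omega_e_dproj[OF subspace_scale[OF subspace_m omega_e_in], of r x]
    by (simp add: linear_scale[OF linear_dproj] dproj_omega_e)
qed

text \<open>\<open>omega\<close> with the representative as a parameter instead of an arbitrary
  choice. Along a curve the representative can then be a smooth local lift.\<close>

definition omega_at :: "'g \<Rightarrow> 'g set \<times> 'f \<Rightarrow> 'e" where
  "omega_at g v = Ad G A g (\<omega>\<^sub>e (tderiv B B (quot_act G (inv g)) (fst v) (snd v)))"

lemma tderiv_act_omega_at:
  assumes g: "g \<in> carrier G"
  shows "tderiv A B (\<lambda>x. quot_act G x (\<pi> g)) \<one> (omega_at g (\<pi> g, u)) = u"
proof -
  have "quot_act G (inv g) (\<pi> g) = \<pi> \<one>" using g by (simp add: act_proj)
  then show ?thesis
    unfolding omega_at_def tderiv_act_Ad[OF g] dproj_omega_e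
    using act.tderiv_act_inverse[OF g proj_in[OF g], of u] by simp
qed

text \<open>Both sides lie in \<open>Ad(g)\<mm> = Ad(h)\<mm>\<close>, on which the infinitesimal action at \<open>\<pi> g\<close> is injective.\<close>

lemma omega_at_unique:
  assumes g: "g \<in> carrier G" and h: "h \<in> carrier G" and gh: "\<pi> g = \<pi> h"
  shows "omega_at g (\<pi> g, u) = omega_at h (\<pi> g, u)"
proof -
  define X where "X = \<omega>\<^sub>e (tderiv B B (quot_act G (inv g)) (\<pi> g) u)"
  define k where "k = inv g \<otimes> h"
  define Y where "Y = Ad G A k (\<omega>\<^sub>e (tderiv B B (quot_act G (inv h)) (\<pi> g) u))"
  have kH: "k \<in> H" unfolding k_def by (rule proj_eqD[OF g h gh])
  have kG: "k \<in> carrier G" using kH H_subset by blast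
  have hk: "h = g \<otimes> k" using g h by (simp add: k_def m_assoc[symmetric])
  have Xg: "omega_at g (\<pi> g, u) = Ad G A g X" by (simp add: omega_at_def X_def)
  have Yh: "omega_at h (\<pi> g, u) = Ad G A g Y"
    unfolding omega_at_def Y_def using Ad_mult[OF g kG] hk by simp
  have Xm: "X \<in> \<mm>" by (simp add: X_def omega_e_in)
  have Ym: "Y \<in> \<mm>" unfolding Y_def by (rule Ad_m[OF kH omega_e_in])
  have "tderiv B B (quot_act G g) (\<pi> \<one>) (d\<pi> X) = tderiv B B (quot_act G g) (\<pi> \<one>) (d\<pi> Y)"
    using tderiv_act_omega_at[OF g, of u] tderiv_act_omega_at[OF h, of u]
    unfolding gh[symmetric] Xg Yh tderiv_act_Ad[OF g] by simp
  moreover have "tderiv B B (quot_act G (inv g)) (quot_act G g (\<pi> \<one>)) (tderiv B B (quot_act G g) (\<pi> \<one>) v) = v" for v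
    using act.tderiv_act_inverse[OF inv_closed[OF g], of "\<pi> \<one>" v] g by (simp add: proj_in)
  ultimately have "d\<pi> X = d\<pi> Y" by metis
  then have "X = Y" using bij_dproj_m Xm Ym by (auto simp: bij_betw_def dest: inj_onD)
  then show ?thesis by (simp add: Xg Yh)
qed

lemma omega_eq_omega_at:
  assumes "g \<in> carrier G" "\<pi> g = p"
  shows "omega G A H B \<mm> (p, u) = omega_at g (p, u)"
proof -
  have p: "p \<in> points_of B" using proj_in[OF assms(1)] assms(2) by simp
  define h where "h = (SOME h. h \<in> p)"
  have "g \<in> p" using proj_eq_iff_mem[OF assms(1) p] assms(2) by simp
  then have hp: "h \<in> p" unfolding h_def by (rule someI)
  have hG: "h \<in> carrier G"
    using hp lcosets_part_G[OF subgroup_H] p points_B by blast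
  have "\<pi> h = p" using proj_eq_iff_mem[OF hG p] hp by simp
  then have "omega_at h (p, u) = omega_at g (p, u)" using omega_at_unique[OF hG assms(1), of u] assms(2) by simp
  moreover have "omega G A H B \<mm> (p, u) = omega_at h (p, u)"
    unfolding omega_def omega_at_def tangent_map_def Let_def h_def by simp
  ultimately show ?thesis by simp
qed

lemma tderiv_act_omega:
  assumes "p \<in> points_of B"
  shows "tderiv A B (\<lambda>x. quot_act G x p) \<one> (omega G A H B \<mm> (p, u)) = u"
proof -
  obtain g where g: "g \<in> carrier G" "\<pi> g = p" using proj_surj[OF assms] .
  then show ?thesis using tderiv_act_omega_at[OF g(1), of u] omega_eq_omega_at[OF g] by simp
qed

text \<open>Conjugation by \<open>\<gamma> t\<close> fixes the identity, so for every
  \<open>t\<close> the differential is read in one and the same chart. It is the partial derivative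
  in the second variable, at \<open>(t, ?a)\<close>, of the smooth coordinate expression of
  \<open>\<Psi>\<close>.\<close>

lemma Cinf_on_Ad:
  fixes \<gamma> :: "real \<Rightarrow> 'g"
  assumes \<gamma>: "plot A N \<gamma>"
  shows "Cinf_on N (\<lambda>t. Ad G A (\<gamma> t) v)"
proof -
  let ?U = "fst (chart_at A \<one>)" and ?\<chi> = "chart_map A \<one>" and ?e = "chart_inv A \<one>"
  let ?X = "?\<chi> ` ?U" and ?a = "?\<chi> \<one>"
  note ch = chart_at_mem[OF one_in_points]
  note e = plot_chart_inv[OF one_in_points]
  have N: "open N" using plot_open[OF \<gamma>] .
  have fd2: "fin_dim TYPE(real \<times> 'e)" using fin_dim_prod[OF fin_dim_real fin_dim] .
  have NX: "open (N \<times> ?X)" using N plot_open[OF e] by (rule open_Times)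
  note fs = Cinf_on_bounded_linear[OF NX bounded_linear_fst Cinf_on_ident[OF NX]]
    Cinf_on_bounded_linear[OF NX bounded_linear_snd Cinf_on_ident[OF NX]]
  define \<Psi> where "\<Psi> z = \<gamma> (fst z) \<otimes> ?e (snd z) \<otimes> inv (\<gamma> (fst z))" for z
  have \<Psi>: "plot A (N \<times> ?X) \<Psi>" unfolding \<Psi>_def
    by (intro plot_mult plot_inv plot_compose[OF fin_dim_real \<gamma> NX fs(1)] plot_compose[OF fin_dim e NX fs(2)]) auto
  have \<Psi>a: "\<Psi> (t, ?a) = \<one>" if "t \<in> N" for t
    using plot_carrier[OF \<gamma> that] by (simp add: \<Psi>_def chart_inv_point[OF one_in_points])
  have tin: "(t, ?a) \<in> N \<times> ?X" if "t \<in> N" for t using that chart_point_in[OF one_in_points] by simp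
  define \<Theta> where "\<Theta> = {z\<in>N \<times> ?X. \<Psi> z \<in> ?U}"
  have \<Theta>: "open \<Theta>" unfolding \<Theta>_def using plot_chart_open[OF \<Psi> ch(1)] .
  have "Cinf_on \<Theta> (\<lambda>z. ?\<chi> (\<Psi> z))" unfolding \<Theta>_def using plot_chart[OF \<Psi> ch(1)] .
  note D = Cinf_on_frechet_derivative[OF this, of "(0, v)"]
  have "Cinf_on N (\<lambda>t. frechet_derivative (\<lambda>z. ?\<chi> (\<Psi> z)) (at (t, ?a)) (0, v))"
    by (rule Cinf_on_compose[OF fd2 N \<Theta> _ D Cinf_on_Pair[OF N Cinf_on_ident[OF N] Cinf_on_const]])
      (use tin \<Psi>a ch(2) in \<open>auto simp: \<Theta>_def\<close>)
  then show ?thesis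
  proof (rule Cinf_on_cong[OF N, rotated])
    fix t assume t: "t \<in> N"
    have "((\<lambda>y. (t, y)) has_derivative (\<lambda>v. (0, v))) (at ?a)" by (auto intro!: derivative_eq_intros)
    from pder_compose[OF \<Psi> this tin[OF t], of v]
    have "pder A (\<lambda>y. \<gamma> t \<otimes> ?e y \<otimes> inv (\<gamma> t)) ?a v = pder A \<Psi> (t, ?a) (0, v)" by (simp add: \<Psi>_def)
    then show "frechet_derivative (\<lambda>z. ?\<chi> (\<Psi> z)) (at (t, ?a)) (0, v) = Ad G A (\<gamma> t) v"
      by (simp add: Ad_def tderiv_eq_pder[OF one_in_points] pder_def[of A \<Psi>] \<Psi>a[OF t])
  qed
qed

text \<open>With a lift \<open>\<gamma>\<close> of \<open>c\<close>, the curve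
  \<open>inv (\<gamma> t) c(t)\<close> is constantly the base point, so its velocity carries no
  information. Separating the two times in \<open>\<eta> (t, s) = inv (\<gamma> t) c(s)\<close> and
  differentiating in \<open>s\<close> on the diagonal gives the translated velocity of
  \<open>c\<close>. On the diagonal \<open>\<eta>\<close> is the base point, so again one chart
  serves for all times.\<close>

lemma Cinf_on_omega:
  fixes c :: "real \<Rightarrow> 'g set"
  assumes c: "plot B J c"
  shows "Cinf_on J (\<lambda>t. omega G A H B \<mm> (c t, pder B c t 1))"
proof (rule Cinf_on_local)
  fix t0 assume t0: "t0 \<in> J"
  obtain p where p: "p \<in> carrier G" "\<pi> p = c t0" using proj_surj[OF plot_in[OF c t0]] .
  obtain N \<gamma> where N: "open N" "t0 \<in> N" "N \<subseteq> J" "plot A N \<gamma>" "\<And>t. t \<in> N \<Longrightarrow> \<pi> (\<gamma> t) = c t"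
    using plot_lift[OF c t0 p] by metis
  note cN = plot_subset[OF c N(1,3)]
  note \<gamma>G = plot_carrier[OF N(4)]
  let ?p = "\<pi> \<one>"
  let ?V = "fst (chart_at B ?p)" and ?\<psi> = "chart_map B ?p"
  have "?p \<in> points_of B" by (simp add: proj_in)
  note ch = chart_at_mem[OF this]
  have NN: "open (N \<times> N)" using N(1) by (intro open_Times)
  note fs = Cinf_on_bounded_linear[OF NN bounded_linear_fst Cinf_on_ident[OF NN]]
    Cinf_on_bounded_linear[OF NN bounded_linear_snd Cinf_on_ident[OF NN]]
  define \<eta> where "\<eta> z = quot_act G (inv (\<gamma> (fst z))) (c (snd z))" for z
  have \<eta>: "plot B (N \<times> N) \<eta>" unfolding \<eta>_def
    by (intro act.plot_act plot_inv plot_compose[OF fin_dim_real N(4) NN fs(1)] plot_compose[OF fin_dim_real cN NN fs(2)]) auto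
  have \<eta>d: "\<eta> (t, t) = ?p" if "t \<in> N" for t
    using \<gamma>G[OF that] by (simp add: \<eta>_def N(5)[OF that, symmetric] act_proj)
  define \<Theta> where "\<Theta> = {z\<in>N \<times> N. \<eta> z \<in> ?V}"
  have \<Theta>: "open \<Theta>" unfolding \<Theta>_def using plot_chart_open[OF \<eta> ch(1)] .
  define \<xi> where "\<xi> t = frechet_derivative (\<lambda>z. ?\<psi> (\<eta> z)) (at (t, t)) (0, 1)" for t
  have "Cinf_on \<Theta> (\<lambda>z. ?\<psi> (\<eta> z))" unfolding \<Theta>_def using plot_chart[OF \<eta> ch(1)] .
  note D = Cinf_on_frechet_derivative[OF this, of "(0, 1)"]
  have \<xi>: "Cinf_on N \<xi>" unfolding \<xi>_def
    by (rule Cinf_on_compose[OF fin_dim_prod[OF fin_dim_real fin_dim_real] N(1) \<Theta> _ D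
        Cinf_on_Pair[OF N(1) Cinf_on_ident[OF N(1)] Cinf_on_ident[OF N(1)]]])
      (use \<eta>d ch(2) in \<open>auto simp: \<Theta>_def\<close>)
  have \<xi>eq: "\<xi> t = tderiv B B (quot_act G (inv (\<gamma> t))) (c t) (pder B c t 1)" if t: "t \<in> N" for t
  proof -
    have "((\<lambda>s. (t, s)) has_derivative (\<lambda>v. (0, v))) (at t)" by (auto intro!: derivative_eq_intros)
    from pder_compose[OF \<eta> this, of 1] t
    have "pder B (\<lambda>s. quot_act G (inv (\<gamma> t)) (c s)) t 1 = pder B \<eta> (t, t) (0, 1)" by (simp add: \<eta>_def)
    then show ?thesis
      using B.pder_smooth_map[OF B.charted_axioms act.smooth_act_left[OF inv_closed[OF \<gamma>G[OF t]]] cN t, of 1]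
      by (simp add: \<xi>_def pder_def[of B \<eta>] \<eta>d[OF t])
  qed
  have "Cinf_on N (\<lambda>t. Ad G A (\<gamma> t) (\<omega>\<^sub>e (\<xi> t)))"
    by (rule Cinf_on_operator_apply[OF fin_dim N(1) linear_Ad[OF \<gamma>G] Cinf_on_Ad[OF N(4)]
      Cinf_on_bounded_linear[OF N(1) linear_bounded_fin_dim[OF B.fin_dim linear_omega_e] \<xi>]])
  then have "Cinf_on N (\<lambda>t. omega G A H B \<mm> (c t, pder B c t 1))"
    by (rule Cinf_on_cong[OF N(1), rotated])
      (simp add: \<xi>eq omega_eq_omega_at[OF \<gamma>G N(5)] omega_at_def)
  then show "\<exists>V. open V \<and> t0 \<in> V \<and> Cinf_on V (\<lambda>t. omega G A H B \<mm> (c t, pder B c t 1))"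
    using N(1,2) by blast
qed

end

text \<open>The stored velocity component may jump when the chosen chart changes with the point. The
  charts of \<open>tangent_atlas\<close> undo this: in the one induced by \<open>?\<phi>\<close> the
  curve becomes the coordinate expression of \<open>f\<close> together with its ordinary
  derivative.\<close>

lemma (in charted) curve_deriv_smooth:
  assumes f: "plot A J f" "{0..1} \<subseteq> J" and c: "c \<in> extensional {0..1}" "\<And>t. t \<in> {0..1} \<Longrightarrow> f t = c t"
  shows "curve_deriv A c \<in> smooth_curves (tangent_atlas A)"
    and "t \<in> {0..1} \<Longrightarrow> curve_deriv A c t = (c t, pder A f t 1)"
proof -
  show cd: "curve_deriv A c t = (c t, pder A f t 1)" if t: "t \<in> {0..1}" for t
    using velocity_eq_pder[OF f(1) _ t, of c] t f(2) c(2) at_unit_int_nontrivial[OF t]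
    by (auto simp: curve_deriv_def)
  have "smooth_curve (tangent_atlas A) {0..1} (curve_deriv A c)"
    unfolding smooth_curve_def
  proof
    fix t :: real assume t: "t \<in> {0..1}"
    then have tJ: "t \<in> J" using f(2) by blast
    let ?U = "fst (chart_at A (f t))" and ?\<phi> = "chart_map A (f t)"
    note ch = chart_at_mem[OF plot_in[OF f(1) tJ]]
    let ?\<Phi> = "\<lambda>(p, u). (?\<phi> p, frechet_derivative (?\<phi> \<circ> chart_inv A p) (at (chart_map A p p)) u)"
    let ?F = "\<lambda>s. (?\<phi> (f s), frechet_derivative (\<lambda>r. ?\<phi> (f r)) (at s) 1)"
    have mem: "(?U \<times> UNIV, ?\<Phi>) \<in> tangent_atlas A"
      unfolding tangent_atlas_def by (rule image_eqI[OF _ ch(1)]) simp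
    obtain r where r: "r > 0" "ball t r \<subseteq> {s\<in>J. f s \<in> ?U}"
      using plot_chart_open[OF f(1) ch(1)] tJ ch(2) open_contains_ball by (metis (mono_tags, lifting) mem_Collect_eq)
    have C: "Cinf_on (ball t r) (\<lambda>s. ?\<phi> (f s))" using Cinf_on_subset[OF plot_chart[OF f(1) ch(1)] r(2)] .
    have F: "Cinf_on (ball t r) ?F"
      by (rule Cinf_on_Pair[OF open_ball C Cinf_on_frechet_derivative[OF C]])
    have eq: "?\<Phi> (curve_deriv A c s) = ?F s" if "s \<in> {0..1} \<inter> ball t r" for s
    proof -
      have s: "s \<in> {0..1}" "s \<in> J" "f s \<in> ?U" using that r(2) by auto
      show ?thesis
        using frechet_derivative_chart[OF f(1) ch(1) s(2,3), of 1] cd[OF s(1)] c(2)[OF s(1)] by (simp add: o_def)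
    qed
    have "smooth_on ({0..1} \<inter> ball t r) (?\<Phi> \<circ> curve_deriv A c)"
      unfolding smooth_on_def
      by (intro ballI exI[of _ "ball t r"] exI[of _ ?F]) (use F eq in \<open>auto simp: Cinf_on_def\<close>)
    moreover have "curve_deriv A c ` ({0..1} \<inter> ball t r) \<subseteq> ?U \<times> UNIV"
    proof (rule image_subsetI)
      fix s assume s: "s \<in> {0..1} \<inter> ball t r"
      then have "f s \<in> ?U" using r(2) by blast
      then show "curve_deriv A c s \<in> ?U \<times> UNIV" using s cd[of s] c(2)[of s] by simp
    qed
    ultimately show "\<exists>(U, \<phi>)\<in>tangent_atlas A. \<exists>\<epsilon>>0. curve_deriv A c ` ({0..1} \<inter> ball t \<epsilon>) \<subseteq> U \<and>
        smooth_on ({0..1} \<inter> ball t \<epsilon>) (\<phi> \<circ> curve_deriv A c)"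
      using r(1) by (intro bexI[OF _ mem] case_prodI exI[of _ r]) auto
  qed
  then show "curve_deriv A c \<in> smooth_curves (tangent_atlas A)"
    unfolding smooth_curves_def by (simp add: curve_deriv_def)
qed

lemma (in reductive) rho_theta_curve_deriv:
  assumes c: "c \<in> smooth_curves_from B c\<^sub>0"
  shows "rho G A c\<^sub>0 (theta B (omega G A H B \<mm>) (curve_deriv B c)) = c"
proof -
  have c': "smooth_curve B {0..1} c" "c \<in> extensional {0..1}" "c 0 = c\<^sub>0"
    using c by (auto simp: smooth_curves_from_def smooth_curves_def)
  obtain e f where f: "e > 0" "plot B {-e<..<1+e} f" "\<And>t. t \<in> {0..1} \<Longrightarrow> f t = c t"
    using B.smooth_curve_extension[OF c'(1)] by metis
  let ?J = "{-e<..<1+e}"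
  have J: "{0..1} \<subseteq> ?J" using f(1) by auto
  define q where "q t = omega G A H B \<mm> (f t, pder B f t 1)" for t
  have q: "Cinf_on ?J q" unfolding q_def by (rule Cinf_on_omega[OF f(2)])
  have cd: "curve_deriv B c \<in> smooth_curves (tangent_atlas B)"
    by (rule B.curve_deriv_smooth(1)[OF f(2) J c'(2)]) (rule f(3))
  have cd_eq: "curve_deriv B c t = (c t, pder B f t 1)" if "t \<in> {0..1}" for t
    by (rule B.curve_deriv_smooth(2)[OF f(2) J c'(2) _ that]) (rule f(3))
  have "theta B (omega G A H B \<mm>) (curve_deriv B c) = (\<lambda>t\<in>{0..1}. omega G A H B \<mm> (curve_deriv B c t))"
    using cd by (simp add: theta_def)
  also have "\<dots> = restrict q {0..1}"
  proof (rule restrict_ext)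
    show "omega G A H B \<mm> (curve_deriv B c t) = q t" if "t \<in> {0..1}" for t
      unfolding cd_eq[OF that] q_def f(3)[OF that] by (rule refl)
  qed
  finally have th: "theta B (omega G A H B \<mm>) (curve_deriv B c) = restrict q {0..1}" .
  \<comment> \<open>\<open>q\<close> was built from the extended curve \<open>f\<close>, so it is
    itself the smooth extension to an open interval that \<open>smooth_on\<close> asks for;
    \<open>rho\<close> may therefore be evaluated at the restriction.\<close>
  have "smooth_on {0..1} (restrict q {0..1})"
    unfolding smooth_on_def
    by (intro ballI exI[of _ ?J] exI[of _ q]) (use q J in \<open>auto simp: Cinf_on_def\<close>)
  then have qv: "restrict q {0..1} \<in> smooth_vcurves" by (simp add: smooth_vcurves_def)
  obtain e' g where g: "e' > 0" "plot A {0-e'<..<1+e'} g" "{0-e'<..<1+e'} \<subseteq> ?J" "g 0 = \<one>"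
    "\<And>t. t \<in> {0-e'<..<1+e'} \<Longrightarrow> pder A g t 1 = tderiv A A (\<lambda>x. x \<otimes> g t) \<one> (q t)"
    using right_log_derivative_exists[of ?J 0 1 q] J q by (metis open_greaterThanLessThan zero_le_one)
  let ?I = "{0-e'<..<1+e'}"
  have I: "{0..1} \<subseteq> ?I" using g(1) by auto
  have ev: "Evol G A (restrict q {0..1}) = restrict g {0..1}"
    by (rule Evol_eq[OF g(2) I g(4)]) (use g(5) I in \<open>simp add: subset_iff\<close>)
  have fI: "plot B ?I f" using plot_subset[OF f(2) _ g(3)] by simp
  have flow: "quot_act G (g t) c\<^sub>0 = c t" if t: "t \<in> {0..1}" for t
  proof -
    have z: "(0::real) \<in> {0..1}" by simp
    have fB: "f t \<in> points_of B" "f 0 \<in> points_of B" using plot_in[OF fI] I t z by blast+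
    have gt: "g t \<in> carrier G" using plot_carrier[OF g(2)] I t by blast
    have "quot_act G (inv (g t)) (f t) = quot_act G (inv (g 0)) (f 0)"
      \<comment> \<open>\<open>tderiv_act_omega\<close> supplies the differential equation for
        \<open>f\<close>; the equation for \<open>g\<close> holds by construction, with the same
        \<open>q\<close>.\<close>
      by (rule act.act_inverse_flow_constant[OF g(2) fI I _ _ _ t z, of q])
        (use g(5) I plot_in[OF fI] in \<open>auto simp: q_def tderiv_act_omega is_interval_cc subset_iff\<close>)
    then have "quot_act G (inv (g t)) (c t) = c\<^sub>0"
      using act.act_one[OF fB(2)] f(3)[OF t] f(3)[OF z] c'(3) g(4) by simp
    then show ?thesis
      using act.act_mult[OF gt inv_closed[OF gt] fB(1)] act.act_one[OF fB(1)] gt f(3)[OF t] by simp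
  qed
  have "rho G A c\<^sub>0 (restrict q {0..1}) = (\<lambda>t\<in>{0..1}. quot_act G (restrict g {0..1} t) c\<^sub>0)"
    using qv by (simp add: rho_def ev)
  also have "\<dots> = c"
    by (rule extensionalityI[OF restrict_extensional c'(2)]) (simp add: flow)
  finally show ?thesis unfolding th .
qed

theorem proposition17:
  fixes G :: "('g, 'b) monoid_scheme"
    and A :: "('g, 'e::banach) atlas"
    and H :: "'g set"
    and B :: "('g set, 'f::banach) atlas"
    and \<mm> :: "'e set"
    and c\<^sub>0 :: "'g set"
  assumes "lie_group G A"
    and "closed_lie_subgroup G A H"
    and "homogeneous_space G A H B"
    and "reductive_complement G A H \<mm>"
    and "c\<^sub>0 \<in> points_of B"
  shows "restrict (rho G A c\<^sub>0 \<circ> theta B (omega G A H B \<mm>) \<circ> curve_deriv B) (smooth_curves_from B c\<^sub>0)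
    = restrict id (smooth_curves_from B c\<^sub>0)"
proof -
  interpret lie_group G A by fact
  interpret B: smooth_manifold B using assms(3) by (simp add: homogeneous_space_def)
  interpret reductive G A B H \<mm>
    by (intro reductive.intro homogeneous.intro homogeneous_axioms.intro reductive_axioms.intro
        lie_group_axioms B.charted_axioms)
      (use assms(2-4) in \<open>auto simp: closed_lie_subgroup_def homogeneous_space_def\<close>)
  show ?thesis by (intro restrict_ext) (simp add: rho_theta_curve_deriv)
qed

end
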